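(* Let $K\subset T=\{(x,y)\in\mathbb{R}^2: 0\le x\le y\}$ be a compact set with $\min\{x:(x,y)\in K\}>0$, and let $E=\{\xi\in\mathbb{R}^{2\times 2}: (\lambda_1(\xi),\lambda_2(\xi))\in K\}$. Let $\Omega\subset\mathbb{R}^2$ be an open set. Let $\varphi\in C^1_{piec}(\overline{\Omega};\mathbb{R}^2)$ be such that $D\varphi(x)\in E\cup \operatorname{int}\operatorname{Rco}E$ for a.e. $x\in\Omega$. Then there exists a map $u\in\varphi+W^{1,\infty}_0(\Omega;\mathbb{R}^2)$ such that $Du(x)\in E$ for a.e. $x\in\Omega$.
   Context: For $\xi\in\mathbb{R}^{2\times2}$, $0\le\lambda_1(\xi)\le\lambda_2(\xi)$ denote the singular values of $\xi$, i.e. the eigenvalues of $\sqrt{\xi\xi^t}$. A function $f:\mathbb{R}^{2\times2}\to\mathbb{R}\cup\{+\infty\}$ is rank one convex if $f(tA+(1-t)B)\le tf(A)+(1-t)f(B)$ for all $t\in[0,1]$ and all $A,B\in\mathbb{R}^{2\times2}$ with $\operatorname{rank}(A-B)\le1$. The rank one convex hull of $E\subseteq\mathbb{R}^{2\times2}$ is $$\operatorname{Rco}E=\{\xi\in\mathbb{R}^{2\times2}: f(\xi)\le0 \text{ for every rank one convex } f:\mathbb{R}^{2\times2}\to\mathbb{R}\cup\{+\infty\}\text{ with } f|_E\le0\}.$$ Equivalently, $\operatorname{Rco}E=\bigcup_{i\in\mathbb{N}}\mathrm{R}_i\mathrm{co}E$, where $\mathrm{R}_0\mathrm{co}E=E$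 and $\mathrm{R}_{i+1}\mathrm{co}E=\{tA+(1-t)B: A,B\in\mathrm{R}_i\mathrm{co}E,\ \operatorname{rank}(A-B)\le1,\ t\in[0,1]\}$. (No closure is taken.) $\operatorname{int}$ denotes the topological interior in $\mathbb{R}^{2\times2}$. $C^1_{piec}(\overline\Omega;\mathbb{R}^2)$ is the set of piecewise $C^1$ maps: maps $\varphi$ continuous on $\overline\Omega$ and weakly differentiable in $\Omega$ for which there is an at most countable family of disjoint open sets $\Omega_k\subseteq\Omega$ with $\Omega\setminus\bigcup_k\Omega_k$ of Lebesgue measure zero and $\varphi\in C^1(\overline{\Omega_k};\mathbb{R}^2)$ for each $k$. $W^{1,\infty}_0(\Omega;\mathbb{R}^2)$ is the set of maps in $W^{1,\infty}(\Omega;\mathbb{R}^2)$ with zero boundary values, i.e. whose continuous representative $w$ satisfies $w(x)\to0$ as $x\to x_0$, $x\in\Omega$, for every $x_0\in\partial\Omega$ (for bounded $\Omega$ this is $W^{1,\infty}\cap W^{1,1}_0$). $Du$ denotes the weak gradient. *)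

theory Defs
  imports "HOL-Analysis.Analysis"
begin

definition psd_matrix :: "real^2^2 \<Rightarrow> bool" where
  "psd_matrix S \<longleftrightarrow> transpose S = S \<and> (\<forall>v. 0 \<le> v \<bullet> (S *v v))"

text \<open>Well defined on positive semidefinite matrices, by uniqueness of the positive
  semidefinite square root.\<close>

definition matrix_sqrt :: "real^2^2 \<Rightarrow> real^2^2" where
  "matrix_sqrt A = (THE S. psd_matrix S \<and> S ** S = A)"

definition eigenvalues :: "real^2^2 \<Rightarrow> real set" where
  "eigenvalues A = {\<mu>. \<exists>v. v \<noteq> 0 \<and> A *v v = \<mu> *\<^sub>R v}"

text \<open>A symmetric 2x2 matrix has one or two distinct real eigenvalues. Counted with
  multiplicity and in increasing order, they are the minimum and the maximum of this
  set.\<close>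

definition sv1 :: "real^2^2 \<Rightarrow> real" where
  "sv1 \<xi> = Min (eigenvalues (matrix_sqrt (\<xi> ** transpose \<xi>)))"

definition sv2 :: "real^2^2 \<Rightarrow> real" where
  "sv2 \<xi> = Max (eigenvalues (matrix_sqrt (\<xi> ** transpose \<xi>)))"

text \<open>In \<^typ>\<open>ereal\<close> we have \<open>0 * \<infinity> = 0\<close>, the usual convention of convex analysis.\<close>

definition rank_one_convex :: "(real^2^2 \<Rightarrow> ereal) \<Rightarrow> bool" where
  "rank_one_convex f \<longleftrightarrow>
     (\<forall>A. f A \<noteq> -\<infinity>) \<and>
     (\<forall>A B. \<forall>t\<in>{0..1}. rank (A - B) \<le> 1 \<longrightarrow>
        f (t *\<^sub>R A + (1 - t) *\<^sub>R B) \<le> ereal t * f A + ereal (1 - t) * f B)"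

definition Rco :: "(real^2^2) set \<Rightarrow> (real^2^2) set" where
  "Rco E = {\<xi>. \<forall>f. rank_one_convex f \<and> (\<forall>A\<in>E. f A \<le> 0) \<longrightarrow> f \<xi> \<le> 0}"

definition partial :: "2 \<Rightarrow> (real^2 \<Rightarrow> real) \<Rightarrow> real^2 \<Rightarrow> real" where
  "partial j \<psi> x = frechet_derivative \<psi> (at x) (axis j 1)"

primrec Ck :: "nat \<Rightarrow> (real^2 \<Rightarrow> real) \<Rightarrow> bool" where
  "Ck 0 \<psi> \<longleftrightarrow> continuous_on UNIV \<psi>"
| "Ck (Suc k) \<psi> \<longleftrightarrow> (\<forall>x. \<psi> differentiable (at x)) \<and> (\<forall>j. Ck k (partial j \<psi>))"

definition test_function :: "(real^2) set \<Rightarrow> (real^2 \<Rightarrow> real) \<Rightarrow> bool" where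
  "test_function \<Omega> \<psi> \<longleftrightarrow>
     (\<forall>k. Ck k \<psi>) \<and> (\<exists>C. compact C \<and> C \<subseteq> \<Omega> \<and> (\<forall>x. x \<notin> C \<longrightarrow> \<psi> x = 0))"

definition locally_integrable ::
  "(real^2) set \<Rightarrow> (real^2 \<Rightarrow> 'b::euclidean_space) \<Rightarrow> bool" where
  "locally_integrable \<Omega> f \<longleftrightarrow>
     (\<forall>C. compact C \<and> C \<subseteq> \<Omega> \<longrightarrow> set_integrable lebesgue C f)"

text \<open>Maps on \<open>\<Omega>\<close> are total functions whose values outside \<open>\<Omega>\<close> (or its closure) are
  irrelevant. The entry \<open>G x $ i $ j\<close> is the weak derivative of the \<open>i\<close>-th component in
  direction \<open>j\<close>; \<open>G\<close> is determined up to a null subset of \<open>\<Omega>\<close>.\<close>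

definition has_weak_gradient ::
  "(real^2) set \<Rightarrow> (real^2 \<Rightarrow> real^2) \<Rightarrow> (real^2 \<Rightarrow> real^2^2) \<Rightarrow> bool" where
  "has_weak_gradient \<Omega> u G \<longleftrightarrow>
     locally_integrable \<Omega> u \<and> locally_integrable \<Omega> G \<and>
     (\<forall>\<psi> i j. test_function \<Omega> \<psi> \<longrightarrow>
        (LINT x:\<Omega>|lebesgue. u x $ i * partial j \<psi> x)
        = - (LINT x:\<Omega>|lebesgue. G x $ i $ j * \<psi> x))"

text \<open>\<open>C\<^sup>1\<close> up to the boundary: \<open>\<phi>\<close> is \<open>C\<^sup>1\<close> in the open set \<open>U\<close>, and \<open>\<phi>\<close> and its
  gradient extend continuously to the closure (the extension of \<open>\<phi>\<close> being \<open>\<phi>\<close> itself).\<close>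

definition C1_closure :: "(real^2) set \<Rightarrow> (real^2 \<Rightarrow> real^2) \<Rightarrow> bool" where
  "C1_closure U \<phi> \<longleftrightarrow>
     continuous_on (closure U) \<phi> \<and>
     (\<exists>G :: real^2 \<Rightarrow> real^2^2. continuous_on (closure U) G \<and>
        (\<forall>x\<in>U. (\<phi> has_derivative (\<lambda>h. G x *v h)) (at x)))"

definition C1_piec :: "(real^2) set \<Rightarrow> (real^2 \<Rightarrow> real^2) \<Rightarrow> bool" where
  "C1_piec \<Omega> \<phi> \<longleftrightarrow>
     continuous_on (closure \<Omega>) \<phi> \<and>
     (\<exists>G. has_weak_gradient \<Omega> \<phi> G) \<and>
     (\<exists>\<F>. countable \<F> \<and> disjoint \<F> \<and>
        (\<forall>U\<in>\<F>. open U \<and> U \<subseteq> \<Omega> \<and> C1_closure U \<phi>) \<and>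
        negligible (\<Omega> - \<Union>\<F>))"

definition Linf :: "(real^2) set \<Rightarrow> (real^2 \<Rightarrow> 'b::euclidean_space) \<Rightarrow> bool" where
  "Linf \<Omega> f \<longleftrightarrow>
     f \<in> borel_measurable (lebesgue_on \<Omega>) \<and> (\<exists>M. AE x in lebesgue_on \<Omega>. norm (f x) \<le> M)"

definition W1inf :: "(real^2) set \<Rightarrow> (real^2 \<Rightarrow> real^2) set" where
  "W1inf \<Omega> = {w. Linf \<Omega> w \<and> (\<exists>G. has_weak_gradient \<Omega> w G \<and> Linf \<Omega> G)}"

text \<open>Here \<open>v\<close> is the continuous representative of \<open>w\<close>.\<close>

definition W1inf_zero :: "(real^2) set \<Rightarrow> (real^2 \<Rightarrow> real^2) set" where
  "W1inf_zero \<Omega> = {w \<in> W1inf \<Omega>. \<exists>v. continuous_on \<Omega> v \<and>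
     (AE x in lebesgue_on \<Omega>. v x = w x) \<and>
     (\<forall>x0\<in>frontier \<Omega>. (v \<longlongrightarrow> 0) (at x0 within \<Omega>))}"

end

theory Submission
  imports Defs
begin

text \<open>The inclusion is solved by convex integration.

  Let \<open>H\<close> be the set of all matrices obtained from \<open>E\<close> by finitely many splittings along rank one segments, and let
  \<open>U\<close> be its interior. Since \<open>H\<close> contains \<open>Rco E\<close> (\<open>Rco_subset_lamination_hull\<close>), it suffices to correct \<open>\<phi>\<close> on
  the open set where its gradient is an interior point of \<open>Rco E\<close>, hence a point of \<open>U\<close>; elsewhere the gradient is
  already in \<open>E\<close>.

  The geometric input is that contraction by a factor \<open>s < 1\<close> maps \<open>H\<close> into \<open>U\<close> (\<open>scaled_lamination_hull_interior\<close>).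
  A matrix \<open>A\<close> in \<open>U\<close> is \<open>s\<close> times a point of \<open>H\<close> for some \<open>s\<close> close to 1, so it is produced from \<open>s E\<close>, a set close to
  \<open>E\<close>, by finitely many splittings that never leave \<open>U\<close>. This rests on the explicit fact that all matrices with
  singular values at most \<open>x\<close> and \<open>y\<close> are laminates of those with singular values \<open>x\<close> and \<open>y\<close>, and on \<open>x > 0\<close>.

  The analytic input is that a single splitting is realised by a map on a disc that oscillates quickly in one
  direction and has zero boundary values (\<open>lamination_block\<close>). Superposing such maps on finer and finer discs
  gives, for each \<open>A\<close> in \<open>U\<close> and each \<open>\<epsilon> > 0\<close>, a perturbation of the linear map \<open>A\<close> with zero boundary values whose
  gradient stays in \<open>U\<close> and is on average \<open>\<epsilon>\<close>-close to \<open>E\<close> (\<open>interior_hull_approximable\<close>). Filling an open set with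
  small discs transfers this from constant matrices to continuous gradient fields (\<open>approximable_patch\<close>).

  Repeating the correction with \<open>\<epsilon>\<close> tending to 0 gives maps that converge uniformly. As \<open>E\<close> is not convex,
  weak convergence of the gradients does not suffice. They converge strongly: on each small disc a correction has a gradient of mean zero,
  while all earlier gradients are almost constant there. Hence the gradients have almost orthogonal increments, and
  being bounded they form a Cauchy sequence in \<open>L\<^sup>2\<close> (\<open>almost_orthogonal_increments_Cauchy\<close>,
  \<open>exact_solution_bounded\<close>).

  The construction works with the classical gradient of \<open>\<phi>\<close> on the pieces where \<open>\<phi>\<close> is continuously differentiable.
  It agrees almost everywhere with the given weak gradient by the du Bois-Reymond lemma (\<open>du_Bois_Reymond\<close>).\<close>

section \<open>Conformal coordinates and singular values\<close>

text \<open>Identify the plane with the complex numbers. Every real linear map is \<open>z \<mapsto> a z + b cnj z\<close> for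
  unique \<open>a\<close> and \<open>b\<close>, its conformal and anticonformal parts. The determinant is \<open>|a|^2 - |b|^2\<close> and the
  singular values are \<open>||a| - |b||\<close> and \<open>|a| + |b|\<close>, so in these coordinates both the rank one condition
  and the set \<open>E\<close> involve only moduli.\<close>

definition conformal_part :: "real^2^2 \<Rightarrow> complex" where
  "conformal_part A = Complex ((A$1$1 + A$2$2) / 2) ((A$2$1 - A$1$2) / 2)"

definition anticonformal_part :: "real^2^2 \<Rightarrow> complex" where
  "anticonformal_part A = Complex ((A$1$1 - A$2$2) / 2) ((A$2$1 + A$1$2) / 2)"

definition of_parts :: "complex \<Rightarrow> complex \<Rightarrow> real^2^2" where
  "of_parts a b = vector [vector [Re a + Re b, Im b - Im a], vector [Im a + Im b, Re a - Re b]]"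

lemma parts_of_parts [simp]:
  "conformal_part (of_parts a b) = a" "anticonformal_part (of_parts a b) = b"
  by (simp_all add: conformal_part_def anticonformal_part_def of_parts_def complex_eq_iff)

lemma of_parts_parts [simp]: "of_parts (conformal_part A) (anticonformal_part A) = A"
  by (simp add: conformal_part_def anticonformal_part_def of_parts_def vec_eq_iff forall_2 field_simps)

lemma of_parts_eq_iff: "of_parts a b = of_parts c d \<longleftrightarrow> a = c \<and> b = d"
  by (metis parts_of_parts)

lemma matrix_mult_of_parts:
  "of_parts a b ** of_parts c d = of_parts (a * c + b * cnj d) (a * d + b * cnj c)"
  by (simp add: of_parts_def vec_eq_iff forall_2 matrix_matrix_mult_def sum_2 algebra_simps)

lemma transpose_of_parts: "transpose (of_parts a b) = of_parts (cnj a) b"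
  by (simp add: of_parts_def vec_eq_iff forall_2 transpose_def)

lemma of_parts_lincomb:
  "s *\<^sub>R of_parts a b + t *\<^sub>R of_parts c d = of_parts (s *\<^sub>R a + t *\<^sub>R c) (s *\<^sub>R b + t *\<^sub>R d)"
  by (simp add: of_parts_def vec_eq_iff forall_2 algebra_simps)

lemma of_parts_scale: "s *\<^sub>R of_parts a b = of_parts (s *\<^sub>R a) (s *\<^sub>R b)"
  by (simp add: of_parts_def vec_eq_iff forall_2 algebra_simps)

lemma of_parts_diff: "of_parts a b - of_parts c d = of_parts (a - c) (b - d)"
  by (simp add: of_parts_def vec_eq_iff forall_2 algebra_simps)

lemma det_of_parts: "det (of_parts a b) = (norm a)\<^sup>2 - (norm b)\<^sup>2"
  unfolding cmod_power2 by (simp add: of_parts_def det_2 power2_eq_square algebra_simps)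

lemma norm_of_parts: "(norm (of_parts a b))\<^sup>2 = 2 * ((norm a)\<^sup>2 + (norm b)\<^sup>2)"
  unfolding cmod_power2 power2_norm_eq_inner
  by (simp add: inner_vec_def sum_2 of_parts_def power2_eq_square algebra_simps)

lemma continuous_on_parts [continuous_intros]:
  fixes f :: "'a::topological_space \<Rightarrow> real^2^2"
  assumes "continuous_on X f"
  shows "continuous_on X (\<lambda>x. conformal_part (f x))" "continuous_on X (\<lambda>x. anticonformal_part (f x))"
  unfolding conformal_part_def anticonformal_part_def Complex_eq
  by (intro continuous_intros assms; simp)+

text \<open>The quadratic form of \<open>z \<mapsto> a z + b cnj z\<close> is \<open>Re a |z|^2 + Re (cnj b z^2)\<close>, and for fixed \<open>|z|\<close> the
  second term takes all values between \<open>- |b| |z|^2\<close> and \<open>|b| |z|^2\<close>.\<close>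

lemma psd_of_parts:
  "psd_matrix (of_parts a b) \<longleftrightarrow> Im a = 0 \<and> norm b \<le> Re a"
proof -
  have quad: "v \<bullet> (of_parts a b *v v)
      = Re a * (norm (Complex (v$1) (v$2)))\<^sup>2 + Re (cnj b * (Complex (v$1) (v$2))\<^sup>2)" for v :: "real^2"
    unfolding cmod_power2
    by (simp add: of_parts_def matrix_vector_mult_def inner_vec_def sum_2
        power2_eq_square algebra_simps)
  have sym: "transpose (of_parts a b) = of_parts a b \<longleftrightarrow> Im a = 0"
    by (auto simp: transpose_of_parts of_parts_eq_iff complex_eq_iff)
  have pos: "(\<forall>v :: real^2. 0 \<le> v \<bullet> (of_parts a b *v v)) \<longleftrightarrow> norm b \<le> Re a"
  proof
    assume R: "norm b \<le> Re a"
    show "\<forall>v :: real^2. 0 \<le> v \<bullet> (of_parts a b *v v)"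
    proof
      fix v :: "real^2"
      let ?z = "Complex (v$1) (v$2)"
      have "\<bar>Re (cnj b * ?z\<^sup>2)\<bar> \<le> norm (cnj b * ?z\<^sup>2)"
        by (rule abs_Re_le_cmod)
      also have "\<dots> = norm b * (norm ?z)\<^sup>2"
        by (simp add: norm_mult norm_power)
      also have "\<dots> \<le> Re a * (norm ?z)\<^sup>2"
        using R by (simp add: mult_right_mono)
      finally show "0 \<le> v \<bullet> (of_parts a b *v v)"
        unfolding quad by linarith
    qed
  next
    assume L: "\<forall>v :: real^2. 0 \<le> v \<bullet> (of_parts a b *v v)"
    \<comment> \<open>Test with the vector on which the anticonformal part acts as \<open>- norm b\<close>.\<close>
    define z where "z = csqrt (- b)"
    have z2: "z\<^sup>2 = - b" by (simp add: z_def)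
    have nz: "(norm z)\<^sup>2 = norm b"
      by (metis z2 norm_minus_cancel norm_power)
    have "0 \<le> Re a * (norm z)\<^sup>2 + Re (cnj b * z\<^sup>2)"
      using L[rule_format, of "vector [Re z, Im z]"] unfolding quad by simp
    also have "Re (cnj b * z\<^sup>2) = - (norm b)\<^sup>2"
      unfolding z2 cmod_power2 by (simp add: power2_eq_square)
    finally have *: "(norm b)\<^sup>2 \<le> Re a * norm b" using nz by simp
    show "norm b \<le> Re a"
    proof (cases "b = 0")
      case False
      then show ?thesis using * by (simp add: power2_eq_square)
    next
      case True
      have "0 \<le> Re a * (norm (1::complex))\<^sup>2 + Re (cnj b * 1\<^sup>2)"
        using L[rule_format, of "vector [1, 0]"] unfolding quad
        by (simp add: cmod_power2)
      then show ?thesis using True by simp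
    qed
  qed
  show ?thesis unfolding psd_matrix_def using sym pos by blast
qed

lemma eigenvalues_symmetric:
  "eigenvalues (of_parts (of_real p) q) = {p - norm q, p + norm q}"
proof -
  have "\<mu> \<in> eigenvalues (of_parts (of_real p) q) \<longleftrightarrow> \<bar>p - \<mu>\<bar> = norm q" for \<mu>
  proof -
    let ?A = "of_parts (of_real p) q"
    have shift: "?A *v v - \<mu> *\<^sub>R v = of_parts (of_real (p - \<mu>)) q *v v" for v :: "real^2"
      by (simp add: of_parts_def vec_eq_iff forall_2 matrix_vector_mult_def sum_2 algebra_simps)
    have "\<mu> \<in> eigenvalues ?A \<longleftrightarrow> (\<exists>v. v \<noteq> 0 \<and> of_parts (of_real (p - \<mu>)) q *v v = 0)"
      unfolding eigenvalues_def shift[symmetric] by simp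
    also have "\<dots> \<longleftrightarrow> det (of_parts (of_real (p - \<mu>)) q) = 0"
      using invertible_det_nz[of "of_parts (of_real (p - \<mu>)) q"]
      unfolding invertible_left_inverse matrix_left_invertible_ker by auto
    also have "\<dots> \<longleftrightarrow> \<bar>p - \<mu>\<bar> = norm q"
      unfolding det_of_parts norm_of_real
      using power2_eq_iff_nonneg[of "\<bar>p - \<mu>\<bar>" "norm q"] by auto
    finally show ?thesis .
  qed
  moreover have "\<bar>p - \<mu>\<bar> = norm q \<longleftrightarrow> \<mu> \<in> {p - norm q, p + norm q}" for \<mu>
    using norm_ge_zero[of q] by (simp add: abs_if del: norm_ge_zero) linarith
  ultimately show ?thesis
    by blast
qed

text \<open>With parts \<open>a\<close>, \<open>b\<close> of \<open>A\<close>, the matrix \<open>A A\<^sup>t\<close> has parts \<open>|a|^2 + |b|^2\<close> and \<open>2 a b\<close>, while the square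
  of the symmetric matrix with parts \<open>p\<close>, \<open>q\<close> has parts \<open>p^2 + |q|^2\<close> and \<open>2 p q\<close>. Comparing moduli
  determines \<open>p + |q|\<close> and \<open>p - |q|\<close> up to sign, and semidefiniteness, \<open>|q| \<le> p\<close>, fixes the signs. This gives
  existence and uniqueness of the root, as the definite description in \<open>matrix_sqrt\<close> demands.\<close>

lemma matrix_sqrt_gram:
  obtains p q where "matrix_sqrt (A ** transpose A) = of_parts (of_real p) q"
    "p = max (norm (conformal_part A)) (norm (anticonformal_part A))"
    "norm q = min (norm (conformal_part A)) (norm (anticonformal_part A))"
proof -
  define a b where "a = conformal_part A" and "b = anticonformal_part A"
  have A: "A = of_parts a b" by (simp add: a_def b_def)
  define p where "p = max (norm a) (norm b)"
  define m where "m = min (norm a) (norm b)"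
  define q where "q = a * b / of_real p"
  have pm: "p * m = norm a * norm b" "p\<^sup>2 + m\<^sup>2 = (norm a)\<^sup>2 + (norm b)\<^sup>2" "0 \<le> m" "m \<le> p"
    by (auto simp: p_def m_def max_def min_def)
  have p0: "a = 0 \<and> b = 0" if "p = 0"
    using that by (auto simp: p_def max_def split: if_splits)
  have q: "norm q = m"
  proof (cases "p = 0")
    case True then show ?thesis using p0 by (simp add: q_def m_def)
  next
    case False
    then show ?thesis using pm
      by (simp add: q_def norm_mult norm_divide field_simps)
  qed
  have pq: "of_real p * q = a * b"
    using p0 by (cases "p = 0") (auto simp: q_def)
  have gram: "A ** transpose A = of_parts (of_real (p\<^sup>2 + m\<^sup>2)) (2 * (a * b))"
    unfolding A transpose_of_parts matrix_mult_of_parts of_parts_eq_iff pm of_real_add complex_norm_square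
    by (simp add: algebra_simps)
  have sq: "of_parts (of_real r) s ** of_parts (of_real r) s
      = of_parts (of_real (r\<^sup>2 + (norm s)\<^sup>2)) (2 * (of_real r * s))" for r s
    unfolding matrix_mult_of_parts of_parts_eq_iff of_real_add complex_norm_square
    by (simp add: power2_eq_square algebra_simps)
  have "matrix_sqrt (A ** transpose A) = of_parts (of_real p) q"
    unfolding matrix_sqrt_def
  proof (rule the_equality)
    show "psd_matrix (of_parts (of_real p) q) \<and>
        of_parts (of_real p) q ** of_parts (of_real p) q = A ** transpose A"
      unfolding gram sq psd_of_parts using pm q pq by simp
  next
    fix S assume S: "psd_matrix S \<and> S ** S = A ** transpose A"
    define r s where "r = Re (conformal_part S)" and "s = anticonformal_part S"
    have rs: "Im (conformal_part S) = 0" "norm s \<le> r"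
      using S psd_of_parts[of "conformal_part S" "anticonformal_part S"]
      by (auto simp: r_def s_def)
    have Seq: "S = of_parts (of_real r) s"
      using rs of_parts_parts[of S] by (metis complex_is_Real_iff of_real_Re r_def s_def)
    have 1: "of_real (r\<^sup>2 + (norm s)\<^sup>2) = (of_real (p\<^sup>2 + m\<^sup>2) :: complex)" and 2: "of_real r * s = a * b"
      using S unfolding Seq sq gram of_parts_eq_iff by auto
    have 1: "r\<^sup>2 + (norm s)\<^sup>2 = p\<^sup>2 + m\<^sup>2" using 1 of_real_eq_iff by blast
    have r0: "0 \<le> r" using rs norm_ge_zero order_trans by blast
    have 3: "r * norm s = p * m"
      using arg_cong[OF 2, of norm] r0 pm by (simp add: norm_mult)
    have "(r + norm s)\<^sup>2 = (p + m)\<^sup>2" "(r - norm s)\<^sup>2 = (p - m)\<^sup>2"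
      using 1 3 by (simp_all add: power2_sum power2_diff)
    then have "r + norm s = p + m" "r - norm s = p - m"
      using rs r0 pm by (simp_all add: power2_eq_iff_nonneg)
    then have rp: "r = p" "norm s = m" by auto
    have "s = q"
    proof (cases "p = 0")
      case True
      then show ?thesis using rp rs q pm by (metis norm_eq_zero order_antisym)
    next
      case False
      then show ?thesis using 2 pq rp by (metis mult_cancel_left of_real_eq_0_iff)
    qed
    then show "S = of_parts (of_real p) q" using Seq rp by simp
  qed
  then show thesis using that q unfolding p_def m_def a_def b_def by blast
qed

lemma sv1_parts: "sv1 A = \<bar>norm (conformal_part A) - norm (anticonformal_part A)\<bar>"
proof (rule matrix_sqrt_gram[of A])
  fix p q assume *: "matrix_sqrt (A ** transpose A) = of_parts (of_real p) q"
    "p = max (norm (conformal_part A)) (norm (anticonformal_part A))"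
    "norm q = min (norm (conformal_part A)) (norm (anticonformal_part A))"
  show ?thesis
    unfolding sv1_def *(1) eigenvalues_symmetric *(2,3) by (auto simp: max_def min_def)
qed

lemma sv2_parts: "sv2 A = norm (conformal_part A) + norm (anticonformal_part A)"
proof (rule matrix_sqrt_gram[of A])
  fix p q assume *: "matrix_sqrt (A ** transpose A) = of_parts (of_real p) q"
    "p = max (norm (conformal_part A)) (norm (anticonformal_part A))"
    "norm q = min (norm (conformal_part A)) (norm (anticonformal_part A))"
  show ?thesis
    unfolding sv2_def *(1) eigenvalues_symmetric *(2,3) by (auto simp: max_def min_def)
qed

section \<open>Lamination hulls\<close>

text \<open>The union of the iterated hulls \<open>R\<^sub>i co E\<close>, without closure. For 2x2 matrices, rank at most one is the
  vanishing of the determinant.\<close>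

inductive_set lamination_hull :: "(real^2^2) set \<Rightarrow> (real^2^2) set" for E where
  base: "A \<in> E \<Longrightarrow> A \<in> lamination_hull E"
| step: "\<lbrakk>A \<in> lamination_hull E; B \<in> lamination_hull E; det (A - B) = 0; 0 \<le> t; t \<le> 1\<rbrakk>
    \<Longrightarrow> t *\<^sub>R A + (1 - t) *\<^sub>R B \<in> lamination_hull E"

text \<open>The function that is 0 on the lamination hull and infinite elsewhere is rank one convex, precisely
  because the hull is closed under taking points of rank one segments. From here on \<open>Rco\<close> is replaced by the
  lamination hull, whose points can be reached by induction over finitely many splittings.\<close>

lemma Rco_subset_lamination_hull: "Rco E \<subseteq> lamination_hull E"
proof
  fix X assume X: "X \<in> Rco E"
  define f :: "real^2^2 \<Rightarrow> ereal" where "f A = (if A \<in> lamination_hull E then 0 else \<infinity>)" for A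
  have "rank_one_convex f"
    unfolding rank_one_convex_def
  proof (intro conjI allI ballI impI)
    fix A show "f A \<noteq> -\<infinity>" by (simp add: f_def)
  next
    fix A B :: "real^2^2" and t :: real assume t: "t \<in> {0..1}" and r: "rank (A - B) \<le> 1"
    have d: "det (A - B) = 0"
      using r by (subst det_eq_0_rank) simp
    show "f (t *\<^sub>R A + (1 - t) *\<^sub>R B) \<le> ereal t * f A + ereal (1 - t) * f B"
    proof (cases "t = 0 \<or> t = 1")
      case True then show ?thesis by (auto simp: f_def)
    next
      case False
      then have t': "0 < t" "t < 1" using t by auto
      show ?thesis
        using lamination_hull.step[of A E B t] t' d
        by (auto simp: f_def)
    qed
  qed
  moreover have "\<forall>A\<in>E. f A \<le> 0" by (auto simp: f_def lamination_hull.base)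
  ultimately have "f X \<le> 0" using X by (auto simp: Rco_def)
  then show "X \<in> lamination_hull E" by (auto simp: f_def split: if_splits)
qed

lemma lamination_hull_subset_convex:
  assumes "convex C" "E \<subseteq> C" shows "lamination_hull E \<subseteq> C"
proof
  fix A assume "A \<in> lamination_hull E"
  then show "A \<in> C"
    by induction (use assms in \<open>auto simp: convex_def\<close>)
qed

text \<open>The rank one condition is invariant under translating both end points by the same matrix, so equal balls
  around the end points sweep out a ball around each point of the segment.\<close>

lemma interior_lamination_hull_segment:
  assumes "A \<in> interior (lamination_hull E)" "B \<in> interior (lamination_hull E)"
    and d: "det (A - B) = 0" and t: "0 \<le> t" "t \<le> 1"
  shows "t *\<^sub>R A + (1 - t) *\<^sub>R B \<in> interior (lamination_hull E)"
proof -
  obtain r1 where r1: "r1 > 0" "ball A r1 \<subseteq> lamination_hull E"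
    using assms(1) mem_interior by blast
  obtain r2 where r2: "r2 > 0" "ball B r2 \<subseteq> lamination_hull E"
    using assms(2) mem_interior by blast
  define r where "r = min r1 r2"
  have "ball (t *\<^sub>R A + (1 - t) *\<^sub>R B) r \<subseteq> lamination_hull E"
  proof
    fix X assume X: "X \<in> ball (t *\<^sub>R A + (1 - t) *\<^sub>R B) r"
    define h where "h = X - (t *\<^sub>R A + (1 - t) *\<^sub>R B)"
    have h: "norm h < r" using X by (simp add: h_def dist_norm norm_minus_commute)
    have "A + h \<in> lamination_hull E" "B + h \<in> lamination_hull E"
      using h r1 r2 by (auto simp: r_def dist_norm subset_iff)
    then have "t *\<^sub>R (A + h) + (1 - t) *\<^sub>R (B + h) \<in> lamination_hull E"
      using d t by (intro lamination_hull.step) auto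
    moreover have "t *\<^sub>R (A + h) + (1 - t) *\<^sub>R (B + h) = X"
      by (simp add: h_def algebra_simps)
    ultimately show "X \<in> lamination_hull E" by simp
  qed
  moreover have "r > 0" using r1 r2 by (simp add: r_def)
  ultimately show ?thesis using mem_interior by blast
qed

definition singular_value_set :: "(real \<times> real) set \<Rightarrow> (real^2^2) set" where
  "singular_value_set K = {\<xi>. (sv1 \<xi>, sv2 \<xi>) \<in> K}"

lemma of_parts_mem_singular_value_set:
  "of_parts a b \<in> singular_value_set K \<longleftrightarrow> (\<bar>norm a - norm b\<bar>, norm a + norm b) \<in> K"
  by (simp add: singular_value_set_def sv1_parts sv2_parts)

lemma closed_singular_value_set:
  assumes "closed K" shows "closed (singular_value_set K)"
proof -
  have "closed ((\<lambda>\<xi>. (sv1 \<xi>, sv2 \<xi>)) -` K)"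
    using assms
    by (intro closed_vimage) (auto simp: sv1_parts sv2_parts intro!: continuous_intros)
  then show ?thesis by (simp add: singular_value_set_def vimage_def)
qed

lemma norm_le_sv:
  "norm (\<xi> :: real^2^2) \<le> 2 * sv2 \<xi>"
proof -
  have "(norm \<xi>)\<^sup>2 = 2 * ((norm (conformal_part \<xi>))\<^sup>2 + (norm (anticonformal_part \<xi>))\<^sup>2)"
    using norm_of_parts[of "conformal_part \<xi>" "anticonformal_part \<xi>"] by simp
  also have "\<dots> \<le> (2 * sv2 \<xi>)\<^sup>2"
    by (simp add: sv2_parts power2_sum power_mult_distrib)
  finally show ?thesis
    by (rule power2_le_imp_le) (simp add: sv2_parts)
qed

lemma bounded_singular_value_set:
  assumes "bounded K" shows "bounded (singular_value_set K)"
proof -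
  obtain R where R: "\<And>p. p \<in> K \<Longrightarrow> norm p \<le> R"
    using assms by (auto simp: bounded_iff)
  have "norm \<xi> \<le> 2 * R" if "\<xi> \<in> singular_value_set K" for \<xi>
  proof -
    have "sv2 \<xi> \<le> norm (sv1 \<xi>, sv2 \<xi>)"
      by (metis norm_snd_le abs_ge_self order_trans real_norm_def snd_conv)
    then show ?thesis
      using R[of "(sv1 \<xi>, sv2 \<xi>)"] that norm_le_sv[of \<xi>]
      by (auto simp: singular_value_set_def)
  qed
  then show ?thesis by (auto simp: bounded_iff)
qed

lemma singular_value_set_nonempty:
  assumes "(x, y) \<in> K" "0 \<le> x" "x \<le> y" shows "singular_value_set K \<noteq> {}"
proof -
  have "of_parts (of_real ((y + x) / 2)) (of_real ((y - x) / 2)) \<in> singular_value_set K"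
    using assms unfolding of_parts_mem_singular_value_set norm_of_real
    by (simp add: abs_if field_simps)
  then show ?thesis by blast
qed

text \<open>Fix the phases of the two parts. The matrices with signed singular values \<open>s\<close>, \<open>r\<close> then form a plane in
  which the determinant of a difference is \<open>(s - s') (r - r')\<close>, so that segments parallel to the axes are
  rank one. The four corners of the rectangle \<open>[-y, y] \<times> [-x, x]\<close> have singular values \<open>x\<close>, \<open>y\<close>; splitting
  in one direction gives two edges, and splitting in the other direction the whole rectangle.\<close>

lemma below_singular_values_mem_lamination_hull:
  assumes K: "(x, y) \<in> K" "0 \<le> x" "x \<le> y" "0 < x"
    and a: "\<bar>norm a - norm b\<bar> \<le> x" "norm a + norm b \<le> y"
  shows "of_parts a b \<in> lamination_hull (singular_value_set K)"
proof -
  let ?L = "lamination_hull (singular_value_set K)"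
  obtain u where u: "norm u = 1" "a = norm a *\<^sub>R u"
    by (cases "a = 0") (force intro: that[of 1] that[of "a /\<^sub>R norm a"])+
  obtain v where v: "norm v = 1" "b = norm b *\<^sub>R v"
    by (cases "b = 0") (force intro: that[of 1] that[of "b /\<^sub>R norm b"])+
  \<comment> \<open>\<open>D s r\<close> is the matrix with signed singular values \<open>s\<close>, \<open>r\<close> and phases \<open>u\<close>, \<open>v\<close>.\<close>
  define D where "D s r = of_parts (((s + r) / 2) *\<^sub>R u) (((s - r) / 2) *\<^sub>R v)" for s r
  have comb: "t *\<^sub>R D s r + (1 - t) *\<^sub>R D s' r'
      = D (t * s + (1 - t) * s') (t * r + (1 - t) * r')" for t s r s' r'
    unfolding D_def of_parts_lincomb by (simp add: of_parts_eq_iff flip: scaleR_left_distrib)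
      (simp add: algebra_simps add_divide_distrib diff_divide_distrib)
  have det: "det (D s r - D s' r') = (s - s') * (r - r')" for s r s' r'
    unfolding D_def of_parts_diff det_of_parts scaleR_left_diff_distrib[symmetric] norm_scaleR u v
    by (simp add: power2_eq_square field_simps)
  have corner: "D s r \<in> ?L" if "\<bar>s\<bar> = y" "\<bar>r\<bar> = x" for s r
  proof -
    have sr: "s = y \<or> s = - y" "r = x \<or> r = - x"
      using that by (auto simp: abs_if split: if_splits)
    have "\<bar>\<bar>(s + r) / 2\<bar> - \<bar>(s - r) / 2\<bar>\<bar> = x"
      using sr K by (elim disjE) (simp_all add: abs_if field_simps)
    moreover have "\<bar>(s + r) / 2\<bar> + \<bar>(s - r) / 2\<bar> = y"
      using sr K by (elim disjE) (simp_all add: abs_if field_simps)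
    ultimately have "(\<bar>\<bar>(s + r) / 2\<bar> - \<bar>(s - r) / 2\<bar>\<bar>, \<bar>(s + r) / 2\<bar> + \<bar>(s - r) / 2\<bar>) \<in> K"
      using K by simp
    then show ?thesis
      unfolding D_def
      by (intro lamination_hull.base) (simp only: of_parts_mem_singular_value_set norm_scaleR u v mult_1_right)
  qed
  have interp: "\<exists>t. 0 \<le> t \<and> t \<le> 1 \<and> c = t * m + (1 - t) * (- m)" if "\<bar>c\<bar> \<le> m" "0 < m" for c m :: real
  proof -
    define t where "t = (c + m) / (2 * m)"
    have "0 \<le> c + m" "c + m \<le> 2 * m" using that by linarith+
    then have "0 \<le> t" "t \<le> 1" using that by (simp_all add: t_def)
    moreover have "c = t * m + (1 - t) * (- m)"
      using that by (simp add: t_def field_simps)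
    ultimately show ?thesis by blast
  qed
  have edge: "D s r \<in> ?L" if "\<bar>s\<bar> = y" and r: "\<bar>r\<bar> \<le> x" for s r
  proof -
    obtain t where t: "0 \<le> t" "t \<le> 1" "r = t * x + (1 - t) * (- x)"
      using interp[OF r] K by auto
    have "t *\<^sub>R D s x + (1 - t) *\<^sub>R D s (- x) \<in> ?L"
      using that t K by (intro lamination_hull.step corner) (auto simp: det)
    then show ?thesis unfolding comb t(3)[symmetric] by (simp flip: distrib_right)
  qed
  have "D s r \<in> ?L" if s: "\<bar>s\<bar> \<le> y" and "\<bar>r\<bar> \<le> x" for s r
  proof -
    obtain t where t: "0 \<le> t" "t \<le> 1" "s = t * y + (1 - t) * (- y)"
      using interp[OF s] K by auto
    have "t *\<^sub>R D y r + (1 - t) *\<^sub>R D (- y) r \<in> ?L"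
      using that t K by (intro lamination_hull.step edge) (auto simp: det)
    then show ?thesis unfolding comb t(3)[symmetric] by (simp flip: distrib_right)
  qed
  from this[of "norm a + norm b" "norm a - norm b"] a
  have "D (norm a + norm b) (norm a - norm b) \<in> ?L" by auto
  also have "D (norm a + norm b) (norm a - norm b) = of_parts a b"
    unfolding D_def using u v by simp
  finally show ?thesis .
qed

text \<open>This is where the positivity of the smaller singular value is used: contraction makes both singular
  values strictly smaller, which is an open condition, and the matrices satisfying it are laminates.\<close>

lemma scaled_singular_value_set_interior:
  assumes K: "\<And>x y. (x, y) \<in> K \<Longrightarrow> 0 < x \<and> x \<le> y"
    and \<xi>: "\<xi> \<in> singular_value_set K" and s: "0 < s" "s < 1"
  shows "s *\<^sub>R \<xi> \<in> interior (lamination_hull (singular_value_set K))"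
proof -
  define x y where "x = sv1 \<xi>" and "y = sv2 \<xi>"
  have xy: "(x, y) \<in> K" using \<xi> by (simp add: x_def y_def singular_value_set_def)
  define V where "V = {\<eta>. sv1 \<eta> < x \<and> sv2 \<eta> < y}"
  have "open V"
    unfolding V_def sv1_parts sv2_parts
    by (intro open_Collect_conj open_Collect_less continuous_intros)
  moreover have "V \<subseteq> lamination_hull (singular_value_set K)"
  proof
    fix \<eta> assume "\<eta> \<in> V"
    then have "of_parts (conformal_part \<eta>) (anticonformal_part \<eta>) \<in> lamination_hull (singular_value_set K)"
      using K[OF xy] by (intro below_singular_values_mem_lamination_hull[OF xy])
        (auto simp: V_def sv1_parts sv2_parts)
    then show "\<eta> \<in> lamination_hull (singular_value_set K)" by simp
  qed
  moreover have "s *\<^sub>R \<xi> \<in> V"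
  proof -
    have "s *\<^sub>R \<xi> = of_parts (s *\<^sub>R conformal_part \<xi>) (s *\<^sub>R anticonformal_part \<xi>)"
      unfolding of_parts_scale[symmetric] by simp
    then have "sv1 (s *\<^sub>R \<xi>) = s * x" "sv2 (s *\<^sub>R \<xi>) = s * y"
      using s unfolding x_def y_def sv1_parts sv2_parts
      by (simp_all add: abs_mult distrib_left flip: right_diff_distrib)
    then show ?thesis using K[OF xy] s by (simp add: V_def)
  qed
  ultimately show ?thesis using interior_maximal by blast
qed

text \<open>Thus a splitting sequence that produces a point of the hull, multiplied by \<open>s < 1\<close>, starts close to \<open>E\<close> and
  stays in the interior throughout. This plays the role of an in-approximation in convex integration.\<close>

lemma scaled_lamination_hull_interior:
  assumes K: "\<And>x y. (x, y) \<in> K \<Longrightarrow> 0 < x \<and> x \<le> y"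
    and "A \<in> lamination_hull (singular_value_set K)" and s: "0 < s" "s < 1"
  shows "s *\<^sub>R A \<in> interior (lamination_hull (singular_value_set K))"
  using assms(2)
proof induction
  case (base A)
  then show ?case using scaled_singular_value_set_interior K s by blast
next
  case (step A B t)
  have "det (s *\<^sub>R A - s *\<^sub>R B) = 0"
    using step(3) by (simp add: det_2 flip: scaleR_diff_right)
  then have "t *\<^sub>R (s *\<^sub>R A) + (1 - t) *\<^sub>R (s *\<^sub>R B)
      \<in> interior (lamination_hull (singular_value_set K))"
    using step by (intro interior_lamination_hull_segment) auto
  then show ?case by (simp add: algebra_simps)
qed

lemma det_zero_rank_one:
  fixes M :: "real^2^2"
  assumes "det M = 0"
  obtains a n :: "real^2" where "\<And>i j. M $ i $ j = a $ i * n $ j"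
proof (cases "M $ 1 = 0")
  case True
  show thesis
    by (rule that[of "axis 2 1" "M $ 2"]) (use True in \<open>auto simp: axis_def vec_eq_iff, metis exhaust_2\<close>)
next
  case False
  show thesis
  proof (cases "M $ 1 $ 1 = 0")
    case True
    then have "M$1$2 \<noteq> 0" using False by (auto simp: vec_eq_iff forall_2)
    have 0: "M$2$1 = 0" using assms True \<open>M$1$2 \<noteq> 0\<close> by (simp add: det_2)
    have "\<forall>i j. M $ i $ j = (vector [1, M$2$2 / M$1$2] :: real^2) $ i * (M $ 1) $ j"
      using True 0 \<open>M$1$2 \<noteq> 0\<close> by (simp add: forall_2)
    then show thesis by (intro that) blast
  next
    case False
    have "\<forall>i j. M $ i $ j = (vector [1, M$2$1 / M$1$1] :: real^2) $ i * (M $ 1) $ j"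
      using False assms by (simp add: forall_2 det_2 field_simps)
    then show thesis by (intro that) blast
  qed
qed

section \<open>Weak gradients of compactly supported perturbations\<close>

lemma lborel_integral_affine:
  fixes f :: "'a::euclidean_space \<Rightarrow> 'b::{banach, second_countable_topology}"
  assumes [measurable]: "f \<in> borel_measurable borel" and c: "c \<noteq> 0"
  shows "(\<integral>x. f x \<partial>lborel) = \<bar>c\<bar> ^ DIM('a) *\<^sub>R (\<integral>x. f (t + c *\<^sub>R x) \<partial>lborel)"
proof -
  have "(\<integral>x. f x \<partial>lborel) = (\<integral>x. f x \<partial>density (distr lborel borel (\<lambda>x. t + c *\<^sub>R x)) (\<lambda>_. ennreal (\<bar>c\<bar>^DIM('a))))"
    by (subst lborel_affine[OF c, of t]) simp
  also have "\<dots> = (\<integral>x. \<bar>c\<bar> ^ DIM('a) *\<^sub>R f x \<partial>distr lborel borel (\<lambda>x. t + c *\<^sub>R x))"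
    by (rule integral_density) auto
  also have "\<dots> = (\<integral>x. \<bar>c\<bar> ^ DIM('a) *\<^sub>R f (t + c *\<^sub>R x) \<partial>lborel)"
    by (rule integral_distr) auto
  finally show ?thesis by simp
qed

lemma borel_measurable_vec_nth' [measurable (raw)]:
  fixes f :: "'c \<Rightarrow> ('b::topological_space)^'n"
  shows "f \<in> borel_measurable M \<Longrightarrow> (\<lambda>x. f x $ i) \<in> borel_measurable M"
  by (rule borel_measurable_continuous_on[of "\<lambda>y. y $ i"]) (auto intro!: continuous_intros)

lemma AE_lborel_negligible:
  assumes "negligible N" "\<And>x. x \<notin> N \<Longrightarrow> P x"
  shows "AE x in lborel. P x"
  unfolding AE_completion_iff[where M=lborel, symmetric]
  by (rule AE_I'[of N]) (use assms in \<open>auto simp: negligible_iff_null_sets\<close>)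

lemma integrable_bounded_support:
  fixes f :: "'a::euclidean_space \<Rightarrow> 'b::{banach, second_countable_topology}"
  assumes "f \<in> borel_measurable borel" "bounded D" "\<And>x. x \<notin> D \<Longrightarrow> f x = 0"
    and "\<And>x. norm (f x) \<le> M"
  shows "integrable lborel f"
proof -
  obtain R where R: "D \<subseteq> ball 0 R" using \<open>bounded D\<close> bounded_subset_ballD by blast
  then have "f x = 0" if "x \<notin> ball 0 R" for x using that assms(3) by blast
  then show ?thesis
    using assms emeasure_lborel_ball_finite[of 0 R]
    by (intro integrableI_bounded_set[where A="ball 0 R" and B=M]) (auto intro!: AE_I2)
qed

lemma integrable_mult_bounded_support:
  fixes f :: "'a::euclidean_space \<Rightarrow> real"
  assumes "f \<in> borel_measurable borel" "bounded D" "\<And>x. x \<notin> D \<Longrightarrow> f x = 0"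
    and "\<And>x. \<bar>f x\<bar> \<le> M" and "continuous_on UNIV \<psi>"
  shows "integrable lborel (\<lambda>x. f x * \<psi> x)"
proof -
  have "compact (\<psi> ` closure D)"
    using assms by (intro compact_continuous_image)
      (auto intro: continuous_on_subset)
  then obtain B where B: "\<And>x. x \<in> closure D \<Longrightarrow> \<bar>\<psi> x\<bar> \<le> B"
    by (force dest!: compact_imp_bounded simp: bounded_iff)
  have "\<bar>f x * \<psi> x\<bar> \<le> \<bar>M\<bar> * \<bar>B\<bar>" for x
  proof (cases "x \<in> D")
    case True
    then have "x \<in> closure D" using closure_subset by blast
    then show ?thesis unfolding abs_mult
      using B[of x] assms(4)[of x] by (intro mult_mono) auto
  qed (use assms in auto)
  then show ?thesis
    using assms
    by (intro integrable_bounded_support[where D=D and M="\<bar>M\<bar> * \<bar>B\<bar>"] borel_measurable_times)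
      (auto intro: borel_measurable_continuous_onI)
qed

text \<open>The difference quotients of \<open>f\<close> have integral zero by translation invariance, and the Lipschitz bound
  allows passing to the limit. All integrations by parts below are instances of this lemma, applied to a
  product of the map in question with a test function.\<close>

lemma integral_gradient_zero:
  fixes f :: "'a::euclidean_space \<Rightarrow> real"
  assumes lip: "\<And>x y. \<bar>f x - f y\<bar> \<le> L * norm (x - y)"
    and supp: "\<And>x. x \<notin> ball 0 R \<Longrightarrow> f x = 0"
    and der: "AE x in lborel. (f has_derivative (\<lambda>h. g x \<bullet> h)) (at x)"
    and g: "g \<in> borel_measurable borel"
  shows "(\<integral>x. g x \<bullet> e \<partial>lborel) = 0"
proof -
  define t where "t n = inverse (real (Suc n))" for n
  have t: "t n > 0" "t n \<le> 1" for n by (auto simp: t_def inverse_le_1_iff)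
  have t0: "t \<longlonglongrightarrow> 0" unfolding t_def using LIMSEQ_inverse_real_of_nat by simp
  have "continuous_on UNIV f"
    unfolding continuous_on_iff
  proof (intro ballI allI impI)
    fix x :: 'a and \<epsilon> :: real assume "\<epsilon> > 0"
    moreover have "\<bar>f y - f x\<bar> < \<epsilon>" if "dist y x < \<epsilon> / (\<bar>L\<bar> + 1)" for y
    proof -
      have "\<bar>f y - f x\<bar> \<le> (\<bar>L\<bar> + 1) * norm (y - x)"
        using lip[of y x] by (rule order_trans) (intro mult_right_mono, auto)
      also have "\<dots> < \<epsilon>" using that by (simp add: dist_norm field_simps)
      finally show ?thesis .
    qed
    ultimately show "\<exists>d>0. \<forall>x'\<in>UNIV. dist x' x < d \<longrightarrow> dist (f x') (f x) < \<epsilon>"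
      by (intro exI[of _ "\<epsilon> / (\<bar>L\<bar> + 1)"]) (auto simp: dist_real_def)
  qed
  then have fm [measurable]: "f \<in> borel_measurable borel" by (rule borel_measurable_continuous_onI)
  have bdf: "\<bar>f x\<bar> \<le> \<bar>L\<bar> * (norm x + \<bar>R\<bar>)" for x
  proof (cases "x \<in> ball 0 R")
    case True
    obtain b :: 'a where b: "norm b = \<bar>R\<bar>" using vector_choose_size[of "\<bar>R\<bar>"] by auto
    have "\<bar>f x\<bar> \<le> L * norm (x - b)" using lip[of x b] supp[of b] b by simp
    also have "\<dots> \<le> \<bar>L\<bar> * norm (x - b)" by (intro mult_right_mono) auto
    also have "\<dots> \<le> \<bar>L\<bar> * (norm x + \<bar>R\<bar>)" using b norm_triangle_ineq4[of x b] by (intro mult_left_mono) auto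
    finally show ?thesis .
  qed (use supp in auto)
  have fint: "integrable lborel f"
  proof (rule integrable_bounded_support[where D="ball 0 R"])
    fix x show "norm (f x) \<le> \<bar>L\<bar> * (2 * \<bar>R\<bar>)"
    proof (cases "x \<in> ball 0 R")
      case True
      then have "\<bar>L\<bar> * (norm x + \<bar>R\<bar>) \<le> \<bar>L\<bar> * (2 * \<bar>R\<bar>)" by (intro mult_left_mono) auto
      then show ?thesis using bdf[of x] by simp
    qed (use supp in auto)
  qed (use supp in auto)
  have shift: "(\<integral>x. f (x + c) \<partial>lborel) = (\<integral>x. f x \<partial>lborel)"
    "integrable lborel (\<lambda>x. f (x + c))" for c
  proof -
    show "(\<integral>x. f (x + c) \<partial>lborel) = (\<integral>x. f x \<partial>lborel)"
      using lborel_integral_affine[of f 1 c] by (simp add: add.commute)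
    have "integrable (distr lborel borel ((+) c)) f" using fint by (simp add: lborel_distr_plus)
    then show "integrable lborel (\<lambda>x. f (x + c))"
      by (subst (asm) integrable_distr_eq) (auto simp: add.commute)
  qed
  define s where "s n x = (f (x + t n *\<^sub>R e) - f x) / t n" for n x
  have [measurable]: "s n \<in> borel_measurable borel" for n unfolding s_def by measurable
  have int0: "(\<integral>x. s n x \<partial>lborel) = 0" for n
    unfolding s_def using shift[of "t n *\<^sub>R e"] fint by simp
  have "(\<lambda>n. \<integral>x. s n x \<partial>lborel) \<longlonglongrightarrow> (\<integral>x. g x \<bullet> e \<partial>lborel)"
  proof (rule integral_dominated_convergence)
    show "(\<lambda>x. g x \<bullet> e) \<in> borel_measurable lborel" using g by measurable
    show "s n \<in> borel_measurable lborel" for n by simp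
    let ?w = "\<lambda>x. indicator (ball 0 (R + norm e)) x *\<^sub>R (\<bar>L\<bar> * norm e)"
    show "integrable lborel ?w"
      by (intro integrable_bounded_support[where D="ball 0 (R + norm e)" and M="\<bar>L\<bar> * norm e"] borel_measurable_scaleR borel_measurable_indicator borel_measurable_const)
        (auto split: split_indicator)
    show "AE x in lborel. norm (s n x) \<le> ?w x" for n
    proof (rule AE_I2)
      fix x
      show "norm (s n x) \<le> ?w x"
      proof (cases "x \<in> ball 0 (R + norm e)")
        case True
        have "\<bar>f (x + t n *\<^sub>R e) - f x\<bar> \<le> L * (t n * norm e)"
          using lip[of "x + t n *\<^sub>R e" x] t[of n] by simp
        also have "\<dots> \<le> \<bar>L\<bar> * (t n * norm e)" using t(1)[of n] by (intro mult_right_mono) auto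
        finally show ?thesis using True t(1)[of n] by (simp add: s_def abs_divide field_simps)
      next
        case False
        have "t n * norm e \<le> norm e" using t[of n] by (simp add: mult_left_le_one_le)
        then have "norm (x + t n *\<^sub>R e) \<ge> R" "norm x \<ge> R"
          using False norm_triangle_ineq4[of "x + t n *\<^sub>R e" "t n *\<^sub>R e"] t(1)[of n] norm_ge_zero[of e]
          by (auto simp del: norm_ge_zero)
        then have "f (x + t n *\<^sub>R e) = 0" "f x = 0" by (auto intro!: supp)
        then show ?thesis using False by (simp add: s_def)
      qed
    qed
    show "AE x in lborel. (\<lambda>n. s n x) \<longlonglongrightarrow> g x \<bullet> e"
      using der
    proof eventually_elim
      case (elim x)
      have "((\<lambda>r. (f (x + r *\<^sub>R e) - f x) / r) \<longlongrightarrow> g x \<bullet> e) (at 0)"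
      proof -
        have lim: "((\<lambda>r::real. x + r *\<^sub>R e) has_derivative (\<lambda>r. r *\<^sub>R e)) (at 0)"
          by (auto intro!: derivative_eq_intros)
        have "((\<lambda>r. f (x + r *\<^sub>R e)) has_derivative (\<lambda>r. g x \<bullet> (r *\<^sub>R e))) (at 0)"
          using diff_chain_at[OF lim, of f "\<lambda>h. g x \<bullet> h"] elim by (simp add: o_def)
        then have "((\<lambda>r. f (x + r *\<^sub>R e)) has_field_derivative (g x \<bullet> e)) (at 0)"
          unfolding has_field_derivative_def by (simp add: mult.commute[of _ "g x \<bullet> e"] mult_commute_abs)
        then show ?thesis unfolding has_field_derivative_iff by simp
      qed
      moreover have "filterlim t (at 0) sequentially"
        unfolding filterlim_at using t0 t(1) by (auto simp: less_imp_neq[symmetric] eventually_sequentially intro!: exI[of _ 0])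
      ultimately show ?case
        unfolding s_def by (rule filterlim_compose)
    qed
  qed
  then show ?thesis using int0 LIMSEQ_unique by (auto simp: LIMSEQ_const_iff)
qed

definition has_continuous_gradient :: "(real^2 \<Rightarrow> real) \<Rightarrow> (real^2 \<Rightarrow> real^2) \<Rightarrow> bool" where
  "has_continuous_gradient \<psi> d \<longleftrightarrow>
     continuous_on UNIV d \<and> (\<forall>x. (\<psi> has_derivative (\<lambda>h. d x \<bullet> h)) (at x))"

text \<open>The test functions are all continuously differentiable functions, without restriction on their support.
  For \<open>w\<close> of bounded support this is the usual notion on the plane, and taking \<open>\<psi> = 1\<close> shows at once that the
  gradient of such a map has mean zero.\<close>

definition weak_gradient :: "(real^2 \<Rightarrow> real^2) \<Rightarrow> (real^2 \<Rightarrow> real^2^2) \<Rightarrow> bool" where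
  "weak_gradient w G \<longleftrightarrow> (\<forall>\<psi> d i j. has_continuous_gradient \<psi> d \<longrightarrow>
     (\<integral>x. w x $ i * d x $ j \<partial>lborel) = - (\<integral>x. G x $ i $ j * \<psi> x \<partial>lborel))"

definition perturbation :: "(real^2) set \<Rightarrow> (real^2 \<Rightarrow> real^2) \<Rightarrow> (real^2 \<Rightarrow> real^2^2) \<Rightarrow> bool" where
  "perturbation D w G \<longleftrightarrow> continuous_on UNIV w \<and> (\<forall>x. x \<notin> D \<longrightarrow> w x = 0 \<and> G x = 0) \<and>
     G \<in> borel_measurable borel \<and> (\<exists>M. \<forall>x. norm (G x) \<le> M) \<and> weak_gradient w G"

text \<open>A substitute for piecewise affine maps: the gradient is only required to be continuous on an open subset
  \<open>D'\<close> of full measure. Near a point of \<open>D'\<close> it is almost constant, which is all that is needed to superpose a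
  finer perturbation designed for a constant gradient. As \<open>G\<close> vanishes off \<open>D'\<close>, bounds on its
  values can be stated for all points instead of almost all.\<close>

definition pw_perturbation ::
  "(real^2) set \<Rightarrow> (real^2) set \<Rightarrow> (real^2 \<Rightarrow> real^2) \<Rightarrow> (real^2 \<Rightarrow> real^2^2) \<Rightarrow> bool" where
  "pw_perturbation D D' w G \<longleftrightarrow> perturbation D w G \<and> open D' \<and> D' \<subseteq> D \<and> negligible (D - D') \<and>
     continuous_on D' G \<and> (\<forall>x. x \<notin> D' \<longrightarrow> G x = 0)"

lemma has_continuous_gradientD:
  assumes "has_continuous_gradient \<psi> d"
  shows "continuous_on UNIV \<psi>" "continuous_on UNIV d" "continuous_on UNIV (\<lambda>x. d x $ j)"
proof -
  have "isCont \<psi> x" for x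
    using assms has_derivative_continuous unfolding has_continuous_gradient_def by blast
  then show "continuous_on UNIV \<psi>" by (simp add: continuous_at_imp_continuous_on)
  show "continuous_on UNIV d" "continuous_on UNIV (\<lambda>x. d x $ j)"
    using assms by (auto simp: has_continuous_gradient_def intro!: continuous_intros)
qed

lemma perturbationD:
  assumes "perturbation D w G"
  shows "continuous_on UNIV w" "\<And>x. x \<notin> D \<Longrightarrow> w x = 0" "\<And>x. x \<notin> D \<Longrightarrow> G x = 0"
    "G \<in> borel_measurable borel" "weak_gradient w G" "w \<in> borel_measurable borel"
  using assms by (auto simp: perturbation_def intro: borel_measurable_continuous_onI)

lemma perturbation_bounded:
  assumes "perturbation D w G" "bounded D"
  obtains M where "\<And>x. norm (G x) \<le> M" "\<And>x. norm (w x) \<le> M"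
proof -
  obtain M1 where M1: "\<And>x. norm (G x) \<le> M1" using assms by (auto simp: perturbation_def)
  have "compact (w ` closure D)"
    using assms by (intro compact_continuous_image)
      (auto intro: continuous_on_subset dest: perturbationD)
  then obtain M2 where M2: "\<And>x. x \<in> closure D \<Longrightarrow> norm (w x) \<le> M2"
    by (force dest!: compact_imp_bounded simp: bounded_iff)
  have "norm (w x) \<le> max M1 \<bar>M2\<bar>" for x
  proof (cases "x \<in> D")
    case True
    then have "x \<in> closure D" using closure_subset by blast
    then show ?thesis using M2[of x] by auto
  qed (use perturbationD(2)[OF assms(1)] in auto)
  moreover have "norm (G x) \<le> max M1 \<bar>M2\<bar>" for x using M1[of x] by auto
  ultimately show thesis using that by blast
qed

lemma perturbation_integrable:
  assumes "perturbation D w G" "bounded D" "continuous_on UNIV \<psi>"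
  shows "integrable lborel (\<lambda>x. w x $ i * \<psi> x)" "integrable lborel (\<lambda>x. G x $ i $ j * \<psi> x)"
    "integrable lborel G"
proof -
  obtain M where M: "\<And>x. norm (G x) \<le> M" "\<And>x. norm (w x) \<le> M"
    using perturbation_bounded[OF assms(1,2)] by blast
  note D = perturbationD[OF assms(1)]
  have [measurable]: "G \<in> borel_measurable borel" "w \<in> borel_measurable borel" using D by auto
  have "\<bar>w x $ i\<bar> \<le> M" for x using M(2)[of x] Finite_Cartesian_Product.norm_nth_le[of "w x" i] by simp
  then show "integrable lborel (\<lambda>x. w x $ i * \<psi> x)"
    using D assms by (intro integrable_mult_bounded_support[where D=D and M=M]) auto
  have "\<bar>G x $ i $ j\<bar> \<le> M" for x
    using M(1)[of x] Finite_Cartesian_Product.norm_nth_le[of "G x" i] Finite_Cartesian_Product.norm_nth_le[of "G x $ i" j] by simp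
  then show "integrable lborel (\<lambda>x. G x $ i $ j * \<psi> x)"
    using D assms by (intro integrable_mult_bounded_support[where D=D and M=M]) auto
  show "integrable lborel G"
    using D assms M by (intro integrable_bounded_support[where D=D and M=M]) auto
qed

text \<open>Zero boundary values force the mean of the gradient to vanish. This is the source of the orthogonality
  on which the convergence of the iteration rests.\<close>

lemma perturbation_integral_zero:
  assumes "perturbation D w G" "bounded D"
  shows "(\<integral>x. G x \<bullet> A \<partial>lborel) = 0"
proof -
  have "has_continuous_gradient (\<lambda>_. 1) (\<lambda>_. 0)"
    by (auto simp: has_continuous_gradient_def)
  then have "(\<integral>x. G x $ i $ j \<partial>lborel) = 0" for i j
    using perturbationD(5)[OF assms(1)] unfolding weak_gradient_def by fastforce
  moreover have "integrable lborel (\<lambda>x. G x $ i $ j)" for i j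
    using perturbation_integrable(2)[OF assms, of "\<lambda>_. 1"] by simp
  ultimately show ?thesis by (simp add: inner_vec_def sum_2)
qed

lemma weak_gradient_cong_AE:
  assumes "weak_gradient w G" "AE x in lborel. G x = G' x"
    "G \<in> borel_measurable borel" "G' \<in> borel_measurable borel"
  shows "weak_gradient w G'"
  unfolding weak_gradient_def
proof (intro allI impI)
  fix \<psi> d i j assume h: "has_continuous_gradient \<psi> d"
  have [measurable]: "G \<in> borel_measurable borel" "G' \<in> borel_measurable borel" "\<psi> \<in> borel_measurable borel"
    using assms has_continuous_gradientD(1)[OF h] by (auto intro: borel_measurable_continuous_onI)
  have "(\<integral>x. G x $ i $ j * \<psi> x \<partial>lborel) = (\<integral>x. G' x $ i $ j * \<psi> x \<partial>lborel)"
    using assms(2) by (intro integral_cong_AE) auto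
  then show "(\<integral>x. w x $ i * d x $ j \<partial>lborel) = - (\<integral>x. G' x $ i $ j * \<psi> x \<partial>lborel)"
    using assms(1)[unfolded weak_gradient_def, rule_format, OF h, of i j] by simp
qed

lemma perturbation_add:
  assumes "perturbation D w G" "perturbation D v H" "bounded D"
  shows "perturbation D (\<lambda>x. w x + v x) (\<lambda>x. G x + H x)"
proof -
  note D = perturbationD[OF assms(1)] perturbationD[OF assms(2)]
  obtain M1 where M1: "\<And>x. norm (G x) \<le> M1" using assms by (auto simp: perturbation_def)
  obtain M2 where M2: "\<And>x. norm (H x) \<le> M2" using assms by (auto simp: perturbation_def)
  have "norm (G x + H x) \<le> M1 + M2" for x
    using M1[of x] M2[of x] norm_triangle_ineq[of "G x" "H x"] by linarith
  moreover have "weak_gradient (\<lambda>x. w x + v x) (\<lambda>x. G x + H x)"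
    unfolding weak_gradient_def
  proof (intro allI impI)
    fix \<psi> d i j assume h: "has_continuous_gradient \<psi> d"
    note c = has_continuous_gradientD[OF h]
    show "(\<integral>x. (w x + v x) $ i * d x $ j \<partial>lborel) = - (\<integral>x. (G x + H x) $ i $ j * \<psi> x \<partial>lborel)"
      using D(5,11) h perturbation_integrable[OF assms(1,3) c(1)] perturbation_integrable[OF assms(1,3) c(3)]
        perturbation_integrable[OF assms(2,3) c(1)] perturbation_integrable[OF assms(2,3) c(3)]
      by (simp add: weak_gradient_def distrib_right)
  qed
  ultimately show ?thesis
    using D unfolding perturbation_def by (auto intro!: continuous_intros)
qed

text \<open>The second perturbation lives where the first gradient is continuous. Its exceptional null set is removed
  from the domain of continuity, so the gradient has to be reset to 0 there.\<close>

lemma pw_perturbation_add: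
  assumes 1: "pw_perturbation D D' w G" and 2: "pw_perturbation D' D'' v H" and "bounded D"
  shows "pw_perturbation D D'' (\<lambda>x. w x + v x) (\<lambda>x. if x \<in> D'' then G x + H x else 0)"
proof -
  have sub: "D'' \<subseteq> D'" "D' \<subseteq> D" and op: "open D''" using assms by (auto simp: pw_perturbation_def)
  have P2: "perturbation D v H"
    using 2 sub unfolding pw_perturbation_def perturbation_def by blast
  have add: "perturbation D (\<lambda>x. w x + v x) (\<lambda>x. G x + H x)"
    using 1 P2 assms by (intro perturbation_add) (auto simp: pw_perturbation_def)
  note A = perturbationD[OF add]
  let ?F = "\<lambda>x. if x \<in> D'' then G x + H x else 0"
  have meas: "?F \<in> borel_measurable borel"
    by (intro measurable_If_set A(4)) (use op in auto)
  have neg: "negligible (D - D'')"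
    using 1 2 negligible_subset[OF negligible_Un[of "D - D'" "D' - D''"]]
    by (auto simp: pw_perturbation_def)
  then have "AE x in lborel. G x + H x = ?F x"
    by (rule AE_lborel_negligible[where N="D - D''"]) (use A(3) in auto)
  then have wg: "weak_gradient (\<lambda>x. w x + v x) ?F"
    by (rule weak_gradient_cong_AE[OF A(5)]) (use A(4) meas in auto)
  obtain M where M: "\<And>x. norm (G x + H x) \<le> M" using add by (auto simp: perturbation_def)
  have "norm (?F x) \<le> \<bar>M\<bar>" for x using order_trans[OF M[of x] abs_ge_self] by simp
  then have "\<exists>M. \<forall>x. norm (?F x) \<le> M" by blast
  then have "perturbation D (\<lambda>x. w x + v x) ?F"
    unfolding perturbation_def using A(1,2) wg meas sub by auto
  moreover have "continuous_on D'' ?F"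
    using 1 2 sub continuous_on_subset[of D' G D'']
    by (subst continuous_on_cong[OF refl, of D'' _ "\<lambda>x. G x + H x"])
      (auto simp: pw_perturbation_def intro!: continuous_intros)
  ultimately show ?thesis
    using neg op sub by (auto simp: pw_perturbation_def)
qed

lemma pw_perturbation_zero: "open D \<Longrightarrow> pw_perturbation D D (\<lambda>_. 0) (\<lambda>_. 0)"
  by (auto simp: pw_perturbation_def perturbation_def weak_gradient_def intro!: exI[of _ 0])

text \<open>Rescaling about a point shrinks the map but leaves the values of the gradient unchanged.\<close>

lemma pw_perturbation_rescale:
  assumes "pw_perturbation (ball 0 1) D' w G" and r: "r > 0"
  shows "pw_perturbation (ball a r) ((\<lambda>x. a + r *\<^sub>R x) ` D')
     (\<lambda>x. r *\<^sub>R w ((x - a) /\<^sub>R r)) (\<lambda>x. G ((x - a) /\<^sub>R r))"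
proof -
  let ?T = "\<lambda>x::real^2. a + r *\<^sub>R x" and ?S = "\<lambda>x::real^2. (x - a) /\<^sub>R r"
  have TS: "?T (?S x) = x" "?S (?T x) = x" for x using r by simp_all
  have mem: "x \<in> ?T ` X \<longleftrightarrow> ?S x \<in> X" for x X
  proof
    assume "x \<in> ?T ` X"
    then obtain y where "y \<in> X" "x = ?T y" by blast
    then show "?S x \<in> X" using TS(2)[of y] by simp
  next
    assume "?S x \<in> X"
    then have "?T (?S x) \<in> ?T ` X" by (rule imageI)
    then show "x \<in> ?T ` X" unfolding TS .
  qed
  have ballT: "ball a r = ?T ` ball 0 1"
  proof -
    have "x \<in> ball a r \<longleftrightarrow> ?S x \<in> ball 0 1" for x
      using r by (simp add: dist_norm norm_minus_commute[of a x] divide_simps)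
    then show ?thesis using mem by blast
  qed
  have P: "perturbation (ball 0 1) w G" using assms by (simp add: pw_perturbation_def)
  note D = perturbationD[OF P]
  have [measurable]: "G \<in> borel_measurable borel" "w \<in> borel_measurable borel" using D by auto
  have wg: "weak_gradient (\<lambda>x. r *\<^sub>R w (?S x)) (\<lambda>x. G (?S x))"
    unfolding weak_gradient_def
  proof (intro allI impI)
    fix \<psi> d i j assume h: "has_continuous_gradient \<psi> d"
    have [measurable]: "\<psi> \<in> borel_measurable borel" "d \<in> borel_measurable borel"
      using has_continuous_gradientD[OF h] by (auto intro: borel_measurable_continuous_onI)
    have "has_continuous_gradient (\<lambda>x. \<psi> (?T x)) (\<lambda>x. r *\<^sub>R d (?T x))"
      unfolding has_continuous_gradient_def
    proof (intro conjI allI)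
      show "continuous_on UNIV (\<lambda>x. r *\<^sub>R d (?T x))"
        by (intro continuous_intros continuous_on_compose2[OF has_continuous_gradientD(2)[OF h]]) auto
      fix x
      have d: "(\<psi> has_derivative (\<lambda>h. d (?T x) \<bullet> h)) (at (?T x))"
        using h by (auto simp: has_continuous_gradient_def)
      have "(?T has_derivative (\<lambda>h. r *\<^sub>R h)) (at x)" by (auto intro!: derivative_eq_intros)
      from has_derivative_compose[of ?T _ x UNIV \<psi>, OF this d]
      show "((\<lambda>x. \<psi> (?T x)) has_derivative (\<lambda>h. (r *\<^sub>R d (?T x)) \<bullet> h)) (at x)"
        by simp
    qed
    then have wk: "(\<integral>x. w x $ i * (r *\<^sub>R d (?T x)) $ j \<partial>lborel) = - (\<integral>x. G x $ i $ j * \<psi> (?T x) \<partial>lborel)"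
      using D(5)[unfolded weak_gradient_def, rule_format, of "\<lambda>x. \<psi> (?T x)" "\<lambda>x. r *\<^sub>R d (?T x)" i j] by simp
    have "(\<integral>x. (r *\<^sub>R w (?S x)) $ i * d x $ j \<partial>lborel)
        = \<bar>r\<bar> ^ 2 *\<^sub>R (\<integral>x. (r *\<^sub>R w (?S (?T x))) $ i * d (?T x) $ j \<partial>lborel)"
      by (subst lborel_integral_affine[of _ r a]) (use r in auto)
    also have "\<dots> = \<bar>r\<bar> ^ 2 *\<^sub>R (\<integral>x. w x $ i * (r *\<^sub>R d (?T x)) $ j \<partial>lborel)"
      unfolding TS by (simp add: mult_ac)
    also have "\<dots> = - (\<bar>r\<bar> ^ 2 *\<^sub>R (\<integral>x. G (?S (?T x)) $ i $ j * \<psi> (?T x) \<partial>lborel))"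
      unfolding wk TS by simp
    also have "\<dots> = - (\<integral>x. G (?S x) $ i $ j * \<psi> x \<partial>lborel)"
      by (subst (2) lborel_integral_affine[of _ r a]) (use r in auto)
    finally show "(\<integral>x. (r *\<^sub>R w (?S x)) $ i * d x $ j \<partial>lborel) = - (\<integral>x. G (?S x) $ i $ j * \<psi> x \<partial>lborel)" .
  qed
  obtain M where M: "\<And>x. norm (G x) \<le> M" using P by (auto simp: perturbation_def)
  have "perturbation (ball a r) (\<lambda>x. r *\<^sub>R w (?S x)) (\<lambda>x. G (?S x))"
    unfolding perturbation_def
  proof (intro conjI)
    show "continuous_on UNIV (\<lambda>x. r *\<^sub>R w (?S x))"
      by (intro continuous_intros continuous_on_compose2[OF D(1)]) auto
    show "\<forall>x. x \<notin> ball a r \<longrightarrow> r *\<^sub>R w (?S x) = 0 \<and> G (?S x) = 0"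
      unfolding ballT mem using D(2,3) by auto
    show "\<exists>M. \<forall>x. norm (G (?S x)) \<le> M" using M by blast
  qed (use wg in auto)
  moreover have "open (?T ` D')"
    using assms r open_affinity[of D' r a] by (auto simp: pw_perturbation_def)
  moreover have "?T ` D' \<subseteq> ball a r" unfolding ballT using assms by (auto simp: pw_perturbation_def)
  moreover have "negligible (ball a r - ?T ` D')"
  proof -
    have "ball a r - ?T ` D' = ?T ` (ball 0 1 - D')"
      unfolding ballT by (rule image_set_diff[symmetric]) (use r in \<open>simp add: inj_def\<close>)
    moreover have "negligible (?T ` (ball 0 1 - D'))"
      using assms
      by (intro negligible_differentiable_image_negligible)
        (auto simp: pw_perturbation_def intro!: derivative_intros)
    ultimately show ?thesis by simp
  qed
  moreover have "continuous_on (?T ` D') (\<lambda>x. G (?S x))"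
  proof (rule continuous_on_compose2[of D' G])
    show "continuous_on D' G" using assms by (simp add: pw_perturbation_def)
    show "continuous_on (?T ` D') ?S" by (intro continuous_intros)
    show "?S ` ?T ` D' \<subseteq> D'" using mem by blast
  qed
  moreover have "G (?S x) = 0" if "x \<notin> ?T ` D'" for x
  proof -
    have "?S x \<notin> D'" using that mem by blast
    then show ?thesis using assms unfolding pw_perturbation_def by blast
  qed
  ultimately show ?thesis unfolding pw_perturbation_def by blast
qed

section \<open>Gluing perturbations with disjoint supports\<close>

text \<open>In every use the family \<open>D\<close> is disjoint, so that the least index is the only one.\<close>

definition glue :: "(nat \<Rightarrow> 'a set) \<Rightarrow> (nat \<Rightarrow> 'a \<Rightarrow> 'b::zero) \<Rightarrow> 'a \<Rightarrow> 'b" where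
  "glue D f x = (if \<exists>n. x \<in> D n then f (LEAST n. x \<in> D n) x else 0)"

lemma glue_outside: "x \<notin> (\<Union>n. D n) \<Longrightarrow> glue D f x = 0"
  by (auto simp: glue_def)

lemma glue_inside:
  assumes "disjoint_family D" "x \<in> D n" shows "glue D f x = f n x"
proof -
  have "(LEAST n. x \<in> D n) = n"
    using assms by (intro Least_equality) (auto simp: disjoint_family_on_def disjoint_iff, metis order.refl)
  then show ?thesis using assms by (auto simp: glue_def)
qed

lemma glue_sums:
  fixes f :: "nat \<Rightarrow> 'a \<Rightarrow> 'b::real_normed_vector"
  assumes "disjoint_family D" "\<And>n x. x \<notin> D n \<Longrightarrow> f n x = 0"
  shows "(\<lambda>n. f n x) sums glue D f x"
proof (cases "\<exists>m. x \<in> D m")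
  case True
  then obtain m where m: "x \<in> D m" by blast
  have "x \<notin> D n" if "n \<noteq> m" for n
    using assms(1) m that by (auto simp: disjoint_family_on_def disjoint_iff)
  then have "f n x = (if n = m then f n x else 0)" for n using assms(2) by auto
  then have "(\<lambda>n. f n x) = (\<lambda>n. if n = m then f n x else 0)" by blast
  then show ?thesis
    unfolding glue_inside[OF assms(1) m] using sums_single[of m "\<lambda>n. f n x"] by metis
next
  case False
  then show ?thesis using assms(2) by (simp add: glue_def)
qed

lemma borel_measurable_glue:
  fixes f :: "nat \<Rightarrow> 'a::topological_space \<Rightarrow> 'b::{second_countable_topology, banach}"
  assumes "disjoint_family D" "\<And>n x. x \<notin> D n \<Longrightarrow> f n x = 0" "\<And>n. f n \<in> borel_measurable borel"
  shows "glue D f \<in> borel_measurable borel"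
proof -
  have "glue D f = (\<lambda>x. \<Sum>n. f n x)"
    using glue_sums[of D f, OF assms(1,2)] by (auto simp: sums_iff)
  then show ?thesis using assms(3) by (metis borel_measurable_suminf)
qed

text \<open>At each point at most one term of the series of the \<open>f n\<close> is nonzero, so the bounds \<open>c n \<longlonglongrightarrow> 0\<close> make it
  converge uniformly.\<close>

lemma continuous_on_glue:
  fixes f :: "nat \<Rightarrow> 'a::topological_space \<Rightarrow> 'b::real_normed_vector"
  assumes disj: "disjoint_family D" and out: "\<And>n x. x \<notin> D n \<Longrightarrow> f n x = 0"
    and cont: "\<And>n. continuous_on UNIV (f n)"
    and bound: "\<And>n x. norm (f n x) \<le> c n" and c: "c \<longlonglongrightarrow> 0"
  shows "continuous_on UNIV (glue D f)"
proof (rule uniform_limit_theorem)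
  show "\<forall>\<^sub>F N in sequentially. continuous_on UNIV (\<lambda>x. \<Sum>n<N. f n x)"
    using cont by (auto intro!: always_eventually continuous_intros)
  show "uniform_limit UNIV (\<lambda>N x. \<Sum>n<N. f n x) (glue D f) sequentially"
  proof (rule uniform_limitI)
    fix e :: real assume "e > 0"
    then obtain N0 where N0: "\<And>n. n \<ge> N0 \<Longrightarrow> c n < e"
      using order_tendstoD(2)[OF c] by (auto simp: eventually_sequentially)
    have "dist (\<Sum>n<N. f n x) (glue D f x) < e" if N: "N \<ge> N0" for N x
    proof (cases "\<exists>m. x \<in> D m")
      case True
      then obtain m where m: "x \<in> D m" by blast
      have "x \<notin> D n" if "n \<noteq> m" for n
        using disj m that by (auto simp: disjoint_family_on_def disjoint_iff)
      then have "f n x = (if n = m then f m x else 0)" for n using out by auto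
      then have "(\<Sum>n<N. f n x) = (\<Sum>n<N. if n = m then f m x else 0)" by (rule sum.cong[OF refl])
      also have "\<dots> = (if m < N then f m x else 0)" by simp
      finally show ?thesis
        using glue_inside[OF disj m, of f] \<open>e > 0\<close> N0[of m] bound[of m x] N by (auto simp: dist_norm)
    next
      case False
      then show ?thesis using \<open>e > 0\<close> out by (simp add: glue_def)
    qed
    then show "\<forall>\<^sub>F N in sequentially. \<forall>x\<in>UNIV. dist (\<Sum>n<N. f n x) (glue D f x) < e"
      by (auto simp: eventually_sequentially)
  qed
qed simp

lemma integral_glue_sums:
  fixes f :: "nat \<Rightarrow> 'a::euclidean_space \<Rightarrow> 'b::{second_countable_topology, banach}"
  assumes disj: "disjoint_family D" and out: "\<And>n x. x \<notin> D n \<Longrightarrow> f n x = 0"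
    and D: "\<And>n. D n \<in> sets borel" and int: "integrable lborel (glue D f)"
  shows "(\<lambda>n. \<integral>x. f n x \<partial>lborel) sums (\<integral>x. glue D f x \<partial>lborel)"
proof -
  have eq: "indicat_real (D n) x *\<^sub>R glue D f x = f n x" for n x
    using glue_inside[OF disj, of x n f] out by (auto split: split_indicator)
  have int_n: "integrable lborel (f n)" for n
    using integrable_mult_indicator[of "D n" lborel, OF _ int] D eq by simp
  have norm_sums: "(\<lambda>n. norm (f n x)) sums glue D (\<lambda>n x. norm (f n x)) x" for x
    by (rule glue_sums[OF disj]) (simp add: out)
  have norm_glue: "glue D (\<lambda>n x. norm (f n x)) x = norm (glue D f x)" for x
    by (auto simp: glue_def)
  have part: "(\<Sum>n<N. \<integral>x. norm (f n x) \<partial>lborel) \<le> (\<integral>x. norm (glue D f x) \<partial>lborel)" for N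
  proof -
    have "(\<Sum>n<N. \<integral>x. norm (f n x) \<partial>lborel) = (\<integral>x. (\<Sum>n<N. norm (f n x)) \<partial>lborel)"
      using int_n by (subst Bochner_Integration.integral_sum) auto
    also have "\<dots> \<le> (\<integral>x. norm (glue D f x) \<partial>lborel)"
    proof (rule integral_mono)
      show "(\<Sum>n<N. norm (f n x)) \<le> norm (glue D f x)" for x
        using sum_le_suminf[of "\<lambda>n. norm (f n x)" "{..<N}"] norm_sums[of x] norm_glue[of x]
        by (auto simp: sums_iff)
    qed (use int_n int in auto)
    finally show ?thesis .
  qed
  have "summable (\<lambda>n. \<integral>x. norm (f n x) \<partial>lborel)"
    by (rule bounded_imp_summable[OF _ part[of "Suc _", unfolded lessThan_Suc_atMost]]) auto
  then have "(\<lambda>n. \<integral>x. f n x \<partial>lborel) sums (\<integral>x. (\<Sum>n. f n x) \<partial>lborel)"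
    using norm_sums by (intro sums_integral int_n) (auto simp: sums_iff)
  also have "(\<lambda>x. \<Sum>n. f n x) = glue D f"
    using glue_sums[of D f, OF disj out] by (intro ext) (simp add: sums_iff)
  finally show ?thesis .
qed

lemma glue_comp2:
  assumes "\<And>x. h 0 x = 0"
  shows "h (glue D f x) x = glue D (\<lambda>n x. h (f n x) x) x"
  using assms by (auto simp: glue_def)

text \<open>Both integrals are sums over the sets \<open>D n\<close>, on each of which the identity holds because the perturbation
  vanishes outside.\<close>

lemma glue_weak_identity:
  assumes disj: "disjoint_family D" and D: "\<And>n. D n \<in> sets borel"
    and P: "\<And>n. perturbation (D n) (w n) (G n)" and h: "has_continuous_gradient \<psi> d"
    and int: "integrable lborel (\<lambda>x. glue D w x $ i * d x $ j)" "integrable lborel (\<lambda>x. glue D G x $ i $ j * \<psi> x)"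
  shows "(\<integral>x. glue D w x $ i * d x $ j \<partial>lborel) = - (\<integral>x. glue D G x $ i $ j * \<psi> x \<partial>lborel)"
proof -
  have 1: "(\<lambda>x. glue D w x $ i * d x $ j) = glue D (\<lambda>n x. w n x $ i * d x $ j)"
    by (rule ext, rule glue_comp2) simp
  have 2: "(\<lambda>x. glue D G x $ i $ j * \<psi> x) = glue D (\<lambda>n x. G n x $ i $ j * \<psi> x)"
    by (rule ext, rule glue_comp2) simp
  have A: "(\<lambda>n. \<integral>x. w n x $ i * d x $ j \<partial>lborel) sums (\<integral>x. glue D w x $ i * d x $ j \<partial>lborel)"
    unfolding 1 by (rule integral_glue_sums[OF disj _ D int(1)[unfolded 1]]) (use perturbationD(2)[OF P] in auto)
  have "(\<lambda>n. \<integral>x. G n x $ i $ j * \<psi> x \<partial>lborel) sums (\<integral>x. glue D G x $ i $ j * \<psi> x \<partial>lborel)"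
    unfolding 2 by (rule integral_glue_sums[OF disj _ D int(2)[unfolded 2]]) (use perturbationD(3)[OF P] in auto)
  from sums_minus[OF this] have B: "(\<lambda>n. \<integral>x. w n x $ i * d x $ j \<partial>lborel) sums - (\<integral>x. glue D G x $ i $ j * \<psi> x \<partial>lborel)"
    using perturbationD(5)[OF P] h by (simp add: weak_gradient_def)
  show ?thesis using A B by (rule sums_unique2)
qed

lemma glue_norm_le:
  assumes "disjoint_family D" "\<And>n x. norm (f n x) \<le> M"
  shows "norm (glue D f x) \<le> M"
proof -
  have "0 \<le> M" using assms(2)[of 0 x] norm_ge_zero order_trans by blast
  then show ?thesis using assms(2) by (auto simp: glue_def)
qed

lemma glue_perturbation:
  assumes disj: "disjoint_family D" and D: "\<And>n. D n \<in> sets borel" "\<And>n. D n \<subseteq> O'" and O: "bounded O'"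
    and P: "\<And>n. perturbation (D n) (w n) (G n)"
    and c: "\<And>n x. norm (w n x) \<le> c n" "c \<longlonglongrightarrow> 0" and M: "\<And>n x. norm (G n x) \<le> M"
  shows "perturbation O' (glue D w) (glue D G)"
proof -
  have out: "glue D w x = 0" "glue D G x = 0" if "x \<notin> O'" for x
    using D that by (auto intro!: glue_outside)
  have cont: "continuous_on UNIV (glue D w)"
    by (rule continuous_on_glue[OF disj _ _ c]) (use perturbationD[OF P] in auto)
  have meas: "glue D G \<in> borel_measurable borel"
    by (rule borel_measurable_glue[OF disj]) (use perturbationD[OF P] in auto)
  have wm: "glue D w \<in> borel_measurable borel"
    using cont by (rule borel_measurable_continuous_onI)
  obtain C where C: "\<And>n. \<bar>c n\<bar> \<le> C"
    using convergent_imp_Bseq[OF convergentI[OF c(2)]] by (auto simp: Bseq_def)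
  have nw: "norm (glue D w x) \<le> C" for x
    using c(1) C by (intro glue_norm_le disj) (meson abs_ge_self order_trans)
  have nG: "norm (glue D G x) \<le> M" for x
    using M by (intro glue_norm_le disj)
  have "weak_gradient (glue D w) (glue D G)"
    unfolding weak_gradient_def
  proof (intro allI impI)
    fix \<psi> d i j assume h: "has_continuous_gradient \<psi> d"
    have "\<bar>glue D w x $ i\<bar> \<le> C" for x using nw[of x] Finite_Cartesian_Product.norm_nth_le[of "glue D w x" i] by simp
    then have 1: "integrable lborel (\<lambda>x. glue D w x $ i * d x $ j)"
      using has_continuous_gradientD[OF h] O out wm
      by (intro integrable_mult_bounded_support[where D=O' and M=C]) auto
    have "\<bar>glue D G x $ i $ j\<bar> \<le> M" for x
      using nG[of x] Finite_Cartesian_Product.norm_nth_le[of "glue D G x" i]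
        Finite_Cartesian_Product.norm_nth_le[of "glue D G x $ i" j] by simp
    then have 2: "integrable lborel (\<lambda>x. glue D G x $ i $ j * \<psi> x)"
      using has_continuous_gradientD[OF h] O out meas
      by (intro integrable_mult_bounded_support[where D=O' and M=M]) auto
    show "(\<integral>x. glue D w x $ i * d x $ j \<partial>lborel) = - (\<integral>x. glue D G x $ i $ j * \<psi> x \<partial>lborel)"
      by (rule glue_weak_identity[OF disj D(1) P h 1 2])
  qed
  then show ?thesis unfolding perturbation_def using cont out meas nG by auto
qed

lemma glue_pw_perturbation:
  assumes disj: "disjoint_family D" and D: "\<And>n. open (D n)" "\<And>n. D n \<subseteq> O'" and O: "bounded O'"
    and P: "\<And>n. pw_perturbation (D n) (D' n) (w n) (G n)" and neg: "negligible (O' - (\<Union>n. D n))"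
    and c: "\<And>n x. norm (w n x) \<le> c n" "c \<longlonglongrightarrow> 0" and M: "\<And>n x. norm (G n x) \<le> M"
  shows "pw_perturbation O' (\<Union>n. D' n) (glue D w) (glue D G)"
proof -
  have P': "perturbation (D n) (w n) (G n)" "open (D' n)" "D' n \<subseteq> D n" "negligible (D n - D' n)"
      "continuous_on (D' n) (G n)" "\<And>x. x \<notin> D' n \<Longrightarrow> G n x = 0" for n
    using P[of n] by (auto simp: pw_perturbation_def)
  have "perturbation O' (glue D w) (glue D G)"
    by (rule glue_perturbation[OF disj _ D(2) O P'(1) c M]) (use D(1) in auto)
  moreover have "negligible (O' - (\<Union>n. D' n))"
  proof -
    have "negligible ((O' - (\<Union>n. D n)) \<union> (\<Union>n. D n - D' n))"
      using neg P'(4) by (intro negligible_Un negligible_countable_Union) auto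
    then show ?thesis by (rule negligible_subset) auto
  qed
  moreover have "continuous_on (\<Union>n. D' n) (glue D G)"
  proof (intro continuous_on_open_UN P'(2))
    fix n show "continuous_on (D' n) (glue D G)"
      using P'(5)[of n] P'(3)[of n] glue_inside[OF disj]
      by (subst continuous_on_cong[OF refl, of _ _ "G n"]) auto
  qed
  moreover have "glue D G x = 0" if "x \<notin> (\<Union>n. D' n)" for x
    using that P'(6) by (auto simp: glue_def)
  ultimately show ?thesis
    unfolding pw_perturbation_def using P'(2,3) D(2) by (auto, blast)
qed

section \<open>The simple laminate on the unit disc\<close>

text \<open>The product \<open>f \<psi>\<close> is again Lipschitz: if one of two points lies outside the disc, then \<open>f\<close> vanishes there
  and the increment of the product is that of \<open>f\<close> alone times a value of \<open>\<psi>\<close>.\<close>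

lemma weak_identity_lipschitz:
  fixes f :: "real^2 \<Rightarrow> real"
  assumes lip: "\<And>x y. \<bar>f x - f y\<bar> \<le> L * norm (x - y)"
    and supp: "\<And>x. x \<notin> ball 0 R \<Longrightarrow> f x = 0 \<and> g x = 0"
    and der: "AE x in lborel. (f has_derivative (\<lambda>h. g x \<bullet> h)) (at x)"
    and g [measurable]: "g \<in> borel_measurable borel" and gb: "\<And>x. norm (g x) \<le> M"
    and fm [measurable]: "f \<in> borel_measurable borel" and fb: "\<And>x. \<bar>f x\<bar> \<le> M"
    and h: "has_continuous_gradient \<psi> d"
  shows "(\<integral>x. f x * d x $ j \<partial>lborel) = - (\<integral>x. g x $ j * \<psi> x \<partial>lborel)"
proof -
  note c = has_continuous_gradientD[OF h]
  have [measurable]: "\<psi> \<in> borel_measurable borel" "d \<in> borel_measurable borel"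
    using c by (auto intro: borel_measurable_continuous_onI)
  have "bounded (\<psi> ` cball 0 R)" "bounded (d ` cball 0 R)"
    using c by (auto intro!: compact_imp_bounded compact_continuous_image intro: continuous_on_subset)
  then obtain P Q where "\<forall>y\<in>\<psi> ` cball 0 R. norm y \<le> P" "\<forall>y\<in>d ` cball 0 R. norm y \<le> Q"
    unfolding bounded_iff by blast
  then have P: "\<bar>\<psi> x\<bar> \<le> \<bar>P\<bar>" and Q: "norm (d x) \<le> \<bar>Q\<bar>" if "x \<in> cball 0 R" for x
    using that by force+
  have L: "L * norm (x - y) \<le> \<bar>L\<bar> * norm (x - y)" for x y :: "real^2"
    by (intro mult_right_mono) auto
  have M0: "0 \<le> M" using gb[of 0] norm_ge_zero order_trans by blast
  have lip\<psi>: "\<bar>\<psi> x - \<psi> y\<bar> \<le> \<bar>Q\<bar> * norm (x - y)" if "x \<in> cball 0 R" "y \<in> cball 0 R" for x y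
  proof -
    have "norm (\<psi> x - \<psi> y) \<le> \<bar>Q\<bar> * norm (x - y)"
    proof (rule differentiable_bound[OF convex_cball _ _ that])
      fix x :: "real^2" assume x: "x \<in> cball 0 R"
      show "(\<psi> has_derivative (\<lambda>h. d x \<bullet> h)) (at x within cball 0 R)"
        using h by (auto simp: has_continuous_gradient_def intro: has_derivative_at_withinI)
      show "onorm (\<lambda>h. d x \<bullet> h) \<le> \<bar>Q\<bar>"
      proof (rule onorm_le)
        fix v show "norm (d x \<bullet> v) \<le> \<bar>Q\<bar> * norm v"
          using Cauchy_Schwarz_ineq2[of "d x" v] mult_right_mono[OF Q[OF x], of "norm v"] by auto
      qed
    qed
    then show ?thesis by simp
  qed
  have one: "\<bar>f x * \<psi> x\<bar> \<le> \<bar>L\<bar> * \<bar>P\<bar> * norm (x - y)" if "f y = 0" for x y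
  proof (cases "x \<in> ball 0 R")
    case True
    have "\<bar>f x * \<psi> x\<bar> = \<bar>f x - f y\<bar> * \<bar>\<psi> x\<bar>" using that by (simp add: abs_mult)
    also have "\<dots> \<le> (\<bar>L\<bar> * norm (x - y)) * \<bar>P\<bar>"
      using lip[of x y] L[of x y] P[of x] True by (intro mult_mono) auto
    finally show ?thesis by (simp add: mult_ac)
  qed (use supp in auto)
  define L' where "L' = \<bar>L\<bar> * \<bar>P\<bar> + M * \<bar>Q\<bar>"
  have LL: "\<bar>L\<bar> * \<bar>P\<bar> * norm (x - y) \<le> L' * norm (x - y)" for x y :: "real^2"
    unfolding L'_def using M0 by (intro mult_right_mono) auto
  have lipF: "\<bar>f x * \<psi> x - f y * \<psi> y\<bar> \<le> L' * norm (x - y)" for x y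
  proof (cases "x \<in> ball 0 R \<and> y \<in> ball 0 R")
    case True
    have "f x * \<psi> x - f y * \<psi> y = (f x - f y) * \<psi> x + f y * (\<psi> x - \<psi> y)" by (simp add: algebra_simps)
    then have "\<bar>f x * \<psi> x - f y * \<psi> y\<bar> \<le> \<bar>f x - f y\<bar> * \<bar>\<psi> x\<bar> + \<bar>f y\<bar> * \<bar>\<psi> x - \<psi> y\<bar>"
      by (simp add: abs_mult[symmetric])
    also have "\<dots> \<le> (\<bar>L\<bar> * norm (x - y)) * \<bar>P\<bar> + M * (\<bar>Q\<bar> * norm (x - y))"
    proof (rule add_mono)
      have "\<bar>f x - f y\<bar> \<le> \<bar>L\<bar> * norm (x - y)" using lip[of x y] L[of x y] by linarith
      then show "\<bar>f x - f y\<bar> * \<bar>\<psi> x\<bar> \<le> (\<bar>L\<bar> * norm (x - y)) * \<bar>P\<bar>"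
        using P[of x] True by (intro mult_mono) auto
      show "\<bar>f y\<bar> * \<bar>\<psi> x - \<psi> y\<bar> \<le> M * (\<bar>Q\<bar> * norm (x - y))"
        using True lip\<psi>[of x y] by (intro mult_mono fb M0) auto
    qed
    finally show ?thesis by (simp add: L'_def algebra_simps)
  next
    case False
    then have "f x = 0 \<or> f y = 0" using supp by auto
    then show ?thesis
      using one[of y x] one[of x y] LL[of x y] by (auto simp: norm_minus_commute)
  qed
  have "(\<integral>x. (f x *\<^sub>R d x + \<psi> x *\<^sub>R g x) \<bullet> axis j 1 \<partial>lborel) = 0"
  proof (rule integral_gradient_zero[OF lipF])
    show "AE x in lborel. ((\<lambda>x. f x * \<psi> x) has_derivative (\<lambda>h. (f x *\<^sub>R d x + \<psi> x *\<^sub>R g x) \<bullet> h)) (at x)"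
      using der
    proof eventually_elim
      case (elim x)
      have "(\<psi> has_derivative (\<lambda>h. d x \<bullet> h)) (at x)" using h by (auto simp: has_continuous_gradient_def)
      from has_derivative_mult[OF elim this] show ?case
        by (simp add: inner_add_left mult.commute[of "\<psi> x"])
    qed
  qed (use supp in auto)
  moreover have "integrable lborel (\<lambda>x. f x * d x $ j)"
    using fb c supp by (intro integrable_mult_bounded_support[where D="ball 0 R" and M=M]) auto
  moreover have "integrable lborel (\<lambda>x. g x $ j * \<psi> x)"
  proof (rule integrable_mult_bounded_support[where D="ball 0 R" and M=M])
    show "\<bar>g x $ j\<bar> \<le> M" for x using component_le_norm_cart[of "g x" j] gb[of x] by simp
  qed (use c supp in auto)
  ultimately show ?thesis
    by (simp add: inner_axis mult.commute[of "\<psi> _"] eq_neg_iff_add_eq_0)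
qed

text \<open>The 1-periodic function with slope \<open>1 - t\<close> on a fraction \<open>t\<close> of each period and slope \<open>- t\<close> on the rest. The
  slopes are those needed to move from \<open>t B + (1 - t) C\<close> to \<open>B\<close> and to \<open>C\<close>, in units of \<open>B - C\<close>.\<close>

definition sawtooth :: "real \<Rightarrow> real \<Rightarrow> real" where
  "sawtooth t s = min ((1 - t) * frac s) (t * (1 - frac s))"

definition sawtooth_slope :: "real \<Rightarrow> real \<Rightarrow> real" where
  "sawtooth_slope t s = (if frac s < t then 1 - t else - t)"

definition rising :: "real \<Rightarrow> real set" where "rising t = {s. 0 < frac s \<and> frac s < t}"
definition falling :: "real \<Rightarrow> real set" where "falling t = {s. t < frac s}"

lemma rising_falling_unions:
  assumes "0 < t" "t < 1"
  shows "rising t = (\<Union>k::int. {of_int k <..< of_int k + t})"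
    "falling t = (\<Union>k::int. {of_int k + t <..< of_int k + 1})"
proof -
  show "rising t = (\<Union>k::int. {of_int k <..< of_int k + t})"
  proof (intro equalityI subsetI)
    fix s assume "s \<in> rising t"
    then show "s \<in> (\<Union>k::int. {of_int k <..< of_int k + t})"
      by (auto simp: rising_def frac_def intro!: exI[of _ "\<lfloor>s\<rfloor>"])
  next
    fix s assume "s \<in> (\<Union>k::int. {of_int k <..< of_int k + t})"
    then obtain k :: int where "of_int k < s" "s < of_int k + t" by auto
    moreover from this have "\<lfloor>s\<rfloor> = k" using assms by linarith
    ultimately show "s \<in> rising t" by (auto simp: rising_def frac_def)
  qed
  show "falling t = (\<Union>k::int. {of_int k + t <..< of_int k + 1})"
  proof (intro equalityI subsetI)
    fix s assume "s \<in> falling t"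
    then show "s \<in> (\<Union>k::int. {of_int k + t <..< of_int k + 1})"
      by (auto simp: falling_def frac_def intro!: exI[of _ "\<lfloor>s\<rfloor>"])
  next
    fix s assume "s \<in> (\<Union>k::int. {of_int k + t <..< of_int k + 1})"
    then obtain k :: int where "of_int k + t < s" "s < of_int k + 1" by auto
    moreover from this have "\<lfloor>s\<rfloor> = k" using assms by linarith
    ultimately show "s \<in> falling t" by (auto simp: falling_def frac_def)
  qed
qed

lemma open_rising_falling: "0 < t \<Longrightarrow> t < 1 \<Longrightarrow> open (rising t)" "0 < t \<Longrightarrow> t < 1 \<Longrightarrow> open (falling t)"
  by (auto simp: rising_falling_unions)

lemma sawtooth_bounds:
  assumes "0 < t" "t < 1"
  shows "0 \<le> sawtooth t s" "sawtooth t s \<le> 1" "sawtooth t s \<le> frac s" "sawtooth t s \<le> 1 - frac s"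
proof -
  have f: "0 \<le> frac s" "frac s < 1" by (auto simp: frac_lt_1)
  have "0 \<le> (1 - t) * frac s" "0 \<le> t * (1 - frac s)" using assms f by auto
  then show "0 \<le> sawtooth t s" by (auto simp: sawtooth_def)
  have "(1 - t) * frac s \<le> frac s" using assms f by (intro mult_left_le_one_le) auto
  then show 1: "sawtooth t s \<le> frac s" by (auto simp: sawtooth_def)
  have "t * (1 - frac s) \<le> 1 - frac s" using assms f by (intro mult_left_le_one_le) auto
  then show "sawtooth t s \<le> 1 - frac s" by (auto simp: sawtooth_def)
  show "sawtooth t s \<le> 1" using 1 f by linarith
qed

text \<open>Within one period both branches have slope at most one. Across an integer the two values are bounded by
  the distances to it, since the function is nonnegative and vanishes at the integers.\<close>

lemma sawtooth_lipschitz: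
  assumes t: "0 < t" "t < 1"
  shows "\<bar>sawtooth t s - sawtooth t r\<bar> \<le> \<bar>s - r\<bar>"
proof -
  have *: "\<bar>sawtooth t s - sawtooth t r\<bar> \<le> r - s" if "s \<le> r" for s r
  proof (cases "\<lfloor>s\<rfloor> = \<lfloor>r\<rfloor>")
    case True
    then have d: "frac r - frac s = r - s" by (simp add: frac_def)
    have "(1 - t) * (frac r - frac s) \<le> 1 * (frac r - frac s)" "t * (frac r - frac s) \<le> 1 * (frac r - frac s)"
      "0 \<le> (1 - t) * (frac r - frac s)" "0 \<le> t * (frac r - frac s)"
      using t that d mult_left_le_one_le[of "r - s" t] mult_left_le_one_le[of "r - s" "1 - t"] by auto
    moreover have "(1 - t) * frac r - (1 - t) * frac s = (1 - t) * (frac r - frac s)"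
      "t * (1 - frac s) - t * (1 - frac r) = t * (frac r - frac s)" by (simp_all add: algebra_simps)
    ultimately have "\<bar>(1 - t) * frac s - (1 - t) * frac r\<bar> \<le> r - s"
      "\<bar>t * (1 - frac s) - t * (1 - frac r)\<bar> \<le> r - s" using d by auto
    then show ?thesis unfolding sawtooth_def by (auto simp: min_def)
  next
    case False
    then have "\<lfloor>s\<rfloor> + 1 \<le> \<lfloor>r\<rfloor>" using that floor_mono[of s r] by linarith
    then have "1 - frac s \<le> r - s" "frac r \<le> r - s"
      by (auto simp: frac_def) linarith+
    then show ?thesis
      using sawtooth_bounds[OF t, of s] sawtooth_bounds[OF t, of r] by linarith
  qed
  show ?thesis
    using *[of s r] *[of r s] by (cases "s \<le> r") auto
qed

lemma sawtooth_derivative: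
  assumes t: "0 < t" "t < 1" and s: "s \<in> rising t \<union> falling t"
  shows "(sawtooth t has_real_derivative sawtooth_slope t s) (at s)"
  using s
proof
  assume "s \<in> rising t"
  then obtain k :: int where k: "of_int k < s" "s < of_int k + t"
    using rising_falling_unions[OF t] by auto
  have fl: "frac r = r - of_int k" if "r \<in> {of_int k <..< of_int k + t}" for r
  proof -
    have "\<lfloor>r\<rfloor> = k" using that t by (auto simp: floor_eq_iff)
    then show ?thesis by (simp add: frac_def)
  qed
  have "((\<lambda>r. (1 - t) * (r - of_int k)) has_real_derivative (1 - t)) (at s)"
    by (auto intro!: derivative_eq_intros)
  then have "(sawtooth t has_real_derivative (1 - t)) (at s)"
  proof (rule has_field_derivative_transform_within_open)
    show "open {of_int k <..< of_int k + t}" "s \<in> {of_int k <..< of_int k + t}" using k by auto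
    fix r assume r: "r \<in> {of_int k <..< of_int k + t}"
    then show "(1 - t) * (r - of_int k) = sawtooth t r"
      unfolding sawtooth_def fl[OF r] by (auto simp: min_def algebra_simps)
  qed
  moreover have "sawtooth_slope t s = 1 - t"
    using fl[of s] k by (auto simp: sawtooth_slope_def)
  ultimately show ?thesis by simp
next
  assume "s \<in> falling t"
  then obtain k :: int where k: "of_int k + t < s" "s < of_int k + 1"
    using rising_falling_unions[OF t] by auto
  have fl: "frac r = r - of_int k" if "r \<in> {of_int k + t <..< of_int k + 1}" for r
  proof -
    have "\<lfloor>r\<rfloor> = k" using that t by (auto simp: floor_eq_iff)
    then show ?thesis by (simp add: frac_def)
  qed
  have "((\<lambda>r. t * (1 - (r - of_int k))) has_real_derivative (- t)) (at s)"
    by (auto intro!: derivative_eq_intros)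
  then have "(sawtooth t has_real_derivative (- t)) (at s)"
  proof (rule has_field_derivative_transform_within_open)
    show "open {of_int k + t <..< of_int k + 1}" "s \<in> {of_int k + t <..< of_int k + 1}" using k by auto
    fix r assume r: "r \<in> {of_int k + t <..< of_int k + 1}"
    then show "t * (1 - (r - of_int k)) = sawtooth t r"
      unfolding sawtooth_def fl[OF r] by (auto simp: min_def algebra_simps)
  qed
  moreover have "sawtooth_slope t s = - t"
    using fl[of s] k by (auto simp: sawtooth_slope_def)
  ultimately show ?thesis by simp
qed

lemma continuous_on_sawtooth_slope:
  assumes t: "0 < t" "t < 1"
  shows "continuous_on (rising t \<union> falling t) (sawtooth_slope t)"
proof (rule continuous_on_open_Un)
  show "continuous_on (rising t) (sawtooth_slope t)"
    by (rule continuous_on_eq[of _ "\<lambda>_. 1 - t"]) (auto simp: rising_def sawtooth_slope_def)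
  show "continuous_on (falling t) (sawtooth_slope t)"
    by (rule continuous_on_eq[of _ "\<lambda>_. - t"]) (auto simp: falling_def sawtooth_slope_def)
qed (use open_rising_falling t in auto)

lemma negligible_sawtooth_kinks:
  fixes n :: "'a::euclidean_space"
  assumes t: "0 < t" "t < 1" and n: "n \<noteq> 0"
  shows "negligible {x. n \<bullet> x \<notin> rising t \<union> falling t}"
proof -
  have "{x. n \<bullet> x \<notin> rising t \<union> falling t} \<subseteq> (\<Union>k::int. {x. n \<bullet> x = of_int k} \<union> {x. n \<bullet> x = of_int k + t})"
  proof
    fix x assume "x \<in> {x. n \<bullet> x \<notin> rising t \<union> falling t}"
    then have "frac (n \<bullet> x) = 0 \<or> frac (n \<bullet> x) = t"
      using frac_ge_0[of "n \<bullet> x"] by (auto simp: rising_def falling_def simp del: frac_ge_0)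
    then have "n \<bullet> x = of_int \<lfloor>n \<bullet> x\<rfloor> \<or> n \<bullet> x = of_int \<lfloor>n \<bullet> x\<rfloor> + t"
      unfolding frac_def by linarith
    then show "x \<in> (\<Union>k::int. {x. n \<bullet> x = of_int k} \<union> {x. n \<bullet> x = of_int k + t})" by blast
  qed
  moreover have "negligible (\<Union>k::int. {x. n \<bullet> x = of_int k} \<union> {x. n \<bullet> x = of_int k + t})"
    using n by (intro negligible_countable_Union) (auto intro!: negligible_Un negligible_hyperplane)
  ultimately show ?thesis using negligible_subset by blast
qed

definition cutoff :: "real \<Rightarrow> 'a::real_normed_vector \<Rightarrow> real" where
  "cutoff m x = max 0 (min 1 (m * (1 - norm x)))"

definition cutoff_gradient :: "real \<Rightarrow> 'a::real_inner \<Rightarrow> 'a" where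
  "cutoff_gradient m x = (if norm x < 1 - 1 / m then 0 else - (m / norm x) *\<^sub>R x)"

lemma cutoff_bounds: "0 \<le> cutoff m x" "cutoff m x \<le> 1"
  by (auto simp: cutoff_def)

lemma cutoff_lipschitz:
  assumes "m > 0" shows "\<bar>cutoff m x - cutoff m y\<bar> \<le> m * norm (x - y)"
proof -
  have "\<bar>cutoff m x - cutoff m y\<bar> \<le> \<bar>m * (1 - norm x) - m * (1 - norm y)\<bar>"
    by (auto simp: cutoff_def max_def min_def)
  also have "\<dots> = m * \<bar>norm x - norm y\<bar>"
    using assms by (simp add: abs_mult abs_minus_commute flip: right_diff_distrib)
  also have "\<dots> \<le> m * norm (x - y)" using assms norm_triangle_ineq3[of x y] by simp
  finally show ?thesis .
qed

lemma cutoff_eq: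
  assumes "m > 1"
  shows "norm x < 1 - 1 / m \<Longrightarrow> cutoff m x = 1"
    "1 - 1 / m < norm x \<Longrightarrow> norm x < 1 \<Longrightarrow> cutoff m x = m * (1 - norm x)"
    "1 \<le> norm x \<Longrightarrow> cutoff m x = 0"
proof -
  assume "1 \<le> norm x"
  then have "m * (1 - norm x) \<le> 0" using assms by (intro mult_nonneg_nonpos) auto
  then show "cutoff m x = 0" by (auto simp: cutoff_def)
qed (use assms in \<open>auto simp: cutoff_def field_simps max_def min_def\<close>)

lemma cutoff_derivative:
  fixes x :: "'a::real_inner"
  assumes m: "m > 1" and x: "norm x < 1" "norm x \<noteq> 1 - 1 / m"
  shows "(cutoff m has_derivative (\<lambda>h. cutoff_gradient m x \<bullet> h)) (at x)"
proof (cases "norm x < 1 - 1 / m")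
  case True
  have "((\<lambda>_. 1) has_derivative (\<lambda>h. cutoff_gradient m x \<bullet> h)) (at x)"
    using True by (simp add: cutoff_gradient_def)
  then show ?thesis
    by (rule has_derivative_transform_within_open[where s="{x. norm x < 1 - 1 / m}"])
      (use True in \<open>auto simp: cutoff_eq(1)[OF m] intro!: open_Collect_less continuous_intros\<close>)
next
  case False
  have "0 < 1 - 1 / m" using m by simp
  then have nz: "x \<noteq> 0" using False by auto
  have "((\<lambda>y. m * (1 - norm y)) has_derivative (\<lambda>h. cutoff_gradient m x \<bullet> h)) (at x)"
  proof -
    have "((\<lambda>y. m * (1 - norm y)) has_derivative (\<lambda>h. m * (0 - sgn x \<bullet> h))) (at x)"
      using has_derivative_norm[OF nz]
      by (intro has_derivative_mult_right has_derivative_diff has_derivative_const) (simp add: inner_commute)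
    moreover have "(\<lambda>h. m * (0 - sgn x \<bullet> h)) = (\<lambda>h. cutoff_gradient m x \<bullet> h)"
      using False by (auto simp: cutoff_gradient_def sgn_div_norm field_simps)
    ultimately show ?thesis by simp
  qed
  then show ?thesis
    by (rule has_derivative_transform_within_open[where s="{x. 1 - 1 / m < norm x} \<inter> {x. norm x < 1}"])
      (use False x in \<open>auto simp: cutoff_eq(2)[OF m] intro!: open_Int open_Collect_less continuous_intros\<close>)
qed

lemma norm_cutoff_gradient:
  assumes "m > 0" shows "norm (cutoff_gradient m x) \<le> m"
  using assms by (auto simp: cutoff_gradient_def)

lemma continuous_on_cutoff_gradient:
  assumes m: "m > 1"
  shows "continuous_on {x::'a::real_inner. norm x \<noteq> 1 - 1 / m} (cutoff_gradient m)"
proof -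
  have "continuous_on ({x::'a. norm x < 1 - 1 / m} \<union> {x. 1 - 1 / m < norm x}) (cutoff_gradient m)"
  proof (rule continuous_on_open_Un)
    show "continuous_on {x. norm x < 1 - 1 / m} (cutoff_gradient m)"
      by (rule continuous_on_eq[of _ "\<lambda>_. 0"]) (auto simp: cutoff_gradient_def)
    have "continuous_on {x. 1 - 1 / m < norm x} (\<lambda>x. - (m / norm x) *\<^sub>R x)"
      using m by (intro continuous_intros) auto
    then show "continuous_on {x. 1 - 1 / m < norm x} (cutoff_gradient m)"
      by (rule continuous_on_eq) (auto simp: cutoff_gradient_def)
  qed (auto intro!: open_Collect_less continuous_intros)
  moreover have "{x::'a. norm x < 1 - 1 / m} \<union> {x. 1 - 1 / m < norm x} = {x. norm x \<noteq> 1 - 1 / m}"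
    by auto
  ultimately show ?thesis by simp
qed

text \<open>Write \<open>B - C\<close> as the tensor product of \<open>a\<close> and \<open>n\<close>. The map \<open>\<delta> \<eta>(x) h(n \<bullet> x / \<delta>) a\<close> with the sawtooth \<open>h\<close> and a
  cutoff \<open>\<eta>\<close> has gradient \<open>\<eta> h'\<close> times \<open>B - C\<close>, up to the term \<open>\<delta> h\<close> times the tensor product of \<open>a\<close> and the
  gradient of \<open>\<eta>\<close>, which is small with \<open>\<delta>\<close>. Added to \<open>A\<close>, the first term stays on the segment from \<open>C\<close> to \<open>B\<close>
  and equals an end point wherever \<open>\<eta> = 1\<close>. The sets \<open>OB\<close> and \<open>OC\<close> are the parts of the disc of radius \<open>\<rho>\<close> where
  the sawtooth rises and falls; \<open>OR\<close> is the transition ring without the kinks.\<close>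

lemma lamination_block:
  fixes B C :: "real^2^2"
  assumes det: "det (B - C) = 0" and ne: "B \<noteq> C" and t: "0 < t" "t < 1"
    and A: "A = t *\<^sub>R B + (1 - t) *\<^sub>R C" and e: "\<epsilon> > 0"
  obtains w G OB OC OR where "pw_perturbation (ball 0 1) (OB \<union> OC \<union> OR) w G" "\<And>x. norm (w x) \<le> \<epsilon>"
    "\<And>x. \<exists>l. 0 \<le> l \<and> l \<le> 1 \<and> norm (A + G x - (l *\<^sub>R B + (1 - l) *\<^sub>R C)) \<le> \<epsilon>"
    "open OB" "open OC" "open OR" "OB \<inter> OC = {}" "(OB \<union> OC) \<inter> OR = {}"
    "\<And>x. x \<in> OB \<Longrightarrow> A + G x = B" "\<And>x. x \<in> OC \<Longrightarrow> A + G x = C"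
    "measure lborel (ball 0 1 - (OB \<union> OC)) \<le> \<epsilon>"
proof -
  obtain a n :: "real^2" where an: "\<And>i j. (B - C) $ i $ j = a $ i * n $ j"
    using det_zero_rank_one[OF det] by metis
  have BC: "B - C = (\<chi> i. a $ i *\<^sub>R n)"
    by (simp add: vec_eq_iff an[simplified])
  have n0: "n \<noteq> 0"
  proof
    assume "n = 0"
    then have "B - C = 0" unfolding BC by (simp add: vec_eq_iff)
    then show False using ne by simp
  qed
  define V where "V = measure lebesgue (ball 0 1 :: (real^2) set)"
  have V0: "0 \<le> V" by (simp add: V_def)
  \<comment> \<open>The ring where the cutoff falls has measure at most \<open>2 V / m\<close>, and the steep cutoff contributes at most
    \<open>\<delta> m |a|\<close> to the gradient.\<close>
  define m where "m = 2 + 2 * V / \<epsilon>"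
  have m: "m > 1" "2 * V / m \<le> \<epsilon>"
  proof -
    have q: "0 \<le> 2 * V / \<epsilon>" using V0 e by simp
    then show "m > 1" by (simp add: m_def)
    have "2 * V \<le> \<epsilon> * m" using e by (simp add: m_def field_simps)
    then show "2 * V / m \<le> \<epsilon>" using \<open>m > 1\<close> by (simp add: divide_le_eq)
  qed
  define \<delta> where "\<delta> = \<epsilon> / (m * (norm a + 1))"
  have \<delta>: "\<delta> > 0" "\<delta> * m * norm a \<le> \<epsilon>" "\<delta> * norm a \<le> \<epsilon>"
  proof -
    have pos: "m * (norm a + 1) > 0" using m by (intro mult_pos_pos) (auto intro: add_nonneg_pos)
    then show d: "\<delta> > 0" using e by (simp add: \<delta>_def)
    have "m \<noteq> 0" "norm a + 1 \<noteq> 0" using m norm_ge_zero[of a] by linarith+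
    then have "\<delta> * (m * (norm a + 1)) = \<epsilon>" by (simp add: \<delta>_def)
    moreover have "\<delta> * (m * norm a) \<le> \<delta> * (m * (norm a + 1))" using m d by (intro mult_left_mono) auto
    ultimately show 1: "\<delta> * m * norm a \<le> \<epsilon>" by (simp add: mult.assoc)
    have "1 * norm a \<le> m * norm a" using m by (intro mult_right_mono) auto
    then have "\<delta> * norm a \<le> \<delta> * (m * norm a)" using d by (intro mult_left_mono) auto
    then show "\<delta> * norm a \<le> \<epsilon>" using 1 by (simp add: mult.assoc)
  qed
  define p where "p = (1 / \<delta>) *\<^sub>R n"
  have p0: "p \<noteq> 0" and \<delta>p: "\<delta> *\<^sub>R p = n" using n0 \<delta> by (auto simp: p_def)
  define \<rho> where "\<rho> = 1 - 1 / m"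
  have \<rho>: "0 < \<rho>" "\<rho> < 1" using m by (auto simp: \<rho>_def)
  define OB where "OB = {x. norm x < \<rho>} \<inter> {x. p \<bullet> x \<in> rising t}"
  define OC where "OC = {x. norm x < \<rho>} \<inter> {x. p \<bullet> x \<in> falling t}"
  define OR where "OR = ({x. \<rho> < norm x} \<inter> {x. norm x < 1}) \<inter> {x. p \<bullet> x \<in> rising t \<union> falling t}"
  define D' where "D' = {x. norm x < 1 \<and> norm x \<noteq> \<rho>} \<inter> {x. p \<bullet> x \<in> rising t \<union> falling t}"
  define f where "f x = \<delta> * (cutoff m x * sawtooth t (p \<bullet> x))" for x
  define g where "g x = (if x \<in> D' then (cutoff m x * sawtooth_slope t (p \<bullet> x)) *\<^sub>R n
      + (\<delta> * sawtooth t (p \<bullet> x)) *\<^sub>R cutoff_gradient m x else 0)" for x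
  define w where "w x = f x *\<^sub>R a" for x
  define G where "G x = (\<chi> i. a $ i *\<^sub>R g x)" for x
  have op: "open {x. p \<bullet> x \<in> S}" if "open S" for S
  proof -
    have "continuous_on UNIV (\<lambda>x. p \<bullet> x)" by (rule continuous_on_inner) auto
    then have "open ((\<lambda>x. p \<bullet> x) -` S)" by (rule open_vimage[OF that])
    then show ?thesis by (simp add: vimage_def)
  qed
  have opD': "open D'"
  proof -
    have "{x::real^2. norm x < 1 \<and> norm x \<noteq> \<rho>} = {x. norm x < 1} \<inter> {x. norm x \<noteq> \<rho>}" by auto
    then show ?thesis
      unfolding D'_def using open_rising_falling[OF t]
      by (simp only:) (intro open_Int op open_Un open_Collect_less open_Collect_neq continuous_intros)
  qed
  have opO: "open OB" "open OC" "open OR"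
    unfolding OB_def OC_def OR_def using open_rising_falling[OF t]
    by (auto intro!: open_Int op open_Un open_Collect_less continuous_intros simp del: Un_iff)
  have D'eq: "D' = OB \<union> OC \<union> OR"
    using \<rho> by (auto simp: D'_def OB_def OC_def OR_def)
  have kinks: "negligible {x. p \<bullet> x \<notin> rising t \<union> falling t}"
    by (rule negligible_sawtooth_kinks[OF t p0])
  have negD': "negligible (ball 0 1 - D')"
  proof -
    have "negligible (sphere 0 \<rho> \<union> {x. p \<bullet> x \<notin> rising t \<union> falling t})"
      using kinks by (intro negligible_Un negligible_sphere)
    then show ?thesis by (rule negligible_subset) (auto simp: D'_def dist_norm)
  qed
  note sb = sawtooth_bounds[OF t] and cb = cutoff_bounds[of m]
  have slope: "\<bar>sawtooth_slope t s\<bar> \<le> 1" for s using t by (auto simp: sawtooth_slope_def)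
  have cs: "0 \<le> cutoff m x * sawtooth t s" "cutoff m x * sawtooth t s \<le> 1" for x :: "real^2" and s
    using sb cb[of x] by (auto intro: mult_le_one)
  have fb: "0 \<le> f x" "f x \<le> \<delta>" for x
    using cs[of x "p \<bullet> x"] \<delta> by (auto simp: f_def intro: mult_left_le)
  have gn: "norm (g x) \<le> norm n + \<delta> * m" for x
  proof (cases "x \<in> D'")
    case True
    have "norm ((cutoff m x * sawtooth_slope t (p \<bullet> x)) *\<^sub>R n) \<le> 1 * norm n"
      unfolding norm_scaleR using slope cb[of x]
      by (intro mult_right_mono) (auto simp: abs_mult intro!: mult_le_one)
    moreover have "norm ((\<delta> * sawtooth t (p \<bullet> x)) *\<^sub>R cutoff_gradient m x) \<le> \<delta> * m"
      unfolding norm_scaleR using sb[of "p \<bullet> x"] \<delta> m norm_cutoff_gradient[of m x]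
      by (intro mult_mono) (auto simp: abs_mult intro!: mult_left_le)
    ultimately show ?thesis
      using True norm_triangle_ineq[of "(cutoff m x * sawtooth_slope t (p \<bullet> x)) *\<^sub>R n" "(\<delta> * sawtooth t (p \<bullet> x)) *\<^sub>R cutoff_gradient m x"]
      by (simp add: g_def)
  next
    case False then show ?thesis using \<delta> m by (simp add: g_def)
  qed
  have flip: "\<bar>f x - f y\<bar> \<le> (\<delta> * m + norm n) * norm (x - y)" for x y
  proof -
    have "\<bar>p \<bullet> x - p \<bullet> y\<bar> \<le> norm p * norm (x - y)"
      using Cauchy_Schwarz_ineq2[of p "x - y"] by (simp add: inner_diff_right)
    then have s: "\<bar>sawtooth t (p \<bullet> x) - sawtooth t (p \<bullet> y)\<bar> \<le> norm p * norm (x - y)"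
      using sawtooth_lipschitz[OF t, of "p \<bullet> x" "p \<bullet> y"] by linarith
    have "f x - f y = \<delta> * ((cutoff m x - cutoff m y) * sawtooth t (p \<bullet> x)
        + cutoff m y * (sawtooth t (p \<bullet> x) - sawtooth t (p \<bullet> y)))"
      by (simp add: f_def algebra_simps)
    then have "\<bar>f x - f y\<bar> = \<delta> * \<bar>(cutoff m x - cutoff m y) * sawtooth t (p \<bullet> x)
        + cutoff m y * (sawtooth t (p \<bullet> x) - sawtooth t (p \<bullet> y))\<bar>" using \<delta> by (simp add: abs_mult)
    also have "\<dots> \<le> \<delta> * (\<bar>cutoff m x - cutoff m y\<bar> * \<bar>sawtooth t (p \<bullet> x)\<bar>
        + \<bar>cutoff m y\<bar> * \<bar>sawtooth t (p \<bullet> x) - sawtooth t (p \<bullet> y)\<bar>)"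
      unfolding abs_mult[symmetric] using \<delta> by (intro mult_left_mono abs_triangle_ineq) auto
    also have "\<dots> \<le> \<delta> * ((m * norm (x - y)) * 1 + 1 * (norm p * norm (x - y)))"
      using \<delta> m cutoff_lipschitz[of m x y] s sb[of "p \<bullet> x"] cb[of y]
      by (intro mult_left_mono add_mono mult_mono) auto
    also have "\<dots> = (\<delta> * m + norm (\<delta> *\<^sub>R p)) * norm (x - y)" using \<delta> by (simp add: algebra_simps)
    finally show ?thesis unfolding \<delta>p .
  qed
  have fout: "f x = 0" if "x \<notin> ball 0 1" for x
    using that cutoff_eq(3)[OF m(1), of x] by (simp add: f_def dist_norm)
  have gout: "g x = 0" if "x \<notin> D'" for x using that by (simp add: g_def)
  have D'sub: "D' \<subseteq> ball 0 1" by (auto simp: D'_def dist_norm)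
  have gout': "g x = 0" if "norm x \<ge> 1" for x using that gout[of x] D'sub by force
  have contD: "continuous_on D' (\<lambda>x. (cutoff m x * sawtooth_slope t (p \<bullet> x)) *\<^sub>R n
      + (\<delta> * sawtooth t (p \<bullet> x)) *\<^sub>R cutoff_gradient m x)"
  proof -
    have "continuous_on UNIV (sawtooth t)"
      using sawtooth_lipschitz[OF t] by (intro lipschitz_on_continuous_on[of 1] lipschitz_onI) (auto simp: dist_real_def)
    moreover have "continuous_on D' (\<lambda>x. sawtooth_slope t (p \<bullet> x))"
      by (rule continuous_on_compose2[OF continuous_on_sawtooth_slope[OF t]]) (auto simp: D'_def intro!: continuous_intros)
    moreover have "continuous_on D' (cutoff_gradient m)"
      using continuous_on_cutoff_gradient[OF m(1)] by (rule continuous_on_subset) (auto simp: D'_def \<rho>_def)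
    moreover have "continuous_on D' (cutoff m)"
      unfolding cutoff_def by (intro continuous_intros)
    moreover have "continuous_on D' (\<lambda>x. sawtooth t (p \<bullet> x))"
      by (rule continuous_on_compose2[OF \<open>continuous_on UNIV (sawtooth t)\<close>]) (auto intro!: continuous_intros)
    ultimately show ?thesis
      by (intro continuous_on_add continuous_on_scaleR continuous_on_mult continuous_on_const)
  qed
  then have cg: "continuous_on D' g" by (rule continuous_on_eq) (simp add: g_def)
  have gm: "g \<in> borel_measurable borel"
  proof -
    have "g = (\<lambda>x. indicator D' x *\<^sub>R g x)" using gout by (auto split: split_indicator)
    then show ?thesis using borel_measurable_continuous_on_indicator[OF _ cg] opD' by auto
  qed
  have "(f has_derivative (\<lambda>h. g x \<bullet> h)) (at x)" if "x \<in> D'" for x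
  proof -
    have c: "(cutoff m has_derivative (\<lambda>h. cutoff_gradient m x \<bullet> h)) (at x)"
      using that m by (intro cutoff_derivative) (auto simp: D'_def \<rho>_def)
    have "((\<lambda>y. p \<bullet> y) has_derivative (\<lambda>h. p \<bullet> h)) (at x)"
      by (auto intro!: derivative_eq_intros)
    moreover have "(sawtooth t has_derivative (\<lambda>s. sawtooth_slope t (p \<bullet> x) * s)) (at (p \<bullet> x))"
      using sawtooth_derivative[OF t, of "p \<bullet> x"] that by (auto simp: D'_def has_field_derivative_def)
    ultimately have s: "((\<lambda>y. sawtooth t (p \<bullet> y)) has_derivative (\<lambda>h. sawtooth_slope t (p \<bullet> x) * (p \<bullet> h))) (at x)"
      using has_derivative_compose[of "\<lambda>y. p \<bullet> y" "\<lambda>h. p \<bullet> h" x UNIV "sawtooth t"] by blast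
    have "(f has_derivative (\<lambda>h. \<delta> * (cutoff m x * (sawtooth_slope t (p \<bullet> x) * (p \<bullet> h))
        + (cutoff_gradient m x \<bullet> h) * sawtooth t (p \<bullet> x)))) (at x)"
      unfolding f_def by (intro has_derivative_mult_right has_derivative_mult c s)
    also have "(\<lambda>h. \<delta> * (cutoff m x * (sawtooth_slope t (p \<bullet> x) * (p \<bullet> h))
        + (cutoff_gradient m x \<bullet> h) * sawtooth t (p \<bullet> x))) = (\<lambda>h. g x \<bullet> h)"
      using that unfolding g_def \<delta>p[symmetric] by (auto simp: inner_add_left algebra_simps)
    finally show ?thesis .
  qed
  moreover have "(f has_derivative (\<lambda>h. g x \<bullet> h)) (at x)" if "norm x > 1" for x
  proof -
    have "((\<lambda>_. 0) has_derivative (\<lambda>h. g x \<bullet> h)) (at x)"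
      using that gout' by simp
    then show ?thesis
      by (rule has_derivative_transform_within_open[where s="{x. 1 < norm x}"])
        (use that fout in \<open>auto intro!: open_Collect_less continuous_intros simp: dist_norm\<close>)
  qed
  moreover have "negligible (sphere 0 1 \<union> (ball 0 1 - D'))"
    using negD' by (intro negligible_Un negligible_sphere)
  ultimately have der: "AE x in lborel. (f has_derivative (\<lambda>h. g x \<bullet> h)) (at x)"
    by (elim AE_lborel_negligible) (force simp: dist_norm)
  have fc: "continuous_on UNIV f"
    using flip \<delta> m by (intro lipschitz_on_continuous_on[of "\<delta> * m + norm n"] lipschitz_onI) (auto simp: dist_norm)
  have "weak_gradient w G"
    unfolding weak_gradient_def
  proof (intro allI impI)
    fix \<psi> d i j assume h: "has_continuous_gradient \<psi> d"
    have "\<bar>f x\<bar> \<le> max \<delta> (norm n + \<delta> * m)" "norm (g x) \<le> max \<delta> (norm n + \<delta> * m)" for x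
      using fb[of x] gn[of x] by auto
    then have "(\<integral>x. f x * d x $ j \<partial>lborel) = - (\<integral>x. g x $ j * \<psi> x \<partial>lborel)"
      using fc gout' fout
      by (intro weak_identity_lipschitz[OF flip _ der gm _ _ _ h, of 1]) (auto intro: borel_measurable_continuous_onI)
    then have "a $ i * (\<integral>x. f x * d x $ j \<partial>lborel) = - (a $ i * (\<integral>x. g x $ j * \<psi> x \<partial>lborel))" by simp
    then show "(\<integral>x. w x $ i * d x $ j \<partial>lborel) = - (\<integral>x. G x $ i $ j * \<psi> x \<partial>lborel)"
      unfolding w_def G_def
      by (simp add: mult.assoc mult.commute[of _ "a $ i"] flip: integral_mult_right_zero)
  qed
  moreover have nG: "norm (\<chi> i. a $ i *\<^sub>R v) = norm a * norm v" for v :: "real^2"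
  proof -
    have "(norm (\<chi> i. a $ i *\<^sub>R v))\<^sup>2 = (norm a * norm v)\<^sup>2"
      unfolding power_mult_distrib power2_norm_eq_inner
      by (simp add: inner_vec_def sum_2 algebra_simps)
    then show ?thesis by (simp add: power2_eq_iff_nonneg)
  qed
  moreover have Gm: "G \<in> borel_measurable borel"
  proof -
    have "continuous_on UNIV (\<lambda>v::real^2. (\<chi> i. a $ i *\<^sub>R v) :: real^2^2)"
      by (intro continuous_on_vec_lambda continuous_intros)
    then show ?thesis unfolding G_def using gm by (rule borel_measurable_continuous_on)
  qed
  moreover have "norm (G x) \<le> norm a * (norm n + \<delta> * m)" for x
    unfolding G_def nG by (intro mult_left_mono gn) auto
  moreover have Gout: "G x = 0" if "x \<notin> D'" for x using gout[OF that] by (simp add: G_def vec_eq_iff)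
  ultimately have pert: "perturbation (ball 0 1) w G"
    unfolding perturbation_def using fc fout gout' unfolding w_def
    by (auto intro!: continuous_intros simp: G_def vec_eq_iff)
  have "continuous_on D' G" unfolding G_def by (intro continuous_on_vec_lambda continuous_intros cg)
  then have pw: "pw_perturbation (ball 0 1) D' w G"
    unfolding pw_perturbation_def using pert opD' D'sub negD' Gout by blast
  have outer_simp: "(\<chi> i. a $ i *\<^sub>R (s *\<^sub>R n + v)) = s *\<^sub>R (B - C) + (\<chi> i. a $ i *\<^sub>R v)" for s v
    unfolding BC by (simp add: vec_eq_iff algebra_simps)
  have AG: "A + G x = C + (t + cutoff m x * sawtooth_slope t (p \<bullet> x)) *\<^sub>R (B - C)
      + (\<chi> i. a $ i *\<^sub>R ((\<delta> * sawtooth t (p \<bullet> x)) *\<^sub>R cutoff_gradient m x))" if "x \<in> D'" for x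
    unfolding G_def A using that by (simp only: g_def if_True outer_simp) (simp add: algebra_simps)
  have seg: "\<exists>l. 0 \<le> l \<and> l \<le> 1 \<and> norm (A + G x - (l *\<^sub>R B + (1 - l) *\<^sub>R C)) \<le> \<epsilon>" for x
  proof (cases "x \<in> D'")
    case False
    then show ?thesis using t e Gout by (intro exI[of _ t]) (simp add: A)
  next
    case True
    define l where "l = t + cutoff m x * sawtooth_slope t (p \<bullet> x)"
    have "0 \<le> l \<and> l \<le> 1"
    proof (cases "frac (p \<bullet> x) < t")
      case True
      have "cutoff m x * (1 - t) \<le> 1 - t" using cb[of x] t by (intro mult_left_le_one_le) auto
      moreover have "0 \<le> cutoff m x * (1 - t)" using cb[of x] t by auto
      moreover have "l = t + cutoff m x * (1 - t)" using True by (simp add: l_def sawtooth_slope_def)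
      ultimately show ?thesis using t by linarith
    next
      case False
      have "cutoff m x * t \<le> t" using cb[of x] t by (intro mult_left_le_one_le) auto
      moreover have "0 \<le> cutoff m x * t" using cb[of x] t by auto
      moreover have "l = t - cutoff m x * t" using False by (simp add: l_def sawtooth_slope_def)
      ultimately show ?thesis using t by linarith
    qed
    moreover have "norm (A + G x - (l *\<^sub>R B + (1 - l) *\<^sub>R C)) \<le> \<epsilon>"
    proof -
      have "A + G x - (l *\<^sub>R B + (1 - l) *\<^sub>R C) = (\<chi> i. a $ i *\<^sub>R ((\<delta> * sawtooth t (p \<bullet> x)) *\<^sub>R cutoff_gradient m x))"
        unfolding AG[OF True] l_def[symmetric] by (simp add: algebra_simps)
      also have "norm \<dots> = norm a * (\<delta> * sawtooth t (p \<bullet> x) * norm (cutoff_gradient m x))"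
        unfolding nG using \<delta> sb[of "p \<bullet> x"] by simp
      also have "\<dots> \<le> norm a * (\<delta> * 1 * m)"
        using \<delta> m sb[of "p \<bullet> x"] norm_cutoff_gradient[of m x] by (intro mult_left_mono mult_mono) auto
      finally show ?thesis using \<delta> by (simp add: mult_ac)
    qed
    ultimately show ?thesis by blast
  qed
  have inner: "G x = 0 + G x \<and> cutoff m x = 1 \<and> cutoff_gradient m x = 0" if "norm x < \<rho>" for x
    using that cutoff_eq(1)[OF m(1)] by (auto simp: \<rho>_def cutoff_gradient_def)
  have zero: "(\<chi> i. a $ i *\<^sub>R (0::real^2)) = (0::real^2^2)" by (simp add: vec_eq_iff)
  have sub: "OB \<subseteq> D'" "OC \<subseteq> D'" using \<rho> by (auto simp: OB_def OC_def D'_def)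
  have "A + G x = B" if "x \<in> OB" for x
    using AG[of x] that sub inner[of x] zero by (auto simp: OB_def rising_def sawtooth_slope_def)
  moreover have "A + G x = C" if "x \<in> OC" for x
    using AG[of x] that sub inner[of x] zero by (auto simp: OC_def falling_def sawtooth_slope_def)
  moreover have "OB \<inter> OC = {}" "(OB \<union> OC) \<inter> OR = {}"
    by (auto simp: OB_def OC_def OR_def rising_def falling_def)
  moreover have "norm (w x) \<le> \<epsilon>" for x
    using fb[of x] \<delta> mult_right_mono[of "f x" \<delta> "norm a"] by (simp add: w_def)
  moreover have "measure lborel (ball 0 1 - (OB \<union> OC)) \<le> \<epsilon>"
  proof -
    let ?N = "{x. p \<bullet> x \<notin> rising t \<union> falling t}"
    have Nm: "?N \<in> lmeasurable" using kinks by (simp add: negligible_imp_measurable)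
    have "measure lebesgue (ball 0 1 - (OB \<union> OC)) \<le> measure lebesgue ((ball 0 1 - ball 0 \<rho>) \<union> ?N)"
    proof (rule measure_mono_fmeasurable)
      show "ball 0 1 - (OB \<union> OC) \<subseteq> (ball 0 1 - ball 0 \<rho>) \<union> ?N" by (auto simp: OB_def OC_def dist_norm)
      show "ball 0 1 - (OB \<union> OC) \<in> sets lebesgue" using opO by auto
      show "(ball 0 1 - ball 0 \<rho>) \<union> ?N \<in> lmeasurable" using Nm by (intro fmeasurable.Un fmeasurable.Diff) auto
    qed
    also have "\<dots> \<le> measure lebesgue (ball 0 1 - ball (0::real^2) \<rho>) + measure lebesgue ?N"
      using Nm by (intro measure_Un_le) (auto dest: fmeasurableD)
    also have "measure lebesgue ?N = 0" using kinks by (rule negligible_imp_measure0)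
    also have "measure lebesgue (ball 0 1 - ball (0::real^2) \<rho>) = V - measure lebesgue (ball (0::real^2) \<rho>)"
      unfolding V_def using \<rho> by (intro measurable_measure_Diff) auto
    also have "measure lebesgue (ball (0::real^2) \<rho>) = \<rho>\<^sup>2 * V"
      using content_ball_conv_unit_ball[of \<rho> "0::real^2"] \<rho> by (simp add: V_def)
    also have "V - \<rho>\<^sup>2 * V + 0 \<le> 2 * V / m"
    proof -
      have "1 - \<rho>\<^sup>2 = 2 / m - (1 / m)\<^sup>2" by (simp add: \<rho>_def power2_eq_square algebra_simps)
      also have "\<dots> \<le> 2 / m" by simp
      finally have "(1 - \<rho>\<^sup>2) * V \<le> 2 / m * V" using V0 by (intro mult_right_mono)
      then show ?thesis by (simp add: algebra_simps)
    qed
    also note m(2)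
    finally show ?thesis using opO by simp
  qed
  ultimately show thesis
    using that[OF pw[unfolded D'eq] _ seg opO] by blast
qed

section \<open>Approximability of a matrix by gradients on a disc\<close>

text \<open>There is a perturbation on the unit disc of the linear map \<open>A\<close> whose gradient stays in \<open>V\<close>, with a uniform
  margin \<open>r\<close>, and is on average \<open>\<epsilon>\<close>-close to \<open>S\<close>. The margin makes the same perturbation usable for all gradient
  fields close to \<open>A\<close>, and the average distance is convenient because it adds up over disjoint discs.\<close>

definition approximable :: "(real^2^2) set \<Rightarrow> (real^2^2) set \<Rightarrow> real \<Rightarrow> real^2^2 \<Rightarrow> bool" where
  "approximable V S \<epsilon> A \<longleftrightarrow> (\<exists>w G D' r. r > 0 \<and> pw_perturbation (ball 0 1) D' w G \<and>
     (\<forall>x. norm (w x) \<le> 1) \<and> (\<forall>x h. norm h < r \<longrightarrow> A + G x + h \<in> V) \<and>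
     (LINT x:ball 0 1|lborel. infdist (A + G x) S) \<le> \<epsilon> * measure lborel (ball (0::real^2) 1))"

lemma integral_ball_rescale:
  fixes f :: "real^2 \<Rightarrow> real"
  assumes f: "f \<in> borel_measurable borel" and r: "r > 0"
  shows "(LINT x:ball a r|lborel. f ((x - a) /\<^sub>R r)) = r\<^sup>2 * (LINT x:ball 0 1|lborel. f x)"
proof -
  have [measurable]: "f \<in> borel_measurable borel" "ball a r \<in> sets borel" using f by simp_all
  have ind: "indicat_real (ball a r) (a + r *\<^sub>R x) = indicat_real (ball 0 1) x" for x :: "real^2"
    using r by (auto simp: indicator_def dist_norm abs_mult)
  have "(LINT x:ball a r|lborel. f ((x - a) /\<^sub>R r)) =
      \<bar>r\<bar> ^ DIM(real^2) *\<^sub>R (\<integral>x. indicat_real (ball a r) (a + r *\<^sub>R x) *\<^sub>R f ((a + r *\<^sub>R x - a) /\<^sub>R r) \<partial>lborel)"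
    unfolding set_lebesgue_integral_def by (rule lborel_integral_affine) (measurable, use r in auto)
  then show ?thesis
    unfolding ind set_lebesgue_integral_def using r by simp
qed

lemma measure_ball_rescale:
  "r \<ge> 0 \<Longrightarrow> measure lborel (ball (a::real^2) r) = r\<^sup>2 * measure lborel (ball (0::real^2) 1)"
  using content_ball_conv_unit_ball[of r a] by simp

lemma set_integrable_bounded:
  fixes f :: "real^2 \<Rightarrow> real"
  assumes "D \<in> sets borel" "bounded D" "(\<lambda>x. indicator D x *\<^sub>R f x) \<in> borel_measurable borel"
    and "\<And>x. x \<in> D \<Longrightarrow> \<bar>f x\<bar> \<le> M"
  shows "set_integrable lborel D f"
  unfolding set_integrable_def
  by (rule integrable_bounded_support[where D=D and M="\<bar>M\<bar>"])
    (use assms in \<open>force split: split_indicator\<close>)+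

lemma infdist_le_norm: "infdist x S \<le> norm x + infdist 0 S"
  using infdist_triangle[of x S 0] by (simp add: dist_norm add.commute)

lemma infdist_add_le: "infdist (x + y) S \<le> infdist x S + norm y"
  using infdist_triangle[of "x + y" S x] by (simp add: dist_norm)

lemma borel_measurable_infdist' [measurable (raw)]:
  "f \<in> borel_measurable M \<Longrightarrow> (\<lambda>x. infdist (f x) S) \<in> borel_measurable M"
  by (rule borel_measurable_continuous_on[of "\<lambda>x. infdist x S"]) (auto intro!: continuous_intros)

text \<open>On a disc where \<open>F\<close> is almost constant, the rescaled perturbation for the value at the centre still works.
  The last claim is the orthogonality: since the new gradient has mean zero, only the oscillation of \<open>H\<close> on
  the disc contributes.\<close>

lemma approximable_ball:
  assumes bl: "pw_perturbation (ball 0 1) D' w G" and wb: "\<And>x. norm (w x) \<le> 1"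
    and val: "\<And>x h. norm h < r \<Longrightarrow> F a + G x + h \<in> V"
    and avg: "(LINT x:ball 0 1|lborel. infdist (F a + G x) S) \<le> \<epsilon> * measure lborel (ball (0::real^2) 1)"
    and Vb: "\<And>X. X \<in> V \<Longrightarrow> norm X \<le> R"
    and \<rho>: "0 < \<rho>" and F: "continuous_on (ball a \<rho>) F"
    and Fa: "\<And>x. x \<in> ball a \<rho> \<Longrightarrow> norm (F x - F a) < r" "\<And>x. x \<in> ball a \<rho> \<Longrightarrow> norm (F x - F a) \<le> \<delta>"
    and r: "r > 0"
  defines "w' \<equiv> \<lambda>x. \<rho> *\<^sub>R w ((x - a) /\<^sub>R \<rho>)" and "G' \<equiv> \<lambda>x. G ((x - a) /\<^sub>R \<rho>)"
    and "T \<equiv> (\<lambda>x. a + \<rho> *\<^sub>R x) ` D'"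
  shows "pw_perturbation (ball a \<rho>) T w' G'" "norm (w' x) \<le> \<rho>" "x \<in> ball a \<rho> \<Longrightarrow> F x + G' x \<in> V"
    "norm (G' x) \<le> 2 * R"
    "(LINT x:ball a \<rho>|lborel. infdist (F x + G' x) S) \<le> (\<epsilon> + \<delta>) * measure lborel (ball a \<rho>)"
    "\<lbrakk>continuous_on (ball a \<rho>) H; \<And>x. x \<in> ball a \<rho> \<Longrightarrow> norm (H x - H a) \<le> \<eta>\<rbrakk> \<Longrightarrow>
      \<bar>LINT x:ball a \<rho>|lborel. G' x \<bullet> H x\<bar> \<le> (2 * R * \<eta>) * measure lborel (ball a \<rho>)"
proof -
  show pw: "pw_perturbation (ball a \<rho>) T w' G'"
    unfolding w'_def G'_def T_def by (rule pw_perturbation_rescale[OF bl \<rho>])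
  then have P': "perturbation (ball a \<rho>) w' G'" by (simp add: pw_perturbation_def)
  have P: "perturbation (ball 0 1) w G" using bl by (simp add: pw_perturbation_def)
  have [measurable]: "G \<in> borel_measurable borel" "G' \<in> borel_measurable borel" "ball a \<rho> \<in> sets borel"
    using perturbationD(4)[OF P] perturbationD(4)[OF P'] by simp_all
  show "norm (w' x) \<le> \<rho>" for x
    using wb[of "(x - a) /\<^sub>R \<rho>"] \<rho> by (simp add: w'_def mult_left_le)
  show FV: "F x + G' x \<in> V" if "x \<in> ball a \<rho>" for x
    using val[of "F x - F a" "(x - a) /\<^sub>R \<rho>"] Fa(1)[OF that] by (simp add: G'_def algebra_simps)
  have out: "F a + 0 \<in> V" using val[of 0 2] perturbationD(3)[OF P, of 2] r
    by (auto simp: norm_eq_sqrt_inner inner_vec_def)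
  show Gb: "norm (G' x) \<le> 2 * R" for x
  proof -
    have "norm (F a + G' x) \<le> R" "norm (F a) \<le> R"
      using val[of 0 "(x - a) /\<^sub>R \<rho>"] r Vb out by (auto simp: G'_def)
    moreover have "norm (G' x) \<le> norm (F a + G' x) + norm (F a)"
      using norm_triangle_ineq4[of "F a + G' x" "F a"] by simp
    ultimately show ?thesis by linarith
  qed
  let ?m = "measure lborel (ball a \<rho>)"
  have fin: "emeasure lborel (ball a \<rho>) < \<infinity>" by (rule emeasure_lborel_ball_finite)
  have indF: "(\<lambda>x. indicator (ball a \<rho>) x *\<^sub>R F x) \<in> borel_measurable borel"
    by (rule borel_measurable_continuous_on_indicator[OF _ F]) simp
  have meas: "(\<lambda>x. indicator (ball a \<rho>) x *\<^sub>R infdist (F x + G' x) S) \<in> borel_measurable borel"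
  proof -
    have "(\<lambda>x. indicator (ball a \<rho>) x *\<^sub>R infdist (F x + G' x) S)
        = (\<lambda>x. indicat_real (ball a \<rho>) x * infdist (indicator (ball a \<rho>) x *\<^sub>R F x + G' x) S)"
      by (auto split: split_indicator)
    also have "\<dots> \<in> borel_measurable borel" using indF by measurable
    finally show ?thesis .
  qed
  have int1: "set_integrable lborel (ball a \<rho>) (\<lambda>x. infdist (F x + G' x) S)"
  proof (rule set_integrable_bounded[OF _ _ meas])
    show "\<bar>infdist (F x + G' x) S\<bar> \<le> R + infdist 0 S" if "x \<in> ball a \<rho>" for x
      using infdist_le_norm[of "F x + G' x" S] Vb[OF FV[OF that]] by (auto simp: infdist_nonneg)
  qed auto
  have int2: "set_integrable lborel (ball a \<rho>) (\<lambda>x. infdist (F a + G' x) S)"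
  proof (rule set_integrable_bounded)
    show "\<bar>infdist (F a + G' x) S\<bar> \<le> R + infdist 0 S" for x
      using infdist_le_norm[of "F a + G' x" S] Vb val[of 0 "(x - a) /\<^sub>R \<rho>"] r
      by (force simp: infdist_nonneg G'_def)
    show "(\<lambda>x. indicator (ball a \<rho>) x *\<^sub>R infdist (F a + G' x) S) \<in> borel_measurable borel" by measurable
  qed auto
  have const: "set_integrable lborel (ball a \<rho>) (\<lambda>x. c)" "(LINT x:ball a \<rho>|lborel. c) = c * ?m" for c :: real
    using fin by (auto simp: set_integrable_def set_integral_const)
  have "(LINT x:ball a \<rho>|lborel. infdist (F x + G' x) S) \<le> (LINT x:ball a \<rho>|lborel. infdist (F a + G' x) S + \<delta>)"
  proof (rule set_integral_mono[OF int1])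
    show "set_integrable lborel (ball a \<rho>) (\<lambda>x. infdist (F a + G' x) S + \<delta>)"
      by (rule set_integral_add(1)[OF int2 const(1)])
    show "infdist (F x + G' x) S \<le> infdist (F a + G' x) S + \<delta>" if "x \<in> ball a \<rho>" for x
      using infdist_add_le[of "F a + G' x" "F x - F a" S] Fa(2)[OF that] by (simp add: algebra_simps)
  qed
  also have "\<dots> = (LINT x:ball a \<rho>|lborel. infdist (F a + G' x) S) + \<delta> * ?m"
    using set_integral_add(2)[OF int2 const(1)] const(2) by simp
  also have "(LINT x:ball a \<rho>|lborel. infdist (F a + G' x) S) = \<rho>\<^sup>2 * (LINT x:ball 0 1|lborel. infdist (F a + G x) S)"
    unfolding G'_def by (rule integral_ball_rescale[of "\<lambda>y. infdist (F a + G y) S"]) (use \<rho> in auto)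
  also have "\<dots> \<le> \<rho>\<^sup>2 * (\<epsilon> * measure lborel (ball (0::real^2) 1))"
    using avg by (intro mult_left_mono) auto
  also have "\<dots> = \<epsilon> * ?m" using \<rho> measure_ball_rescale[of \<rho> a] by simp
  finally show "(LINT x:ball a \<rho>|lborel. infdist (F x + G' x) S) \<le> (\<epsilon> + \<delta>) * ?m"
    by (simp add: algebra_simps)
  show "\<bar>LINT x:ball a \<rho>|lborel. G' x \<bullet> H x\<bar> \<le> (2 * R * \<eta>) * ?m"
    if H: "continuous_on (ball a \<rho>) H" and Hb: "\<And>x. x \<in> ball a \<rho> \<Longrightarrow> norm (H x - H a) \<le> \<eta>"
  proof -
    have indH: "(\<lambda>x. indicator (ball a \<rho>) x *\<^sub>R (H x - H a)) \<in> borel_measurable borel"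
      by (rule borel_measurable_continuous_on_indicator) (use H in \<open>auto intro!: continuous_intros\<close>)
    have bd: "\<bar>G' x \<bullet> (H x - H a)\<bar> \<le> 2 * R * \<eta>" if "x \<in> ball a \<rho>" for x
    proof -
      have "\<bar>G' x \<bullet> (H x - H a)\<bar> \<le> norm (G' x) * norm (H x - H a)" by (rule Cauchy_Schwarz_ineq2)
      also have "\<dots> \<le> 2 * R * \<eta>" using Gb[of x] Hb[OF that] norm_ge_zero[of "G' x"] norm_ge_zero[of "H x - H a"]
        by (intro mult_mono) linarith+
      finally show ?thesis .
    qed
    have i1: "set_integrable lborel (ball a \<rho>) (\<lambda>x. G' x \<bullet> (H x - H a))"
    proof (rule set_integrable_bounded[OF _ _ _ bd])
      have "(\<lambda>x. indicator (ball a \<rho>) x *\<^sub>R (G' x \<bullet> (H x - H a))) = (\<lambda>x. G' x \<bullet> (indicator (ball a \<rho>) x *\<^sub>R (H x - H a)))"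
        by (auto split: split_indicator)
      also have "\<dots> \<in> borel_measurable borel" using indH by measurable
      finally show "(\<lambda>x. indicator (ball a \<rho>) x *\<^sub>R (G' x \<bullet> (H x - H a))) \<in> borel_measurable borel" .
    qed auto
    have i2: "integrable lborel (\<lambda>x. G' x \<bullet> H a)"
      using perturbation_integrable(3)[OF P' _ continuous_on_const] by auto
    have eq2: "(\<lambda>x. indicator (ball a \<rho>) x *\<^sub>R (G' x \<bullet> H a)) = (\<lambda>x. G' x \<bullet> H a)"
      using perturbationD(3)[OF P'] by (auto split: split_indicator)
    have "(LINT x:ball a \<rho>|lborel. G' x \<bullet> H x) = (LINT x:ball a \<rho>|lborel. G' x \<bullet> (H x - H a) + G' x \<bullet> H a)"
      by (simp add: inner_diff_right)
    also have "\<dots> = (LINT x:ball a \<rho>|lborel. G' x \<bullet> (H x - H a)) + (LINT x:ball a \<rho>|lborel. G' x \<bullet> H a)"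
      by (rule set_integral_add(2)[OF i1]) (unfold set_integrable_def eq2, rule i2)
    also have "(LINT x:ball a \<rho>|lborel. G' x \<bullet> H a) = 0"
      unfolding set_lebesgue_integral_def eq2 by (rule perturbation_integral_zero[OF P']) simp
    finally have "(LINT x:ball a \<rho>|lborel. G' x \<bullet> H x) = (LINT x:ball a \<rho>|lborel. G' x \<bullet> (H x - H a))" by simp
    moreover have "\<bar>LINT x:ball a \<rho>|lborel. G' x \<bullet> (H x - H a)\<bar> \<le> (LINT x:ball a \<rho>|lborel. \<bar>G' x \<bullet> (H x - H a)\<bar>)"
      using set_integral_norm_bound[OF i1] by simp
    moreover have "(LINT x:ball a \<rho>|lborel. \<bar>G' x \<bullet> (H x - H a)\<bar>) \<le> (LINT x:ball a \<rho>|lborel. 2 * R * \<eta>)"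
      by (rule set_integral_mono[OF set_integrable_abs[OF i1] const(1)]) (rule bd)
    ultimately show ?thesis unfolding const(2) by linarith
  qed
qed

section \<open>Filling open sets with small discs\<close>

lemma borel_measurable_indicator_infdist:
  fixes F G :: "real^2 \<Rightarrow> real^2^2"
  assumes "O' \<in> sets borel" "continuous_on O' F" "G \<in> borel_measurable borel"
  shows "(\<lambda>x. indicator O' x *\<^sub>R infdist (F x + G x) S) \<in> borel_measurable borel"
proof -
  have [measurable]: "O' \<in> sets borel" "G \<in> borel_measurable borel"
    "(\<lambda>x. indicator O' x *\<^sub>R F x) \<in> borel_measurable borel"
    using assms borel_measurable_continuous_on_indicator by auto
  have "(\<lambda>x. indicator O' x *\<^sub>R infdist (F x + G x) S)
      = (\<lambda>x. indicat_real O' x * infdist (indicator O' x *\<^sub>R F x + G x) S)"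
    by (auto split: split_indicator)
  also have "\<dots> \<in> borel_measurable borel" by measurable
  finally show ?thesis .
qed

lemma borel_measurable_indicator_inner:
  fixes G H :: "real^2 \<Rightarrow> real^2^2"
  assumes "O' \<in> sets borel" "continuous_on O' H" "G \<in> borel_measurable borel"
  shows "(\<lambda>x. indicator O' x *\<^sub>R (G x \<bullet> H x)) \<in> borel_measurable borel"
proof -
  have [measurable]: "G \<in> borel_measurable borel"
    "(\<lambda>x. indicator O' x *\<^sub>R H x) \<in> borel_measurable borel"
    using assms borel_measurable_continuous_on_indicator by auto
  have "(\<lambda>x. indicator O' x *\<^sub>R (G x \<bullet> H x)) = (\<lambda>x. G x \<bullet> (indicator O' x *\<^sub>R H x))"
    by (auto split: split_indicator)
  also have "\<dots> \<in> borel_measurable borel" by measurable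
  finally show ?thesis .
qed

text \<open>Vitali's covering theorem. Indices outside \<open>N\<close> carry empty balls, which treats finite and infinite
  families alike, and the radii tend to 0 because the balls have finite total measure.\<close>

lemma fine_ball_partition:
  fixes O' :: "'a::euclidean_space set"
  assumes "open O'" "bounded O'"
    and fine: "\<And>a. a \<in> O' \<Longrightarrow> \<exists>\<rho>0>0. \<forall>\<rho>. 0 < \<rho> \<and> \<rho> \<le> \<rho>0 \<longrightarrow> P a \<rho>"
  obtains N :: "nat set" and a :: "nat \<Rightarrow> 'a" and \<rho> :: "nat \<Rightarrow> real"
  where "\<And>n. n \<in> N \<Longrightarrow> a n \<in> O' \<and> 0 < \<rho> n \<and> ball (a n) (\<rho> n) \<subseteq> O' \<and> P (a n) (\<rho> n)"
    "\<And>n. n \<notin> N \<Longrightarrow> \<rho> n = 0" "disjoint_family (\<lambda>n. ball (a n) (\<rho> n))"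
    "negligible (O' - (\<Union>n. ball (a n) (\<rho> n)))" "\<rho> \<longlonglongrightarrow> 0"
proof -
  define K where "K = {i :: 'a \<times> real. fst i \<in> O' \<and> 0 < snd i \<and> ball (fst i) (snd i) \<subseteq> O' \<and> P (fst i) (snd i)}"
  have "\<exists>i. i \<in> K \<and> x \<in> ball (fst i) (snd i) \<and> snd i < d" if x: "x \<in> O'" and d: "0 < d" for x d
  proof -
    obtain \<rho>0 where \<rho>0: "\<rho>0 > 0" "\<And>\<rho>. 0 < \<rho> \<Longrightarrow> \<rho> \<le> \<rho>0 \<Longrightarrow> P x \<rho>" using fine[OF x] by blast
    obtain e where e: "e > 0" "ball x e \<subseteq> O'" using \<open>open O'\<close> x open_contains_ball by blast
    define r where "r = min (d / 2) (min e \<rho>0)"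
    have r: "0 < r" "r < d" "r \<le> e" "r \<le> \<rho>0" using d e \<rho>0 by (auto simp: r_def)
    have "ball x r \<subseteq> O'" using e r by (meson subset_ball subset_trans)
    then have "(x, r) \<in> K" using r \<rho>0 x by (simp add: K_def)
    then show ?thesis using r by (intro exI[of _ "(x, r)"]) auto
  qed
  from Vitali_covering_theorem_balls[of O' K fst snd, OF this]
  obtain C where C: "countable C" "C \<subseteq> K"
    "pairwise (\<lambda>i j. disjnt (ball (fst i) (snd i)) (ball (fst j) (snd j))) C"
    "negligible (O' - (\<Union>i \<in> C. ball (fst i) (snd i)))" by blast
  define N where "N = to_nat_on C ` C"
  define a where "a n = fst (from_nat_into C n)" for n
  define \<rho> where "\<rho> n = (if n \<in> N then snd (from_nat_into C n) else 0)" for n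
  have inC: "from_nat_into C n \<in> C" "to_nat_on C (from_nat_into C n) = n" if "n \<in> N" for n
    using that C(1) by (auto simp: N_def)
  have 1: "a n \<in> O' \<and> 0 < \<rho> n \<and> ball (a n) (\<rho> n) \<subseteq> O' \<and> P (a n) (\<rho> n)" if "n \<in> N" for n
    using inC(1)[OF that] C(2) that by (auto simp: K_def a_def \<rho>_def)
  have 2: "\<rho> n = 0" if "n \<notin> N" for n using that by (simp add: \<rho>_def)
  have disj: "disjoint_family (\<lambda>n. ball (a n) (\<rho> n))"
  proof (unfold disjoint_family_on_def, intro ballI impI)
    fix m n :: nat assume mn: "m \<noteq> n"
    show "ball (a m) (\<rho> m) \<inter> ball (a n) (\<rho> n) = {}"
    proof (cases "m \<in> N \<and> n \<in> N")
      case True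
      then have "from_nat_into C m \<noteq> from_nat_into C n" using inC mn by metis
      then show ?thesis using True inC C(3) by (auto simp: pairwise_def disjnt_def a_def \<rho>_def)
    next
      case False then show ?thesis using 2 by auto
    qed
  qed
  have un: "(\<Union>n. ball (a n) (\<rho> n)) = (\<Union>i \<in> C. ball (fst i) (snd i))"
  proof (intro equalityI subsetI)
    fix x assume "x \<in> (\<Union>n. ball (a n) (\<rho> n))"
    then obtain n where n: "x \<in> ball (a n) (\<rho> n)" by blast
    then have "n \<in> N" using 2[of n] by (cases "n \<in> N") auto
    then show "x \<in> (\<Union>i \<in> C. ball (fst i) (snd i))" using n inC by (auto simp: a_def \<rho>_def)
  next
    fix x assume "x \<in> (\<Union>i \<in> C. ball (fst i) (snd i))"
    then obtain i where i: "i \<in> C" "x \<in> ball (fst i) (snd i)" by blast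
    then have "to_nat_on C i \<in> N" "from_nat_into C (to_nat_on C i) = i" using C(1) by (auto simp: N_def)
    then have "x \<in> ball (a (to_nat_on C i)) (\<rho> (to_nat_on C i))" using i by (simp add: a_def \<rho>_def)
    then show "x \<in> (\<Union>n. ball (a n) (\<rho> n))" by blast
  qed
  have \<rho>0: "\<rho> n \<ge> 0" for n using 1[of n] 2[of n] by (cases "n \<in> N") auto
  have "\<rho> \<longlonglongrightarrow> 0"
  proof -
    have "bounded (\<Union>n. ball (a n) (\<rho> n))"
      unfolding un using C(2) by (intro bounded_subset[OF \<open>bounded O'\<close>]) (auto simp: K_def)
    then have "emeasure lborel (\<Union>n. ball (a n) (\<rho> n)) \<noteq> \<infinity>"
      using emeasure_bounded_finite[of "\<Union>n. ball (a n) (\<rho> n)"] by auto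
    then have "(\<lambda>n. measure lborel (ball (a n) (\<rho> n))) sums measure lborel (\<Union>n. ball (a n) (\<rho> n))"
      by (intro measure_UNION disj) auto
    then have "(\<lambda>n. measure lborel (ball (a n) (\<rho> n))) \<longlonglongrightarrow> 0"
      using sums_summable summable_LIMSEQ_zero by blast
    then have "(\<lambda>n. measure lborel (ball (a n) (\<rho> n)) / measure lborel (ball (0::'a) 1)) \<longlonglongrightarrow> 0 / measure lborel (ball (0::'a) 1)"
      by (intro tendsto_divide tendsto_const) (auto simp: content_ball_pos less_imp_neq[symmetric])
    moreover have "measure lborel (ball (a n) (\<rho> n)) / measure lborel (ball (0::'a) 1) = \<rho> n ^ DIM('a)" for n
      using content_ball_conv_unit_ball[OF \<rho>0[of n], of "a n"] content_ball_pos[of 1 "0::'a"] by simp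
    ultimately have "(\<lambda>n. \<rho> n ^ DIM('a)) \<longlonglongrightarrow> 0" by simp
    then have "(\<lambda>n. root DIM('a) (\<rho> n ^ DIM('a))) \<longlonglongrightarrow> root DIM('a) 0"
      by (rule tendsto_real_root)
    then show ?thesis using \<rho>0 by (simp add: real_root_power_cancel)
  qed
  then show thesis using that[OF 1 2 disj] C(4) un by simp
qed

text \<open>A bound that is proportional to the measure on each piece holds with the same constant on the union.\<close>

lemma set_integral_glue_le:
  fixes g :: "nat \<Rightarrow> 'a::euclidean_space \<Rightarrow> real"
  assumes disj: "disjoint_family D" and D: "\<And>n. D n \<in> sets borel" "\<And>n. D n \<subseteq> O'"
    and O: "bounded O'" "O' \<in> sets borel" and neg: "negligible (O' - (\<Union>n. D n))"
    and eq: "\<And>n x. x \<in> D n \<Longrightarrow> f x = g n x"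
    and meas: "(\<lambda>x. indicator O' x *\<^sub>R f x) \<in> borel_measurable borel" and fb: "\<And>x. x \<in> O' \<Longrightarrow> \<bar>f x\<bar> \<le> M"
    and le: "\<And>n. \<bar>LINT x:D n|lborel. g n x\<bar> \<le> c * measure lborel (D n)" and c: "c \<ge> 0"
  shows "\<bar>LINT x:O'|lborel. f x\<bar> \<le> c * measure lborel O'"
proof -
  let ?U = "\<Union>n. D n"
  have [measurable]: "D n \<in> sets borel" "O' \<in> sets borel" for n using D O by auto
  have int: "set_integrable lborel O' f"
    unfolding set_integrable_def
    by (rule integrable_bounded_support[where D=O' and M="\<bar>M\<bar>"])
      (use O meas fb in \<open>force split: split_indicator\<close>)+
  have finO: "emeasure lborel O' \<noteq> \<infinity>" using emeasure_bounded_finite[OF O(1)] by auto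
  have sub: "?U \<subseteq> O'" using D by blast
  have finU: "emeasure lborel ?U \<noteq> \<infinity>"
    using emeasure_mono[OF sub, of lborel] finO by (auto simp: top_unique)
  have intU: "set_integrable lborel ?U f" by (rule set_integrable_subset[OF int _ sub]) auto
  have "(LINT x:O'|lborel. f x) = (LINT x:?U|lborel. f x)"
    unfolding set_lebesgue_integral_def
  proof (rule integral_cong_AE)
    show "AE x in lborel. indicator O' x *\<^sub>R f x = indicator ?U x *\<^sub>R f x"
      by (rule AE_lborel_negligible[OF neg]) (use sub in \<open>auto split: split_indicator\<close>)
  qed (use int intU in \<open>auto simp: set_integrable_def\<close>)
  also have "\<dots> = (\<Sum>n. LINT x:D n|lborel. f x)"
    by (rule lebesgue_integral_countable_add) (use disj intU in \<open>auto simp: disjoint_family_on_def\<close>)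
  finally have eqs: "(LINT x:O'|lborel. f x) = (\<Sum>n. LINT x:D n|lborel. f x)" .
  have le': "\<bar>LINT x:D n|lborel. f x\<bar> \<le> c * measure lborel (D n)" for n
  proof -
    have "(LINT x:D n|lborel. f x) = (LINT x:D n|lborel. g n x)"
      unfolding set_lebesgue_integral_def using eq by (intro Bochner_Integration.integral_cong) (auto split: split_indicator)
    then show ?thesis using le by simp
  qed
  have sm: "(\<lambda>n. c * measure lborel (D n)) sums (c * measure lborel ?U)"
    by (intro sums_mult measure_UNION disj finU) auto
  have sabs: "summable (\<lambda>n. \<bar>LINT x:D n|lborel. f x\<bar>)"
    by (rule summable_comparison_test'[OF sums_summable[OF sm], of 0]) (use le' in auto)
  have "\<bar>\<Sum>n. LINT x:D n|lborel. f x\<bar> \<le> (\<Sum>n. \<bar>LINT x:D n|lborel. f x\<bar>)"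
    using summable_rabs[OF sabs] .
  also have "\<dots> \<le> c * measure lborel ?U"
    using suminf_le[OF le' sabs sums_summable[OF sm]] sums_unique[OF sm] by simp
  also have "\<dots> \<le> c * measure lborel O'"
    using c finO sub by (intro mult_left_mono measure_mono_fmeasurable) (auto simp: fmeasurable_def less_top)
  finally show ?thesis unfolding eqs .
qed

text \<open>Outside the disc the perturbation vanishes, so \<open>A\<close> itself is among the values that lie in \<open>V\<close>.\<close>

lemma approximable_mem: "approximable V S \<epsilon> A \<Longrightarrow> A \<in> V"
proof -
  assume "approximable V S \<epsilon> A"
  then obtain w G D' r where *: "r > 0" "pw_perturbation (ball 0 1) D' w G" "\<And>x h. norm h < r \<Longrightarrow> A + G x + h \<in> V"
    unfolding approximable_def by blast
  obtain b :: "real^2" where b: "norm b = 2" using vector_choose_size[of 2] by auto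
  then have "G b = 0" using *(2) perturbationD(3)[of "ball 0 1" w G b] by (simp add: pw_perturbation_def)
  then show "A \<in> V" using *(3)[of 0 b] *(1) by simp
qed

text \<open>Fill \<open>O'\<close> with discs so small that \<open>F\<close> and the finitely many fields in \<open>HH\<close> are almost constant on each, and
  put into each disc the rescaled perturbation for the value of \<open>F\<close> at its centre. The last claim says that the
  correction is nearly orthogonal to every field in \<open>HH\<close>.\<close>

lemma approximable_patch:
  assumes O: "open O'" "bounded O'" and F: "continuous_on O' F"
    and good: "\<And>x. x \<in> O' \<Longrightarrow> approximable V S \<epsilon> (F x)" and \<epsilon>: "\<epsilon> \<ge> 0"
    and Vb: "\<And>X. X \<in> V \<Longrightarrow> norm X \<le> R" and R: "R \<ge> 0"
    and HH: "finite HH" "\<And>H. H \<in> HH \<Longrightarrow> continuous_on O' H" "\<And>H x. H \<in> HH \<Longrightarrow> x \<in> O' \<Longrightarrow> norm (H x) \<le> R"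
    and \<delta>: "\<delta> > 0"
  obtains w G D' where "pw_perturbation O' D' w G" "\<And>x. norm (w x) \<le> \<delta>" "\<And>x. x \<in> D' \<Longrightarrow> F x + G x \<in> V"
    "\<And>x. norm (G x) \<le> 2 * R"
    "(LINT x:O'|lborel. infdist (F x + G x) S) \<le> (\<epsilon> + \<delta>) * measure lborel O'"
    "\<And>H. H \<in> HH \<Longrightarrow> \<bar>LINT x:O'|lborel. G x \<bullet> H x\<bar> \<le> \<delta> * measure lborel O'"
proof -
  have "\<forall>x\<in>O'. \<exists>w G D' r. r > 0 \<and> pw_perturbation (ball 0 1) D' w G \<and>
     (\<forall>y. norm (w y) \<le> 1) \<and> (\<forall>y h. norm h < r \<longrightarrow> F x + G y + h \<in> V) \<and>
     (LINT y:ball 0 1|lborel. infdist (F x + G y) S) \<le> \<epsilon> * measure lborel (ball (0::real^2) 1)"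
    using good unfolding approximable_def by blast
  then obtain bw bG bD br where bl: "\<And>x. x \<in> O' \<Longrightarrow> br x > 0 \<and> pw_perturbation (ball 0 1) (bD x) (bw x) (bG x) \<and>
     (\<forall>y. norm (bw x y) \<le> 1) \<and> (\<forall>y h. norm h < br x \<longrightarrow> F x + bG x y + h \<in> V) \<and>
     (LINT y:ball 0 1|lborel. infdist (F x + bG x y) S) \<le> \<epsilon> * measure lborel (ball (0::real^2) 1)"
    by metis
  \<comment> \<open>On each disc the scalar product is at most \<open>2 R\<close> times the oscillation of the field.\<close>
  define \<eta> where "\<eta> = \<delta> / (2 * R + 1)"
  have \<eta>: "\<eta> > 0" "2 * R * \<eta> \<le> \<delta>"
    using \<delta> R by (auto simp: \<eta>_def field_simps)
  define P where "P a \<rho> \<longleftrightarrow> \<rho> \<le> \<delta> \<and> (\<forall>x\<in>ball a \<rho>. norm (F x - F a) < br a \<and> norm (F x - F a) \<le> \<delta>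
      \<and> (\<forall>H\<in>HH. norm (H x - H a) \<le> \<eta>))" for a :: "real^2" and \<rho>
  have fine: "\<exists>\<rho>0>0. \<forall>\<rho>. 0 < \<rho> \<and> \<rho> \<le> \<rho>0 \<longrightarrow> P a \<rho>" if a: "a \<in> O'" for a
  proof -
    have lim: "(H \<longlongrightarrow> H a) (nhds a)" if "continuous_on O' H" for H :: "real^2 \<Rightarrow> real^2^2"
      using that O(1) a by (metis continuous_on_eq_continuous_at isCont_def tendsto_at_iff_tendsto_nhds)
    have ev: "\<forall>\<^sub>F x in nhds a. norm (H x - H a) < e" if "continuous_on O' H" "e > 0" for H :: "real^2 \<Rightarrow> real^2^2" and e
      using tendstoD[OF lim[OF that(1)] that(2)] by (simp add: dist_norm)
    have "\<forall>\<^sub>F x in nhds a. norm (F x - F a) < br a" "\<forall>\<^sub>F x in nhds a. norm (F x - F a) < \<delta>"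
      using bl[OF a] \<delta> by (auto intro!: ev F)
    moreover have "\<forall>\<^sub>F x in nhds a. \<forall>H\<in>HH. norm (H x - H a) < \<eta>"
      using HH \<eta> by (intro eventually_ball_finite ballI ev) auto
    ultimately have "\<forall>\<^sub>F x in nhds a. norm (F x - F a) < br a \<and> norm (F x - F a) \<le> \<delta> \<and> (\<forall>H\<in>HH. norm (H x - H a) \<le> \<eta>)"
      by eventually_elim auto
    then obtain d where d: "d > 0" "\<And>x. dist x a < d \<Longrightarrow> norm (F x - F a) < br a \<and> norm (F x - F a) \<le> \<delta> \<and> (\<forall>H\<in>HH. norm (H x - H a) \<le> \<eta>)"
      unfolding eventually_nhds_metric by blast
    show ?thesis
      using d \<delta> by (intro exI[of _ "min d \<delta>"]) (auto simp: P_def dist_commute)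
  qed
  obtain N a \<rho> where part: "\<And>n. n \<in> N \<Longrightarrow> a n \<in> O' \<and> 0 < \<rho> n \<and> ball (a n) (\<rho> n) \<subseteq> O' \<and> P (a n) (\<rho> n)"
    and off: "\<And>n. n \<notin> N \<Longrightarrow> \<rho> n = 0" and disj: "disjoint_family (\<lambda>n. ball (a n) (\<rho> n))"
    and neg: "negligible (O' - (\<Union>n. ball (a n) (\<rho> n)))" and lim: "\<rho> \<longlonglongrightarrow> 0"
    using fine_ball_partition[where P=P, OF O fine] by blast
  define D where "D n = ball (a n) (\<rho> n)" for n
  define T where "T n = (if n \<in> N then (\<lambda>x. a n + \<rho> n *\<^sub>R x) ` bD (a n) else {})" for n
  define w where "w n = (if n \<in> N then (\<lambda>x. \<rho> n *\<^sub>R bw (a n) ((x - a n) /\<^sub>R \<rho> n)) else (\<lambda>_. 0))" for n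
  define G where "G n = (if n \<in> N then (\<lambda>x. bG (a n) ((x - a n) /\<^sub>R \<rho> n)) else (\<lambda>_. 0))" for n
  have Doff: "D n = {}" if "n \<notin> N" for n using off[OF that] by (simp add: D_def)
  have Dsub: "D n \<subseteq> O'" for n
  proof (cases "n \<in> N")
    case True
    show ?thesis unfolding D_def using part[OF True] by blast
  next
    case False
    then show ?thesis using Doff by blast
  qed
  have blk: "pw_perturbation (D n) (T n) (w n) (G n) \<and> (\<forall>x. norm (w n x) \<le> \<rho> n) \<and> (\<forall>x\<in>D n. F x + G n x \<in> V) \<and>
      (\<forall>x. norm (G n x) \<le> 2 * R) \<and>
      (LINT x:D n|lborel. infdist (F x + G n x) S) \<le> (\<epsilon> + \<delta>) * measure lborel (D n) \<and>
      (\<forall>H\<in>HH. \<bar>LINT x:D n|lborel. G n x \<bullet> H x\<bar> \<le> (2 * R * \<eta>) * measure lborel (D n))" for n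
  proof (cases "n \<in> N")
    case True
    note p = part[OF True]
    then have an: "a n \<in> O'" by blast
    have Fc: "continuous_on (ball (a n) (\<rho> n)) F" and Hc: "\<And>H. H \<in> HH \<Longrightarrow> continuous_on (ball (a n) (\<rho> n)) H"
      using p F HH(2) continuous_on_subset by blast+
    have Fb: "\<And>x. x \<in> ball (a n) (\<rho> n) \<Longrightarrow> norm (F x - F (a n)) < br (a n)"
      "\<And>x. x \<in> ball (a n) (\<rho> n) \<Longrightarrow> norm (F x - F (a n)) \<le> \<delta>"
      and Hb: "\<And>H x. H \<in> HH \<Longrightarrow> x \<in> ball (a n) (\<rho> n) \<Longrightarrow> norm (H x - H (a n)) \<le> \<eta>"
      using p unfolding P_def by blast+
    have b: "pw_perturbation (ball 0 1) (bD (a n)) (bw (a n)) (bG (a n))" "\<And>x. norm (bw (a n) x) \<le> 1"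
      "\<And>x h. norm h < br (a n) \<Longrightarrow> F (a n) + bG (a n) x + h \<in> V"
      "(LINT x:ball 0 1|lborel. infdist (F (a n) + bG (a n) x) S) \<le> \<epsilon> * measure lborel (ball (0::real^2) 1)"
      "br (a n) > 0"
      using bl[OF an] by blast+
    have \<rho>: "0 < \<rho> n" using p by blast
    let ?S = "\<lambda>x. (x - a n) /\<^sub>R \<rho> n"
    have ab1: "pw_perturbation (ball (a n) (\<rho> n)) ((\<lambda>x. a n + \<rho> n *\<^sub>R x) ` bD (a n)) (\<lambda>x. \<rho> n *\<^sub>R bw (a n) (?S x)) (\<lambda>x. bG (a n) (?S x))"
      by (rule approximable_ball(1)[where D'="bD (a n)" and w="bw (a n)" and G="bG (a n)" and r="br (a n)" and F=F and a="a n" and V=V and S=S and \<epsilon>=\<epsilon> and R=R and \<rho>="\<rho> n" and \<delta>=\<delta>]; (assumption | rule b Vb \<rho> Fc Fb)+)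
    have ab2: "norm (\<rho> n *\<^sub>R bw (a n) (?S x)) \<le> \<rho> n" for x
      by (rule approximable_ball(2)[where D'="bD (a n)" and w="bw (a n)" and G="bG (a n)" and r="br (a n)" and F=F and a="a n" and V=V and S=S and \<epsilon>=\<epsilon> and R=R and \<rho>="\<rho> n" and \<delta>=\<delta>]; (assumption | rule b Vb \<rho> Fc Fb)+)
    have ab3: "x \<in> ball (a n) (\<rho> n) \<Longrightarrow> F x + bG (a n) (?S x) \<in> V" for x
      by (rule approximable_ball(3)[where D'="bD (a n)" and w="bw (a n)" and G="bG (a n)" and r="br (a n)" and F=F and a="a n" and V=V and S=S and \<epsilon>=\<epsilon> and R=R and \<rho>="\<rho> n" and \<delta>=\<delta>]; (assumption | rule b Vb \<rho> Fc Fb)+)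
    have ab4: "norm (bG (a n) (?S x)) \<le> 2 * R" for x
      by (rule approximable_ball(4)[where D'="bD (a n)" and w="bw (a n)" and G="bG (a n)" and r="br (a n)" and F=F and a="a n" and V=V and S=S and \<epsilon>=\<epsilon> and R=R and \<rho>="\<rho> n" and \<delta>=\<delta>]; (assumption | rule b Vb \<rho> Fc Fb)+)
    have ab5: "(LINT x:ball (a n) (\<rho> n)|lborel. infdist (F x + bG (a n) (?S x)) S) \<le> (\<epsilon> + \<delta>) * measure lborel (ball (a n) (\<rho> n))"
      by (rule approximable_ball(5)[where D'="bD (a n)" and w="bw (a n)" and G="bG (a n)" and r="br (a n)" and F=F and a="a n" and V=V and S=S and \<epsilon>=\<epsilon> and R=R and \<rho>="\<rho> n" and \<delta>=\<delta>]; (assumption | rule b Vb \<rho> Fc Fb)+)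
    have ab6: "\<bar>LINT x:ball (a n) (\<rho> n)|lborel. bG (a n) (?S x) \<bullet> H x\<bar> \<le> (2 * R * \<eta>) * measure lborel (ball (a n) (\<rho> n))"
      if H: "H \<in> HH" for H
      by (rule approximable_ball(6)[where D'="bD (a n)" and w="bw (a n)" and G="bG (a n)" and r="br (a n)" and F=F and a="a n" and V=V and S=S and \<epsilon>=\<epsilon> and R=R and \<rho>="\<rho> n" and \<delta>=\<delta> and H=H and \<eta>=\<eta>]; (assumption | rule b Vb \<rho> Fc Fb Hc[OF H] Hb[OF H])+)
    show ?thesis
      unfolding D_def T_def w_def G_def if_P[OF True]
      using ab1 ab2 ab3 ab4 ab5 ab6 by blast
  next
    case False
    then show ?thesis
      using Doff[OF False] pw_perturbation_zero[of "{}"] off[OF False] R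
      by (auto simp: T_def w_def G_def set_lebesgue_integral_def)
  qed
  have disj': "disjoint_family D" using disj by (simp add: D_def[abs_def])
  have negU: "negligible (O' - (\<Union>n. D n))" using neg by (simp add: D_def)
  have pw: "pw_perturbation O' (\<Union>n. T n) (glue D w) (glue D G)"
    by (rule glue_pw_perturbation[OF disj' _ Dsub O(2) _ negU, where c=\<rho> and M="2*R"])
      (use blk lim in \<open>auto simp: D_def\<close>)
  then have GP: "perturbation O' (glue D w) (glue D G)" by (simp add: pw_perturbation_def)
  have Tsub: "T n \<subseteq> D n" for n using blk[of n] by (auto simp: pw_perturbation_def)
  have in_D: "glue D G x = G n x" if "x \<in> D n" for n x by (rule glue_inside[OF disj' that])
  have \<rho>\<delta>: "\<rho> n \<le> \<delta>" for n using part[of n] off[of n] \<delta> by (cases "n \<in> N") (auto simp: P_def)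
  have nw: "norm (glue D w x) \<le> \<delta>" for x
    using blk \<rho>\<delta> by (intro glue_norm_le[OF disj']) (meson order_trans)
  have nG: "norm (glue D G x) \<le> 2 * R" for x
    using blk by (intro glue_norm_le[OF disj']) blast
  have FV: "F x + glue D G x \<in> V" if "x \<in> (\<Union>n. T n)" for x
    using that Tsub blk in_D by fastforce
  have FR: "norm (F x) \<le> R" if "x \<in> O'" for x
    using Vb[OF approximable_mem[OF good[OF that]]] .
  have "\<bar>LINT x:O'|lborel. infdist (F x + glue D G x) S\<bar> \<le> (\<epsilon> + \<delta>) * measure lborel O'"
  proof (rule set_integral_glue_le[OF disj' _ Dsub O(2) _ negU, where g="\<lambda>n x. infdist (F x + G n x) S" and M="3 * R + infdist 0 S"])
    show "(\<lambda>x. indicator O' x *\<^sub>R infdist (F x + glue D G x) S) \<in> borel_measurable borel"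
      by (rule borel_measurable_indicator_infdist[OF _ F perturbationD(4)[OF GP]]) (use O in auto)
    show "\<bar>infdist (F x + glue D G x) S\<bar> \<le> 3 * R + infdist 0 S" if "x \<in> O'" for x
      using infdist_le_norm[of "F x + glue D G x" S] norm_triangle_ineq[of "F x" "glue D G x"] FR[OF that] nG[of x]
      by (simp add: infdist_nonneg)
    show "\<bar>LINT x:D n|lborel. infdist (F x + G n x) S\<bar> \<le> (\<epsilon> + \<delta>) * measure lborel (D n)" for n
    proof -
      have "0 \<le> (LINT x:D n|lborel. infdist (F x + G n x) S)"
        unfolding set_lebesgue_integral_def by (intro Bochner_Integration.integral_nonneg) (auto simp: infdist_nonneg)
      then show ?thesis using blk[of n] by simp
    qed
  qed (use in_D O \<epsilon> \<delta> in \<open>auto simp: D_def\<close>)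
  then have avg: "(LINT x:O'|lborel. infdist (F x + glue D G x) S) \<le> (\<epsilon> + \<delta>) * measure lborel O'" by linarith
  have orth: "\<bar>LINT x:O'|lborel. glue D G x \<bullet> H x\<bar> \<le> \<delta> * measure lborel O'" if H: "H \<in> HH" for H
  proof (rule set_integral_glue_le[OF disj' _ Dsub O(2) _ negU, where g="\<lambda>n x. G n x \<bullet> H x" and M="2 * R * R"])
    show "(\<lambda>x. indicator O' x *\<^sub>R (glue D G x \<bullet> H x)) \<in> borel_measurable borel"
      by (rule borel_measurable_indicator_inner[OF _ HH(2)[OF H] perturbationD(4)[OF GP]]) (use O in auto)
    show "\<bar>glue D G x \<bullet> H x\<bar> \<le> 2 * R * R" if "x \<in> O'" for x
    proof -
      have "\<bar>glue D G x \<bullet> H x\<bar> \<le> norm (glue D G x) * norm (H x)" by (rule Cauchy_Schwarz_ineq2)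
      also have "\<dots> \<le> 2 * R * R" using nG[of x] HH(3)[OF H that] R by (intro mult_mono) auto
      finally show ?thesis .
    qed
    show "\<bar>LINT x:D n|lborel. G n x \<bullet> H x\<bar> \<le> \<delta> * measure lborel (D n)" for n
    proof -
      have "(2 * R * \<eta>) * measure lborel (D n) \<le> \<delta> * measure lborel (D n)"
        using \<eta> by (intro mult_right_mono) auto
      then show ?thesis using blk[of n] H by fastforce
    qed
  qed (use in_D O \<delta> in \<open>auto simp: D_def\<close>)
  show thesis by (rule that[OF pw nw FV nG avg orth])
qed

section \<open>Every interior point of the lamination hull is approximable\<close>

lemma approximable_mono: "approximable U S \<epsilon> A \<Longrightarrow> \<epsilon> \<le> \<epsilon>' \<Longrightarrow> approximable U S \<epsilon>' A"
proof -
  assume a: "approximable U S \<epsilon> A" "\<epsilon> \<le> \<epsilon>'"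
  have "\<epsilon> * measure lborel (ball (0::real^2) 1) \<le> \<epsilon>' * measure lborel (ball (0::real^2) 1)"
    using a by (intro mult_right_mono) auto
  then show ?thesis using a(1) unfolding approximable_def by (meson order_trans)
qed

text \<open>Half of the margin is kept as margin, the other half shrinks the target set. A field with values in the
  smaller set may still be perturbed by \<open>r\<close>.\<close>

lemma approximable_shrink:
  assumes "approximable U S \<epsilon> A"
  obtains r where "r > 0" "approximable {X. \<forall>h. norm h < r \<longrightarrow> X + h \<in> U} S \<epsilon> A"
proof -
  obtain w G D' r where *: "r > 0" "pw_perturbation (ball 0 1) D' w G" "\<forall>x. norm (w x) \<le> 1"
     "\<And>x h. norm h < r \<Longrightarrow> A + G x + h \<in> U"
     "(LINT x:ball 0 1|lborel. infdist (A + G x) S) \<le> \<epsilon> * measure lborel (ball (0::real^2) 1)"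
    using assms unfolding approximable_def by blast
  have "A + G x + h + h' \<in> U" if "norm h < r / 2" "norm h' < r / 2" for x h h'
    using *(4)[of "h + h'" x] that norm_triangle_ineq[of h h'] by (simp add: add.assoc)
  then have "approximable {X. \<forall>h. norm h < r / 2 \<longrightarrow> X + h \<in> U} S \<epsilon> A"
    unfolding approximable_def using * by (intro exI[of _ w] exI[of _ G] exI[of _ D'] exI[of _ "r / 2"]) auto
  then show thesis using that[of "r / 2"] *(1) by simp
qed

lemma approximable_const:
  assumes "infdist A S \<le> \<epsilon>" "A \<in> U" "open U"
  shows "approximable U S \<epsilon> A"
proof -
  obtain r where r: "r > 0" "ball A r \<subseteq> U" using assms open_contains_ball by blast
  have "A + 0 + h \<in> U" if "norm h < r" for h using r that by (auto simp: subset_iff dist_norm)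
  moreover have "(LINT x:ball (0::real^2) 1|lborel. infdist (A + 0) S) \<le> \<epsilon> * measure lborel (ball (0::real^2) 1)"
    using assms(1) emeasure_lborel_ball_finite[of "0::real^2" 1]
      mult_right_mono[OF assms(1), of "measure lborel (ball (0::real^2) 1)"]
    by (subst set_integral_const) (auto simp: mult.commute less_top)
  ultimately show ?thesis
    unfolding approximable_def using r pw_perturbation_zero[OF open_ball, of 0 1]
    by (intro exI[of _ "\<lambda>_. 0"] exI[of _ "ball 0 1"] exI[of _ r]) auto
qed

text \<open>Start from the simple laminate between \<open>B\<close> and \<open>C\<close>. On the two open sets where its gradient equals \<open>B\<close> or \<open>C\<close>
  superpose the perturbations that bring \<open>B\<close> and \<open>C\<close> close to \<open>S\<close>; the rest of the disc has small measure, and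
  there the gradient is close to the segment, hence in \<open>U\<close>. The set \<open>{X. \<forall>h. norm h < r \<longrightarrow> X + h \<in> U}\<close> takes the
  place of \<open>U\<close> in the patches, to retain a uniform margin.\<close>

lemma approximable_lamination:
  assumes B: "approximable U S \<epsilon> B" and C: "approximable U S \<epsilon> C" and \<epsilon>: "\<epsilon> \<ge> 0"
    and det: "det (B - C) = 0" and t: "0 \<le> t" "t \<le> 1"
    and U: "open U" "\<And>X. X \<in> U \<Longrightarrow> norm X \<le> R" and seg: "closed_segment B C \<subseteq> U" and \<eta>: "\<eta> > 0"
  shows "approximable U S (\<epsilon> + \<eta>) (t *\<^sub>R B + (1 - t) *\<^sub>R C)"
proof (cases "t = 0 \<or> t = 1 \<or> B = C")
  case True
  then have "t *\<^sub>R B + (1 - t) *\<^sub>R C = B \<or> t *\<^sub>R B + (1 - t) *\<^sub>R C = C"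
    by (auto simp flip: scaleR_left_distrib)
  then show ?thesis using approximable_mono[OF B, of "\<epsilon> + \<eta>"] approximable_mono[OF C, of "\<epsilon> + \<eta>"] \<eta> by auto
next
  case False
  then have t': "0 < t" "t < 1" and ne: "B \<noteq> C" using t by auto
  define A where "A = t *\<^sub>R B + (1 - t) *\<^sub>R C"
  obtain rB where rB: "rB > 0" "approximable {X. \<forall>h. norm h < rB \<longrightarrow> X + h \<in> U} S \<epsilon> B"
    using approximable_shrink[OF B] by blast
  obtain rC where rC: "rC > 0" "approximable {X. \<forall>h. norm h < rC \<longrightarrow> X + h \<in> U} S \<epsilon> C"
    using approximable_shrink[OF C] by blast
  obtain r0 where r0: "r0 > 0" and r0U: "(\<Union>x\<in>closed_segment B C. ball x r0) \<subseteq> U"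
    using compact_subset_open_imp_ball_epsilon_subset[OF compact_segment U(1) seg] by blast
  have segU: "l *\<^sub>R B + (1 - l) *\<^sub>R C + h \<in> U" if "0 \<le> l" "l \<le> 1" "norm h < r0" for l h
  proof -
    have "l *\<^sub>R B + (1 - l) *\<^sub>R C \<in> closed_segment B C"
      unfolding in_segment using that by (intro exI[of _ "1 - l"]) simp
    moreover have "l *\<^sub>R B + (1 - l) *\<^sub>R C + h \<in> ball (l *\<^sub>R B + (1 - l) *\<^sub>R C) r0"
      using that by (simp add: dist_norm)
    ultimately show ?thesis using r0U by blast
  qed
  define V where "V = measure lborel (ball (0::real^2) 1)"
  have V: "V > 0" unfolding V_def by (simp add: content_ball_pos)
  define M where "M = R + infdist 0 S"
  have R: "R \<ge> 0" using U(2)[OF approximable_mem[OF B]] norm_ge_zero[of B] by linarith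
  then have M: "M \<ge> 0" by (simp add: M_def infdist_nonneg)
  \<comment> \<open>Small enough for three purposes: to keep the laminate in \<open>U\<close>, to keep the total displacement at most 1, and to make
    the part of the disc outside \<open>OB\<close> and \<open>OC\<close> contribute at most \<open>\<eta> V / 2\<close>, as the distance to \<open>S\<close> is bounded by \<open>M\<close>.\<close>
  define e where "e = min (r0 / 2) (min (1 / 2) (\<eta> * V / (2 * (M + 1))))"
  have e: "e > 0" "e \<le> r0 / 2" "e \<le> 1 / 2" "M * e \<le> \<eta> * V / 2"
  proof -
    show "e > 0" using r0 \<eta> V M by (auto simp: e_def)
    show "e \<le> r0 / 2" "e \<le> 1 / 2" unfolding e_def by linarith+
    have "M * e \<le> (M + 1) * (\<eta> * V / (2 * (M + 1)))"
      using M \<eta> V \<open>e > 0\<close> by (intro mult_mono) (auto simp: e_def)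
    also have "\<dots> = \<eta> * V / 2" using M by (simp add: field_simps)
    finally show "M * e \<le> \<eta> * V / 2" .
  qed
  define \<delta> where "\<delta> = min (1 / 2) (\<eta> / 2)"
  have \<delta>: "\<delta> > 0" "\<delta> \<le> 1 / 2" "\<delta> \<le> \<eta> / 2" using \<eta> by (auto simp: \<delta>_def)
  obtain w0 G0 OB OC OR where blk: "pw_perturbation (ball 0 1) (OB \<union> OC \<union> OR) w0 G0" "\<And>x. norm (w0 x) \<le> e"
    and near: "\<And>x. \<exists>l. 0 \<le> l \<and> l \<le> 1 \<and> norm (A + G0 x - (l *\<^sub>R B + (1 - l) *\<^sub>R C)) \<le> e"
    and op: "open OB" "open OC" "open OR" and dj: "OB \<inter> OC = {}" "(OB \<union> OC) \<inter> OR = {}"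
    and OBC: "\<And>x. x \<in> OB \<Longrightarrow> A + G0 x = B" "\<And>x. x \<in> OC \<Longrightarrow> A + G0 x = C"
    and rest: "measure lborel (ball 0 1 - (OB \<union> OC)) \<le> e"
  proof (rule lamination_block[OF det ne t' A_def e(1)], goal_cases)
    case (1 w G OB OC OR)
    show ?case by (rule that[of OB OC OR w G]; fact)
  qed
  have sub: "OB \<union> OC \<union> OR \<subseteq> ball 0 1" using blk(1) by (simp add: pw_perturbation_def)
  have bdd: "bounded OB" "bounded OC" using sub bounded_subset[OF bounded_ball[of "0::real^2" 1]] by auto
  have VU: "norm X \<le> R" if "X \<in> {X. \<forall>h. norm h < r \<longrightarrow> X + h \<in> U}" "r > 0" for X r
  proof -
    have "norm (0 :: real^2^2) < r \<longrightarrow> X + 0 \<in> U" using that(1) by blast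
    then show ?thesis using U(2)[of X] that(2) by simp
  qed
  obtain w1 G1 T1 where p1: "pw_perturbation OB T1 w1 G1" "\<And>x. norm (w1 x) \<le> \<delta>"
    "\<And>x. x \<in> T1 \<Longrightarrow> B + G1 x \<in> {X. \<forall>h. norm h < rB \<longrightarrow> X + h \<in> U}" "\<And>x. norm (G1 x) \<le> 2 * R"
    "(LINT x:OB|lborel. infdist (B + G1 x) S) \<le> (\<epsilon> + \<delta>) * measure lborel OB"
    by (rule approximable_patch[OF op(1) bdd(1) continuous_on_const rB(2) \<epsilon> VU[OF _ rB(1)] R finite.emptyI _ _ \<delta>(1)])
      (assumption | simp | (rule that; fact))+
  obtain w2 G2 T2 where p2: "pw_perturbation OC T2 w2 G2" "\<And>x. norm (w2 x) \<le> \<delta>"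
    "\<And>x. x \<in> T2 \<Longrightarrow> C + G2 x \<in> {X. \<forall>h. norm h < rC \<longrightarrow> X + h \<in> U}" "\<And>x. norm (G2 x) \<le> 2 * R"
    "(LINT x:OC|lborel. infdist (C + G2 x) S) \<le> (\<epsilon> + \<delta>) * measure lborel OC"
    by (rule approximable_patch[OF op(2) bdd(2) continuous_on_const rC(2) \<epsilon> VU[OF _ rC(1)] R finite.emptyI _ _ \<delta>(1)])
      (assumption | simp | (rule that; fact))+
  define D where "D n = (if n = 0 then OB else if n = 1 then OC else if n = 2 then OR else {})" for n :: nat
  define T where "T n = (if n = 0 then T1 else if n = 1 then T2 else if n = 2 then OR else {})" for n :: nat
  define w where "w n = (if n = 0 then w1 else if n = 1 then w2 else (\<lambda>_. 0))" for n :: nat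
  define G where "G n = (if n = 0 then G1 else if n = 1 then G2 else (\<lambda>_. 0))" for n :: nat
  have UD: "(\<Union>n. D n) = OB \<union> OC \<union> OR"
  proof
    show "OB \<union> OC \<union> OR \<subseteq> (\<Union>n. D n)"
      using UN_upper[of 0 UNIV D] UN_upper[of 1 UNIV D] UN_upper[of 2 UNIV D] by (auto simp: D_def)
  qed (auto simp: D_def split: if_splits)
  have UT: "(\<Union>n. T n) = T1 \<union> T2 \<union> OR"
  proof
    show "T1 \<union> T2 \<union> OR \<subseteq> (\<Union>n. T n)"
      using UN_upper[of 0 UNIV T] UN_upper[of 1 UNIV T] UN_upper[of 2 UNIV T] by (auto simp: T_def)
  qed (auto simp: T_def split: if_splits)
  have disj: "disjoint_family D" using dj by (auto simp: disjoint_family_on_def D_def)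
  have pwn: "pw_perturbation (D n) (T n) (w n) (G n)" for n
    using p1(1) p2(1) pw_perturbation_zero[OF op(3)] pw_perturbation_zero[of "{}"]
    by (auto simp: D_def T_def w_def G_def)
  have pwD: "pw_perturbation (OB \<union> OC \<union> OR) (\<Union>n. T n) (glue D w) (glue D G)"
  proof (rule glue_pw_perturbation[OF disj _ _ _ pwn, where c="\<lambda>n. if n < 2 then \<delta> else 0" and M="2 * R"])
    show "(\<lambda>n. if n < 2 then \<delta> else 0) \<longlonglongrightarrow> 0"
      by (rule tendsto_eventually) (auto simp: eventually_sequentially intro!: exI[of _ 2])
    show "bounded (OB \<union> OC \<union> OR)" using sub bounded_subset[OF bounded_ball] by blast
    show "negligible (OB \<union> OC \<union> OR - (\<Union>n. D n))" unfolding UD by simp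
    show "D n \<subseteq> OB \<union> OC \<union> OR" for n using UD by blast
  qed (use op p1 p2 R in \<open>auto simp: D_def w_def G_def\<close>)
  define Gt where "Gt x = (if x \<in> (\<Union>n. T n) then G0 x + glue D G x else 0)" for x
  have pw: "pw_perturbation (ball 0 1) (\<Union>n. T n) (\<lambda>x. w0 x + glue D w x) Gt"
    unfolding Gt_def[abs_def] by (rule pw_perturbation_add[OF blk(1) pwD]) simp
  have wb: "norm (w0 x + glue D w x) \<le> 1" for x
  proof -
    have "norm (glue D w x) \<le> \<delta>"
      by (rule glue_norm_le[OF disj]) (use p1 p2 \<delta> in \<open>auto simp: w_def\<close>)
    then show ?thesis using blk(2)[of x] e \<delta> norm_triangle_ineq[of "w0 x" "glue D w x"] by linarith
  qed
  have Tsub: "T1 \<subseteq> OB" "T2 \<subseteq> OC" using p1(1) p2(1) by (auto simp: pw_perturbation_def)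
  have inB: "A + Gt x = B + G1 x" if "x \<in> T1" for x
  proof -
    have "glue D G x = G1 x" using glue_inside[OF disj, of x 0 G] that Tsub by (auto simp: D_def G_def)
    then show ?thesis using that OBC(1)[of x] Tsub unfolding Gt_def UT by (auto simp: add.assoc[symmetric])
  qed
  have inC: "A + Gt x = C + G2 x" if "x \<in> T2" for x
  proof -
    have "glue D G x = G2 x" using glue_inside[OF disj, of x 1 G] that Tsub by (auto simp: D_def G_def)
    then show ?thesis using that OBC(2)[of x] Tsub unfolding Gt_def UT by (auto simp: add.assoc[symmetric])
  qed
  have inR: "A + Gt x = A + G0 x" if "x \<in> OR" for x
  proof -
    have "glue D G x = 0" using glue_inside[OF disj, of x 2 G] that by (auto simp: D_def G_def)
    then show ?thesis using that unfolding Gt_def UT by auto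
  qed
  define r where "r = min rB (min rC (r0 / 2))"
  have val: "A + Gt x + h \<in> U" if h: "norm h < r" for x h
  proof (cases "x \<in> T1 \<or> x \<in> T2")
    case True
    then show ?thesis using inB inC p1(3) p2(3) h by (auto simp: r_def)
  next
    case nT: False
    show ?thesis
    proof (cases "x \<in> OR")
      case True
      obtain l where l: "0 \<le> l" "l \<le> 1" "norm (A + G0 x - (l *\<^sub>R B + (1 - l) *\<^sub>R C)) \<le> e" using near by blast
      have "norm (A + G0 x - (l *\<^sub>R B + (1 - l) *\<^sub>R C) + h) < r0"
        using norm_triangle_ineq[of "A + G0 x - (l *\<^sub>R B + (1 - l) *\<^sub>R C)" h] l(3) e h by (simp add: r_def)
      from segU[OF l(1,2) this] show ?thesis using inR[OF True] by (simp add: add.assoc)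
    next
      case False
      then have "Gt x = 0" using nT UT by (simp add: Gt_def)
      then show ?thesis using segU[OF t, of h] h r0 by (simp add: A_def r_def)
    qed
  qed
  have rpos: "r > 0" using rB rC r0 by (simp add: r_def)
  let ?f = "\<lambda>x. infdist (A + Gt x) S"
  have Gm [measurable]: "Gt \<in> borel_measurable borel" "G1 \<in> borel_measurable borel" "G2 \<in> borel_measurable borel"
    using pw p1(1) p2(1) by (auto simp: pw_perturbation_def perturbation_def)
  have fM: "0 \<le> ?f x \<and> ?f x \<le> M" for x
    using infdist_le_norm[of "A + Gt x" S] U(2)[OF val[of 0 x]] rpos by (simp add: M_def infdist_nonneg)
  have int: "set_integrable lborel X ?f" if "X \<in> sets borel" "bounded X" for X
    using fM that by (intro set_integrable_bounded[where M=M]) auto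
  have ae: "(LINT x:OB|lborel. ?f x) = (LINT x:OB|lborel. infdist (B + G1 x) S)"
    "(LINT x:OC|lborel. ?f x) = (LINT x:OC|lborel. infdist (C + G2 x) S)"
  proof -
    have neg: "negligible (OB - T1)" "negligible (OC - T2)" using p1(1) p2(1) by (auto simp: pw_perturbation_def)
    have [measurable]: "OB \<in> sets borel" "OC \<in> sets borel" using op by auto
    show "(LINT x:OB|lborel. ?f x) = (LINT x:OB|lborel. infdist (B + G1 x) S)"
      unfolding set_lebesgue_integral_def
    proof (rule integral_cong_AE)
      show "AE x in lborel. indicat_real OB x *\<^sub>R ?f x = indicat_real OB x *\<^sub>R infdist (B + G1 x) S"
        by (rule AE_lborel_negligible[OF neg(1)]) (use inB in \<open>auto split: split_indicator\<close>)
    qed measurable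
    show "(LINT x:OC|lborel. ?f x) = (LINT x:OC|lborel. infdist (C + G2 x) S)"
      unfolding set_lebesgue_integral_def
    proof (rule integral_cong_AE)
      show "AE x in lborel. indicat_real OC x *\<^sub>R ?f x = indicat_real OC x *\<^sub>R infdist (C + G2 x) S"
        by (rule AE_lborel_negligible[OF neg(2)]) (use inC in \<open>auto split: split_indicator\<close>)
    qed measurable
  qed
  let ?Q = "ball 0 1 - (OB \<union> OC)"
  have Qm: "?Q \<in> sets borel" "bounded ?Q" "OB \<union> OC \<in> sets borel" "bounded (OB \<union> OC)" using op bdd by (auto intro: bounded_diff)
  have fin: "X \<in> fmeasurable lborel" if "X \<in> sets borel" "bounded X" for X :: "(real^2) set"
    using that emeasure_bounded_finite[of X] by (auto simp: fmeasurable_def)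
  have "(LINT x:ball 0 1|lborel. ?f x) = (LINT x:(OB \<union> OC) \<union> ?Q|lborel. ?f x)"
    using sub by (intro arg_cong[where f="\<lambda>X. LINT x:X|lborel. ?f x"]) auto
  also have "\<dots> = (LINT x:OB \<union> OC|lborel. ?f x) + (LINT x:?Q|lborel. ?f x)"
    using Qm by (intro set_integral_Un int) auto
  also have "(LINT x:OB \<union> OC|lborel. ?f x) = (LINT x:OB|lborel. ?f x) + (LINT x:OC|lborel. ?f x)"
    using op bdd dj by (intro set_integral_Un int) auto
  also have "(LINT x:?Q|lborel. ?f x) \<le> (LINT x:?Q|lborel. M)"
  proof (rule set_integral_mono[OF int])
    show "set_integrable lborel ?Q (\<lambda>x. M)" using fin[OF Qm(1,2)] by (auto simp: set_integrable_def fmeasurable_def less_top)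
  qed (use Qm fM in auto)
  also have "(LINT x:?Q|lborel. M) = M * measure lborel ?Q"
    using fin[OF Qm(1,2)] by (subst set_integral_const) (auto simp: fmeasurable_def less_top)
  also have "M * measure lborel ?Q \<le> M * e" using rest M by (intro mult_left_mono)
  also have "M * e \<le> \<eta> * V / 2" by (rule e(4))
  also have "(LINT x:OB|lborel. ?f x) + (LINT x:OC|lborel. ?f x) \<le> (\<epsilon> + \<delta>) * (measure lborel OB + measure lborel OC)"
    unfolding ae using p1(5) p2(5) by (simp add: distrib_left)
  also have "measure lborel OB + measure lborel OC = measure lborel (OB \<union> OC)"
    using fin[of OB] fin[of OC] op bdd dj
    by (intro measure_Union[symmetric]) (auto simp: fmeasurable_def less_top)
  also have "measure lborel (OB \<union> OC) \<le> V"
    unfolding V_def using sub Qm fin by (intro measure_mono_fmeasurable) auto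
  finally have "(LINT x:ball 0 1|lborel. ?f x) \<le> (\<epsilon> + \<delta>) * V + \<eta> * V / 2"
    using \<epsilon> \<delta> by (simp add: mult_left_mono)
  also have "\<dots> \<le> (\<epsilon> + \<eta> / 2) * V + \<eta> * V / 2" using \<delta> V by (intro add_right_mono mult_right_mono) auto
  also have "\<dots> = (\<epsilon> + \<eta>) * V" by (simp add: field_simps)
  finally have "(LINT x:ball 0 1|lborel. ?f x) \<le> (\<epsilon> + \<eta>) * measure lborel (ball (0::real^2) 1)"
    unfolding V_def .
  then show ?thesis
    unfolding approximable_def A_def[symmetric] using pw wb val rpos by blast
qed

text \<open>Choose \<open>s < 1\<close> so close to 1 that \<open>A / s\<close> is still in the hull and \<open>s E\<close> is within \<open>\<epsilon> / 2\<close> of \<open>E\<close>. Induction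
  over the splittings that produce \<open>A / s\<close> shows that \<open>s X\<close> is approximable for every matrix \<open>X\<close> that occurs,
  because multiplied by \<open>s\<close> all of these matrices are interior points.\<close>

theorem interior_hull_approximable:
  assumes K: "\<And>x y. (x, y) \<in> K \<Longrightarrow> 0 < x \<and> x \<le> y" and bd: "bounded K"
    and A: "A \<in> interior (lamination_hull (singular_value_set K))" and \<epsilon>: "\<epsilon> > 0"
  shows "approximable (interior (lamination_hull (singular_value_set K))) (singular_value_set K) \<epsilon> A"
proof -
  let ?E = "singular_value_set K" and ?L = "lamination_hull (singular_value_set K)"
  obtain R where R: "R > 0" "\<And>X. X \<in> ?E \<Longrightarrow> norm X \<le> R"
    using bounded_singular_value_set[OF bd] bounded_pos by blast
  have "?L \<subseteq> cball 0 R" by (rule lamination_hull_subset_convex) (use R in auto)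
  then have UR: "norm X \<le> R" if "X \<in> interior ?L" for X using that interior_subset[of ?L] by auto
  \<comment> \<open>Dilating by a factor slightly larger than one keeps \<open>A\<close> in the hull.\<close>
  have "((\<lambda>s. inverse s *\<^sub>R A) \<longlongrightarrow> inverse 1 *\<^sub>R A) (at_left (1::real))"
    by (intro tendsto_intros) auto
  then have "\<forall>\<^sub>F s in at_left 1. inverse s *\<^sub>R A \<in> interior ?L"
    using A by (intro topological_tendstoD) auto
  moreover have "\<forall>\<^sub>F s in at_left (1::real). max 0 (1 - \<epsilon> / (2 * R)) < s \<and> s < 1"
    using \<epsilon> R by (intro eventually_at_leftI[of "max 0 (1 - \<epsilon> / (2 * R))"]) auto
  ultimately have "\<forall>\<^sub>F s in at_left (1::real). inverse s *\<^sub>R A \<in> interior ?L \<and> max 0 (1 - \<epsilon> / (2 * R)) < s \<and> s < 1"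
    by eventually_elim auto
  then obtain s where s: "inverse s *\<^sub>R A \<in> interior ?L" "0 < s" "s < 1" "1 - \<epsilon> / (2 * R) < s"
    using eventually_happens[of _ "at_left (1::real)"] by fastforce
  have sR: "(1 - s) * R \<le> \<epsilon> / 2" using s(4) R by (simp add: field_simps)
  have claim: "approximable (interior ?L) ?E (\<epsilon> / 2 + \<eta>) (s *\<^sub>R X)" if "X \<in> ?L" "\<eta> > 0" for X \<eta>
    using that
  proof (induction arbitrary: \<eta>)
    case (base X)
    have "infdist (s *\<^sub>R X) ?E \<le> dist (s *\<^sub>R X) X" by (rule infdist_le[OF base(1)])
    also have "\<dots> = (1 - s) * norm X"
      using s by (simp add: dist_norm scaleR_left_diff_distrib[of s 1 X, simplified, symmetric] abs_if)
    also have "\<dots> \<le> (1 - s) * R" using R(2)[OF base(1)] s by (intro mult_left_mono) auto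
    finally have "infdist (s *\<^sub>R X) ?E \<le> \<epsilon> / 2 + \<eta>" using sR base by linarith
    then show ?case
      using scaled_singular_value_set_interior[OF K base(1) s(2,3)] by (intro approximable_const) auto
  next
    case (step X Y t)
    have d: "det (s *\<^sub>R X - s *\<^sub>R Y) = 0"
      using step(3) by (simp add: det_2 flip: scaleR_diff_right)
    have XY: "s *\<^sub>R X \<in> interior ?L" "s *\<^sub>R Y \<in> interior ?L"
      using step s K by (auto intro!: scaled_lamination_hull_interior)
    have "closed_segment (s *\<^sub>R X) (s *\<^sub>R Y) \<subseteq> interior ?L"
    proof
      fix Z assume "Z \<in> closed_segment (s *\<^sub>R X) (s *\<^sub>R Y)"
      then obtain u where u: "0 \<le> u" "u \<le> 1" "Z = (1 - u) *\<^sub>R (s *\<^sub>R X) + u *\<^sub>R (s *\<^sub>R Y)"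
        unfolding in_segment by blast
      show "Z \<in> interior ?L"
        using interior_lamination_hull_segment[OF XY d, of "1 - u"] u by simp
    qed
    then have "approximable (interior ?L) ?E (\<epsilon> / 2 + \<eta> / 2 + \<eta> / 2) (t *\<^sub>R (s *\<^sub>R X) + (1 - t) *\<^sub>R (s *\<^sub>R Y))"
      using step.IH[of "\<eta> / 2"] step \<epsilon> d UR
      by (intro approximable_lamination[where R=R]) auto
    then show ?case by (simp add: algebra_simps)
  qed
  have "inverse s *\<^sub>R A \<in> ?L" using s(1) interior_subset by blast
  from claim[OF this, of "\<epsilon> / 2"] show ?thesis using s \<epsilon> by simp
qed

section \<open>Strong convergence of the gradients and exact solutions\<close>

lemma weak_gradient_limit:
  assumes O: "bounded O'" and P: "\<And>n::nat. perturbation O' (w n) (G n)"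
    and wb: "\<And>n x. norm (w n x) \<le> C" and Gb: "\<And>n x. norm (G n x) \<le> C"
    and wl: "\<And>x. (\<lambda>n. w n x) \<longlonglongrightarrow> v x" and Gl: "AE x in lborel. (\<lambda>n. G n x) \<longlonglongrightarrow> H x"
    and Hm: "H \<in> borel_measurable borel"
  shows "weak_gradient v H"
  unfolding weak_gradient_def
proof (intro allI impI)
  fix \<psi> d i j assume h: "has_continuous_gradient \<psi> d"
  note c = has_continuous_gradientD[OF h]
  have [measurable]: "\<psi> \<in> borel_measurable borel" "d \<in> borel_measurable borel"
    using c by (auto intro: borel_measurable_continuous_onI)
  have Gm [measurable]: "G n \<in> borel_measurable borel" and wm [measurable]: "w n \<in> borel_measurable borel" for n
    using perturbationD[OF P] by auto
  note Hm [measurable]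
  have vm [measurable]: "v \<in> borel_measurable borel"
    by (rule borel_measurable_LIMSEQ_metric[OF wm wl])
  obtain \<rho> where \<rho>: "O' \<subseteq> cball 0 \<rho>" using bounded_subset_ballD[OF O, of 0] ball_subset_cball by blast
  have C0: "C \<ge> 0" using wb[of 0 0] norm_ge_zero order_trans by blast
  have ind: "integrable lborel (\<lambda>x. indicator (cball 0 \<rho>) x *\<^sub>R (C * \<bar>q x\<bar>))" if "continuous_on UNIV q" for q :: "real^2 \<Rightarrow> real"
    using that
    by (intro borel_integrable_compact[of "cball 0 \<rho>" "\<lambda>x. C * \<bar>q x\<bar>", unfolded set_integrable_def] continuous_intros)
      (auto intro: continuous_on_subset)
  have comp: "\<bar>y $ i\<bar> \<le> norm y" for y :: "real^2" by (rule component_le_norm_cart)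
  have comp2: "\<bar>y $ i $ j\<bar> \<le> norm y" for y :: "real^2^2"
    using Finite_Cartesian_Product.norm_nth_le[of y i] Finite_Cartesian_Product.norm_nth_le[of "y $ i" j] by simp
  have 1: "(\<lambda>n. \<integral>x. w n x $ i * d x $ j \<partial>lborel) \<longlonglongrightarrow> (\<integral>x. v x $ i * d x $ j \<partial>lborel)"
  proof (rule integral_dominated_convergence[OF _ _ ind[OF c(3)[of j]]])
    show "AE x in lborel. (\<lambda>n. w n x $ i * d x $ j) \<longlonglongrightarrow> v x $ i * d x $ j"
      by (intro AE_I2 tendsto_intros tendsto_vec_nth wl)
    show "AE x in lborel. norm (w n x $ i * d x $ j) \<le> indicator (cball 0 \<rho>) x *\<^sub>R (C * \<bar>d x $ j\<bar>)" for n
    proof (rule AE_I2)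
      fix x
      show "norm (w n x $ i * d x $ j) \<le> indicator (cball 0 \<rho>) x *\<^sub>R (C * \<bar>d x $ j\<bar>)"
      proof (cases "x \<in> cball 0 \<rho>")
        case True
        have "\<bar>w n x $ i\<bar> \<le> C" using comp[of "w n x"] wb[of n x] by linarith
        then show ?thesis using True by (simp add: abs_mult mult_right_mono)
      next
        case False
        then have "w n x = 0" using \<rho> perturbationD(2)[OF P] by blast
        then show ?thesis using False by simp
      qed
    qed
  qed measurable
  have 2: "(\<lambda>n. \<integral>x. G n x $ i $ j * \<psi> x \<partial>lborel) \<longlonglongrightarrow> (\<integral>x. H x $ i $ j * \<psi> x \<partial>lborel)"
  proof (rule integral_dominated_convergence[OF _ _ ind[OF c(1)]])
    show "AE x in lborel. (\<lambda>n. G n x $ i $ j * \<psi> x) \<longlonglongrightarrow> H x $ i $ j * \<psi> x"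
      using Gl by eventually_elim (intro tendsto_intros tendsto_vec_nth)
    show "AE x in lborel. norm (G n x $ i $ j * \<psi> x) \<le> indicator (cball 0 \<rho>) x *\<^sub>R (C * \<bar>\<psi> x\<bar>)" for n
    proof (rule AE_I2)
      fix x
      show "norm (G n x $ i $ j * \<psi> x) \<le> indicator (cball 0 \<rho>) x *\<^sub>R (C * \<bar>\<psi> x\<bar>)"
      proof (cases "x \<in> cball 0 \<rho>")
        case True
        have "\<bar>G n x $ i $ j\<bar> \<le> C" using comp2[of "G n x"] Gb[of n x] by linarith
        then show ?thesis using True by (simp add: abs_mult mult_right_mono)
      next
        case False
        then have "G n x = 0" using \<rho> perturbationD(3)[OF P] by blast
        then show ?thesis using False by simp
      qed
    qed
  qed measurable
  have "(\<integral>x. w n x $ i * d x $ j \<partial>lborel) = - (\<integral>x. G n x $ i $ j * \<psi> x \<partial>lborel)" for n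
    using perturbationD(5)[OF P[of n]] h unfolding weak_gradient_def by blast
  with 1 have "(\<lambda>n. - (\<integral>x. G n x $ i $ j * \<psi> x \<partial>lborel)) \<longlonglongrightarrow> (\<integral>x. v x $ i * d x $ j \<partial>lborel)" by simp
  from LIMSEQ_unique[OF this tendsto_minus[OF 2]]
  show "(\<integral>x. v x $ i * d x $ j \<partial>lborel) = - (\<integral>x. H x $ i $ j * \<psi> x \<partial>lborel)" .
qed

text \<open>Expand \<open>|\<Phi>\<^sub>j - \<Phi>\<^sub>k|^2\<close>. Up to a summable error from the scalar products, its integral is the difference of
  the square norms of \<open>\<Phi>\<^sub>j\<close> and \<open>\<Phi>\<^sub>k\<close>. Hence the square norms are almost increasing; being bounded, they converge, and
  the sequence is Cauchy in \<open>L\<^sup>2\<close> and then in \<open>L\<^sup>1\<close>. This replaces the martingale convergence theorem.\<close>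

lemma almost_orthogonal_increments_Cauchy:
  fixes \<Phi> :: "nat \<Rightarrow> 'a::euclidean_space \<Rightarrow> 'b::euclidean_space"
  assumes O: "O' \<in> sets borel" "bounded O'" and meas [measurable]: "\<And>n. \<Phi> n \<in> borel_measurable borel"
    and bd: "\<And>n x. norm (\<Phi> n x) \<le> R" and out: "\<And>n x. x \<notin> O' \<Longrightarrow> \<Phi> n x = 0"
    and orth: "\<And>i k. k \<le> i \<Longrightarrow> \<bar>\<integral>x. (\<Phi> (Suc i) x - \<Phi> i x) \<bullet> \<Phi> k x \<partial>lborel\<bar> \<le> (1 / 2) ^ i * m"
    and m: "m \<ge> 0" and e: "e > 0"
  shows "\<exists>N. \<forall>i\<ge>N. \<forall>j\<ge>N. (\<integral>x. norm (\<Phi> i x - \<Phi> j x) \<partial>lborel) < e"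
proof -
  have R: "R \<ge> 0" using bd[of 0 0] norm_ge_zero order_trans by blast
  have int: "integrable lborel (\<lambda>x. \<Phi> i x \<bullet> \<Phi> j x)" for i j
  proof (rule integrable_bounded_support[where D=O' and M="R * R"])
    show "norm (\<Phi> i x \<bullet> \<Phi> j x) \<le> R * R" for x
      using Cauchy_Schwarz_ineq2[of "\<Phi> i x" "\<Phi> j x"] mult_mono[OF bd[of i x] bd[of j x] R] by simp
  qed (use O out in auto)
  define a where "a k = (\<integral>x. \<Phi> k x \<bullet> \<Phi> k x \<partial>lborel)" for k
  define q where "q j k = (\<integral>x. (\<Phi> j x - \<Phi> k x) \<bullet> \<Phi> k x \<partial>lborel)" for j k
  have dist2: "(\<integral>x. (norm (\<Phi> j x - \<Phi> k x))\<^sup>2 \<partial>lborel) = a j - a k - 2 * q j k" for j k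
  proof -
    have "(\<lambda>x. (norm (\<Phi> j x - \<Phi> k x))\<^sup>2) = (\<lambda>x. \<Phi> j x \<bullet> \<Phi> j x - \<Phi> k x \<bullet> \<Phi> k x - 2 * (\<Phi> j x \<bullet> \<Phi> k x - \<Phi> k x \<bullet> \<Phi> k x))"
      by (simp add: power2_norm_eq_inner inner_diff_left inner_diff_right inner_commute algebra_simps fun_eq_iff)
    then show ?thesis
      unfolding a_def q_def using int by (simp add: inner_diff_left)
  qed
  \<comment> \<open>A geometric sum written in telescoping form, which makes the induction go through.\<close>
  have qb: "\<bar>q (k + l) k\<bar> \<le> (2 * (1 / 2) ^ k - 2 * (1 / 2) ^ (k + l)) * m" for k l
  proof (induction l)
    case 0 then show ?case by (simp add: q_def)
  next
    case (Suc l)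
    have "q (k + Suc l) k = (\<integral>x. (\<Phi> (Suc (k + l)) x - \<Phi> (k + l) x) \<bullet> \<Phi> k x \<partial>lborel) + q (k + l) k"
      unfolding q_def using int by (simp add: inner_diff_left)
    then have "\<bar>q (k + Suc l) k\<bar> \<le> (1 / 2) ^ (k + l) * m + (2 * (1 / 2) ^ k - 2 * (1 / 2) ^ (k + l)) * m"
      using Suc orth[of k "k + l"] by simp
    then show ?case by (simp add: algebra_simps)
  qed
  have qb': "\<bar>q j k\<bar> \<le> 2 * (1 / 2) ^ k * m" if "k \<le> j" for j k
  proof -
    have "0 \<le> 2 * (1 / 2) ^ j * m" using m by simp
    then show ?thesis using qb[of k "j - k"] that by (simp add: algebra_simps)
  qed
  \<comment> \<open>The square norm may decrease by at most \<open>2 (1/2)^k m\<close> in step \<open>k\<close>; the correction term absorbs all later losses.\<close>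
  define b where "b k = a k - 4 * (1 / 2) ^ k * m" for k
  have "incseq b"
  proof (rule incseq_SucI)
    fix k
    have "0 \<le> (\<integral>x. (norm (\<Phi> (Suc k) x - \<Phi> k x))\<^sup>2 \<partial>lborel)" by simp
    then have "a k + 2 * q (Suc k) k \<le> a (Suc k)" unfolding dist2 by simp
    moreover have "\<bar>q (Suc k) k\<bar> \<le> (1 / 2) ^ k * m" using orth[of k k] by (simp add: q_def)
    ultimately have "a k - 2 * ((1 / 2) ^ k * m) \<le> a (Suc k)" by linarith
    then show "b k \<le> b (Suc k)" by (simp add: b_def algebra_simps)
  qed
  moreover have "b k \<le> R * R * measure lborel O'" for k
  proof -
    have "a k \<le> (\<integral>x. R * R * indicator O' x \<partial>lborel)"
      unfolding a_def
    proof (rule integral_mono[OF int])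
      show "integrable lborel (\<lambda>x. R * R * indicator O' x)"
        using O emeasure_bounded_finite[of O'] by (intro integrable_mult_right) auto
      show "\<Phi> k x \<bullet> \<Phi> k x \<le> R * R * indicator O' x" for x
        using Cauchy_Schwarz_ineq2[of "\<Phi> k x" "\<Phi> k x"] mult_mono[OF bd[of k x] bd[of k x] R] out[of x k]
        by (auto split: split_indicator)
    qed
    also have "\<dots> = R * R * measure lborel O'" using O by simp
    finally have "a k \<le> R * R * measure lborel O'" .
    moreover have "0 \<le> 4 * (1 / 2) ^ k * m" using m by simp
    ultimately show ?thesis unfolding b_def by linarith
  qed
  ultimately obtain bl where "b \<longlonglongrightarrow> bl" using incseq_convergent by blast
  then have bC: "Cauchy b" by (simp add: LIMSEQ_imp_Cauchy)
  define mO where "mO = measure lborel O'"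
  have mO: "mO \<ge> 0" by (simp add: mO_def)
  define s where "s = e / (mO + 1)"
  have s: "s > 0" "s * mO < e" using e mO by (auto simp: s_def field_simps)
  define e2 where "e2 = (e * s) / 2"
  have e2: "e2 > 0" using e s by (simp add: e2_def)
  obtain N1 where N1: "\<And>i j. i \<ge> N1 \<Longrightarrow> j \<ge> N1 \<Longrightarrow> \<bar>b i - b j\<bar> < e2"
    using CauchyD[OF bC e2] by (auto simp: dist_real_def)
  have "(\<lambda>k. 8 * ((1 / 2) ^ k * m)) \<longlonglongrightarrow> 8 * (0 * m)"
    by (intro tendsto_intros LIMSEQ_power_zero) auto
  then have "\<forall>\<^sub>F k in sequentially. 8 * ((1 / 2) ^ k * m) < e2"
    using e2 by (intro order_tendstoD(2)) auto
  then obtain N2 where N2: "\<And>k. k \<ge> N2 \<Longrightarrow> 8 * ((1 / 2) ^ k * m) < e2" by (auto simp: eventually_sequentially)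
  have main: "(\<integral>x. norm (\<Phi> j x - \<Phi> k x) \<partial>lborel) < e" if jk: "k \<ge> max N1 N2" "k \<le> j" for j k
  proof -
    have j0: "0 \<le> (1 / 2) ^ j * m" and kp: "0 \<le> (1 / 2) ^ k * m" using m by auto
    have jk2: "(1 / 2) ^ j * m \<le> (1 / 2) ^ k * m" using m jk(2) by (intro mult_right_mono power_decreasing) auto
    have "(\<integral>x. (norm (\<Phi> j x - \<Phi> k x))\<^sup>2 \<partial>lborel) = a j - a k - 2 * q j k" by (rule dist2)
    also have "\<dots> = b j - b k + 4 * ((1 / 2) ^ j * m) - 4 * ((1 / 2) ^ k * m) - 2 * q j k" by (simp add: b_def)
    also have "\<dots> \<le> e2 + 4 * ((1 / 2) ^ k * m)"
    proof -
      have "\<bar>q j k\<bar> \<le> 2 * ((1 / 2) ^ k * m)" using qb'[OF jk(2)] by (simp add: mult.assoc)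
      moreover have "\<bar>b j - b k\<bar> < e2" using N1[of j k] jk by simp
      ultimately show ?thesis using jk2 by linarith
    qed
    also have "\<dots> < e2 + e2" using N2[of k] jk kp by simp
    finally have sq: "(\<integral>x. (norm (\<Phi> j x - \<Phi> k x))\<^sup>2 \<partial>lborel) < e * s" by (simp add: e2_def)
    have "(\<integral>x. norm (\<Phi> j x - \<Phi> k x) \<partial>lborel) \<le> (\<integral>x. (s * indicator O' x + (norm (\<Phi> j x - \<Phi> k x))\<^sup>2 / s) / 2 \<partial>lborel)"
    proof (rule integral_mono)
      have nb: "norm (\<Phi> j x - \<Phi> k x) \<le> 2 * R" for x
        using norm_triangle_ineq4[of "\<Phi> j x" "\<Phi> k x"] bd[of j x] bd[of k x] by linarith
      then show "integrable lborel (\<lambda>x. norm (\<Phi> j x - \<Phi> k x))"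
        using O out by (intro integrable_bounded_support[where D=O' and M="2 * R"]) auto
      have sqi: "integrable lborel (\<lambda>x. (norm (\<Phi> j x - \<Phi> k x))\<^sup>2)"
        using O out nb power_mono[OF nb, of _ 2] by (intro integrable_bounded_support[where D=O' and M="(2 * R)\<^sup>2"]) auto
      then show "integrable lborel (\<lambda>x. (s * indicator O' x + (norm (\<Phi> j x - \<Phi> k x))\<^sup>2 / s) / 2)"
        using O emeasure_bounded_finite[of O'] by auto
      fix x
      \<comment> \<open>Young's inequality replaces the Cauchy-Schwarz inequality for integrals.\<close>
      show "norm (\<Phi> j x - \<Phi> k x) \<le> (s * indicator O' x + (norm (\<Phi> j x - \<Phi> k x))\<^sup>2 / s) / 2"
      proof (cases "x \<in> O'")
        case True
        let ?y = "norm (\<Phi> j x - \<Phi> k x)"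
        have "0 \<le> (?y - s)\<^sup>2 / s" using s by simp
        also have "\<dots> = ?y\<^sup>2 / s - 2 * ?y + s" using s by (simp add: power2_diff power2_eq_square field_simps)
        finally show ?thesis using True by simp
      qed (use out in auto)
    qed
    also have "\<dots> = (s * mO + (\<integral>x. (norm (\<Phi> j x - \<Phi> k x))\<^sup>2 \<partial>lborel) / s) / 2"
    proof -
      have nb: "norm (\<Phi> j x - \<Phi> k x) \<le> 2 * R" for x
        using norm_triangle_ineq4[of "\<Phi> j x" "\<Phi> k x"] bd[of j x] bd[of k x] by linarith
      have "integrable lborel (\<lambda>x. (norm (\<Phi> j x - \<Phi> k x))\<^sup>2)"
        using O out nb power_mono[OF nb, of _ 2] by (intro integrable_bounded_support[where D=O' and M="(2 * R)\<^sup>2"]) auto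
      then show ?thesis using O emeasure_bounded_finite[of O'] by (simp add: mO_def)
    qed
    also have "\<dots> < (e + e) / 2"
      using s sq by (intro divide_strict_right_mono add_strict_mono) (auto simp: divide_less_eq)
    finally show ?thesis by simp
  qed
  show ?thesis
  proof (intro exI[of _ "max N1 N2"] allI impI)
    fix i j assume ij: "max N1 N2 \<le> i" "max N1 N2 \<le> j"
    show "(\<integral>x. norm (\<Phi> i x - \<Phi> j x) \<partial>lborel) < e"
    proof (cases "i \<le> j")
      case True
      then show ?thesis using main[of i j] ij by (simp add: norm_minus_commute)
    next
      case False
      then show ?thesis using main[of j i] ij by simp
    qed
  qed
qed

text \<open>Apply \<open>approximable_patch\<close> repeatedly, at stage \<open>n\<close> with accuracy \<open>2^(-n)\<close> and with \<open>HH\<close> containing all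
  gradients constructed so far. The maps converge uniformly since their increments are summable. The gradients
  converge strongly because the increments are almost orthogonal to all earlier gradients, so the average
  distance to \<open>E\<close>, which tends to 0, is zero for the limit.\<close>

lemma exact_solution_bounded:
  assumes O: "open O'" "bounded O'" and F: "continuous_on O' F" and FU: "\<And>x. x \<in> O' \<Longrightarrow> F x \<in> U"
    and good: "\<And>X \<epsilon>. X \<in> U \<Longrightarrow> \<epsilon> > 0 \<Longrightarrow> approximable U E \<epsilon> X"
    and UR: "\<And>X. X \<in> U \<Longrightarrow> norm X \<le> R" and R: "R \<ge> 0"
    and E: "closed E" "E \<noteq> {}" and \<delta>: "\<delta> > 0"
  obtains w G where "perturbation O' w G" "\<And>x. norm (w x) \<le> \<delta>" "\<And>x. norm (G x) \<le> 2 * R"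
    "AE x in lborel. x \<in> O' \<longrightarrow> F x + G x \<in> E"
proof -
  define m where "m = measure lborel O'"
  have m: "m \<ge> 0" by (simp add: m_def)
  define \<Phi> where "\<Phi> D G x = (if x \<in> D then F x + G x else 0)" for D and G :: "real^2 \<Rightarrow> real^2^2" and x
  have finO: "emeasure lborel O' < \<infinity>" using emeasure_bounded_finite[OF O(2)] .
  \<comment> \<open>A stage consists of a perturbation, the open set where its gradient is continuous, and a finite set of fields
    that contains all gradients \<open>F + G\<close> so far, extended by 0. The relation \<open>Q\<close> describes one step.\<close>
  define P where "P n = (\<lambda>(w, G, D, HH). pw_perturbation O' D w G \<and> (\<forall>x\<in>D. F x + G x \<in> U) \<and>
      finite HH \<and> \<Phi> D G \<in> HH \<and> (\<forall>H\<in>HH. continuous_on D H \<and> (\<forall>x\<in>O'. norm (H x) \<le> R) \<and> H \<in> borel_measurable borel) \<and>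
      (n = 0 \<longrightarrow> w = (\<lambda>_. 0)))" for n :: nat
  define Q where "Q n = (\<lambda>(w :: real^2 \<Rightarrow> real^2, G, D, HH) (w', G', D', HH').
      HH \<subseteq> HH' \<and> (\<forall>x. norm (w' x - w x) \<le> \<delta> * (1 / 2) ^ Suc n) \<and>
      (LINT x:O'|lborel. infdist (\<Phi> D' G' x) E) \<le> 2 * (1 / 2) ^ n * m \<and>
      (\<forall>H\<in>HH. \<bar>\<integral>x. (\<Phi> D' G' x - \<Phi> D G x) \<bullet> H x \<partial>lborel\<bar> \<le> (1 / 2) ^ n * m))" for n :: nat
  have \<Phi>_meas: "\<Phi> D G \<in> borel_measurable borel" if "open D" "D \<subseteq> O'" "continuous_on D G" for D G
  proof -
    have "\<Phi> D G = (\<lambda>x. indicator D x *\<^sub>R (F x + G x))" by (auto simp: \<Phi>_def split: split_indicator)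
    then show ?thesis
      using that borel_measurable_continuous_on_indicator[of D "\<lambda>x. F x + G x"]
        continuous_on_subset[OF F that(2)] by (auto intro!: continuous_intros)
  qed
  have "\<exists>s. \<forall>n. P n (s n) \<and> Q n (s n) (s (Suc n))"
  proof (rule dependent_nat_choice)
    have "P 0 (\<lambda>_. 0, \<lambda>_. 0, O', {\<Phi> O' (\<lambda>_. 0)})"
      unfolding P_def using pw_perturbation_zero[OF O(1)] FU UR \<Phi>_meas[OF O(1), of "\<lambda>_. 0"] F
      by (auto simp: \<Phi>_def intro!: continuous_on_eq[OF F])
    then show "\<exists>s. P 0 s" by blast
  next
    fix s n assume Ps: "P n s"
    obtain w G D HH where s: "s = (w, G, D, HH)" by (metis prod_cases4)
    have pw: "pw_perturbation O' D w G" and FGU: "\<And>x. x \<in> D \<Longrightarrow> F x + G x \<in> U" and fin: "finite HH"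
      and \<Phi>in: "\<Phi> D G \<in> HH" and HH: "\<And>H. H \<in> HH \<Longrightarrow> continuous_on D H" "\<And>H x. H \<in> HH \<Longrightarrow> x \<in> O' \<Longrightarrow> norm (H x) \<le> R"
        "\<And>H. H \<in> HH \<Longrightarrow> H \<in> borel_measurable borel"
      using Ps unfolding P_def s by auto
    have D: "open D" "D \<subseteq> O'" "negligible (O' - D)" "continuous_on D G" "\<And>x. x \<notin> D \<Longrightarrow> G x = 0"
      using pw by (auto simp: pw_perturbation_def)
    have bD: "bounded D" using O(2) D(2) bounded_subset by blast
    have mD: "measure lborel D \<le> m"
      unfolding m_def using D(1,2) O finO by (intro measure_mono_fmeasurable) (auto simp: fmeasurable_def)
    define \<eta> where "\<eta> = min (\<delta> * (1 / 2) ^ Suc n) ((1 / 2) ^ n)"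
    have \<eta>: "\<eta> > 0" "\<eta> \<le> \<delta> * (1 / 2) ^ Suc n" "\<eta> \<le> (1 / 2) ^ n"
      unfolding \<eta>_def using \<delta> by (simp, linarith+)
    have Fc: "continuous_on D (\<lambda>x. F x + G x)"
      using D continuous_on_subset[OF F D(2)] by (intro continuous_intros) auto
    have gd: "approximable U E ((1 / 2) ^ n) (F x + G x)" if "x \<in> D" for x
      using FGU[OF that] by (intro good) auto
    obtain v K D' where K: "pw_perturbation D D' v K" "\<And>x. norm (v x) \<le> \<eta>" "\<And>x. x \<in> D' \<Longrightarrow> F x + G x + K x \<in> U"
      "\<And>x. norm (K x) \<le> 2 * R"
      "(LINT x:D|lborel. infdist (F x + G x + K x) E) \<le> ((1 / 2) ^ n + \<eta>) * measure lborel D"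
      "\<And>H. H \<in> HH \<Longrightarrow> \<bar>LINT x:D|lborel. K x \<bullet> H x\<bar> \<le> \<eta> * measure lborel D"
    proof (rule approximable_patch[OF D(1) bD Fc gd _ UR R fin HH(1) _ \<eta>(1)], goal_cases)
      case (6 w G D')
      show ?case by (rule that[of D' w G]; fact)
    qed (use HH D(2) in auto)
    have D': "open D'" "D' \<subseteq> D" "negligible (D - D')" using K(1) by (auto simp: pw_perturbation_def)
    define w' where "w' x = w x + v x" for x
    define G' where "G' x = (if x \<in> D' then G x + K x else 0)" for x
    have pw': "pw_perturbation O' D' w' G'"
      unfolding w'_def[abs_def] G'_def[abs_def] by (rule pw_perturbation_add[OF pw K(1) O(2)])
    have D'2: "continuous_on D' G'" "D' \<subseteq> O'" using pw' by (auto simp: pw_perturbation_def)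
    define HH' where "HH' = insert (\<Phi> D' G') HH"
    have FG'U: "F x + G' x \<in> U" if "x \<in> D'" for x using K(3)[OF that] that by (simp add: G'_def add.assoc)
    have m': "\<Phi> D' G' \<in> borel_measurable borel" by (rule \<Phi>_meas[OF D'(1) D'2(2,1)])
    have "P (Suc n) (w', G', D', HH')"
      unfolding P_def prod.case
    proof (intro conjI ballI)
      have "continuous_on D' (\<Phi> D' G')"
        by (rule continuous_on_eq[OF continuous_on_add[OF continuous_on_subset[OF F D'2(2)] D'2(1)]])
          (simp add: \<Phi>_def)
      then show "continuous_on D' H" if "H \<in> HH'" for H
        using that HH(1) D'(2) continuous_on_subset unfolding HH'_def by blast
      show "norm (H x) \<le> R" if "H \<in> HH'" "x \<in> O'" for H x
        using that HH(2) FG'U UR R by (auto simp: HH'_def \<Phi>_def)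
      show "H \<in> borel_measurable borel" if "H \<in> HH'" for H
        using that HH(3) m' by (auto simp: HH'_def)
    qed (use pw' FG'U fin in \<open>auto simp: HH'_def\<close>)
    moreover have "Q n (w, G, D, HH) (w', G', D', HH')"
      unfolding Q_def prod.case
    proof (intro conjI ballI allI)
      show "HH \<subseteq> HH'" by (auto simp: HH'_def)
      show "norm (w' x - w x) \<le> \<delta> * (1 / 2) ^ Suc n" for x
        using K(2)[of x] \<eta>(2) unfolding w'_def by simp
      have Km [measurable]: "K \<in> borel_measurable borel" using K(1) by (auto simp: pw_perturbation_def perturbation_def)
      have [measurable]: "D \<in> sets borel" "D' \<in> sets borel" "O' \<in> sets borel" using D D' O by auto
      note m' [measurable]
      have "(LINT x:O'|lborel. infdist (\<Phi> D' G' x) E) = (LINT x:D|lborel. infdist (F x + G x + K x) E)"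
        unfolding set_lebesgue_integral_def
      proof (rule integral_cong_AE)
        have "negligible (O' - D')"
          using negligible_subset[OF negligible_Un[OF D(3) D'(3)], of "O' - D'"] by blast
        then show "AE x in lborel. indicator O' x *\<^sub>R infdist (\<Phi> D' G' x) E = indicator D x *\<^sub>R infdist (F x + G x + K x) E"
          by (rule AE_lborel_negligible) (use D(2) D'(2) in \<open>auto simp: \<Phi>_def G'_def add.assoc split: split_indicator\<close>)
        show "(\<lambda>x. indicat_real D x *\<^sub>R infdist (F x + G x + K x) E) \<in> borel_measurable lborel"
          using borel_measurable_indicator_infdist[OF _ Fc Km] by simp
      qed measurable
      also have "\<dots> \<le> ((1 / 2) ^ n + \<eta>) * measure lborel D" by (rule K(5))
      also have "\<dots> \<le> (2 * (1 / 2) ^ n) * m" using mD \<eta> by (intro mult_mono) auto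
      finally show "(LINT x:O'|lborel. infdist (\<Phi> D' G' x) E) \<le> 2 * (1 / 2) ^ n * m" .
      fix H assume H: "H \<in> HH"
      have [measurable]: "H \<in> borel_measurable borel" "\<Phi> D G \<in> borel_measurable borel" using HH(3) H \<Phi>in by auto
      have "(\<integral>x. (\<Phi> D' G' x - \<Phi> D G x) \<bullet> H x \<partial>lborel) = (LINT x:D|lborel. K x \<bullet> H x)"
        unfolding set_lebesgue_integral_def
      proof (rule integral_cong_AE)
        show "AE x in lborel. (\<Phi> D' G' x - \<Phi> D G x) \<bullet> H x = indicator D x *\<^sub>R (K x \<bullet> H x)"
          by (rule AE_lborel_negligible[OF D'(3)])
            (use D'(2) in \<open>auto simp: \<Phi>_def G'_def split: split_indicator\<close>)
      qed measurable
      then show "\<bar>\<integral>x. (\<Phi> D' G' x - \<Phi> D G x) \<bullet> H x \<partial>lborel\<bar> \<le> (1 / 2) ^ n * m"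
        using K(6)[OF H] mult_mono[OF \<eta>(3) mD] by simp
    qed
    ultimately show "\<exists>s'. P (Suc n) s' \<and> Q n s s'" unfolding s by blast
  qed
  then obtain s where s: "\<And>n. P n (s n)" "\<And>n. Q n (s n) (s (Suc n))" by blast
  define w where "w n = fst (s n)" for n
  define G where "G n = fst (snd (s n))" for n
  define D where "D n = fst (snd (snd (s n)))" for n
  define HH where "HH n = snd (snd (snd (s n)))" for n
  have seq: "s n = (w n, G n, D n, HH n)" for n by (simp add: w_def G_def D_def HH_def)
  have pw: "pw_perturbation O' (D n) (w n) (G n)" and FGU: "\<And>x. x \<in> D n \<Longrightarrow> F x + G n x \<in> U"
    and \<Phi>in: "\<Phi> (D n) (G n) \<in> HH n" and HHm: "\<And>H. H \<in> HH n \<Longrightarrow> H \<in> borel_measurable borel" and w0: "w 0 = (\<lambda>_. 0)" for n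
    using s(1)[of n] s(1)[of 0] unfolding seq P_def by auto
  have HHsub: "HH n \<subseteq> HH (Suc n)" and wd: "\<And>x. norm (w (Suc n) x - w n x) \<le> \<delta> * (1 / 2) ^ Suc n"
    and avg: "(LINT x:O'|lborel. infdist (\<Phi> (D (Suc n)) (G (Suc n)) x) E) \<le> 2 * (1 / 2) ^ n * m"
    and orth: "\<And>H. H \<in> HH n \<Longrightarrow> \<bar>\<integral>x. (\<Phi> (D (Suc n)) (G (Suc n)) x - \<Phi> (D n) (G n) x) \<bullet> H x \<partial>lborel\<bar> \<le> (1 / 2) ^ n * m" for n
    using s(2)[of n] unfolding seq Q_def by auto
  define f where "f n = \<Phi> (D n) (G n)" for n
  have HHmono: "HH k \<subseteq> HH i" if "k \<le> i" for k i using HHsub that by (rule lift_Suc_mono_le)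
  have Dn: "open (D n)" "D n \<subseteq> O'" "negligible (O' - D n)" "\<And>x. x \<notin> D n \<Longrightarrow> G n x = 0" for n
    using pw[of n] by (auto simp: pw_perturbation_def)
  have fm [measurable]: "f n \<in> borel_measurable borel" for n unfolding f_def using HHm \<Phi>in by blast
  have fb: "norm (f n x) \<le> R" for n x using FGU UR R by (auto simp: f_def \<Phi>_def)
  have fout: "f n x = 0" if "x \<notin> O'" for n x using that Dn(2)[of n] by (auto simp: f_def \<Phi>_def)
  have Om [measurable]: "O' \<in> sets borel" using O by simp
  have fint: "integrable lborel (f n)" for n
    by (rule integrable_bounded_support[OF fm O(2) fout fb])
  have "\<exists>N. \<forall>i\<ge>N. \<forall>j\<ge>N. (\<integral>x. norm (f i x - f j x) \<partial>lborel) < e" if "e > 0" for e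
  proof (rule almost_orthogonal_increments_Cauchy[OF Om O(2) fm fb fout _ m that])
    fix i k :: nat assume "k \<le> i"
    then have "f k \<in> HH i" using \<Phi>in[of k] HHmono unfolding f_def by blast
    then show "\<bar>\<integral>x. (f (Suc i) x - f i x) \<bullet> f k x \<partial>lborel\<bar> \<le> (1 / 2) ^ i * m"
      using orth unfolding f_def by blast
  qed
  from cauchy_L1_AE_cauchy_subseq[OF fint this]
  obtain r where r: "strict_mono r" "AE x in lborel. Cauchy (\<lambda>i. f (r i) x)" by blast
  define \<Psi> where "\<Psi> x = lim (\<lambda>i. f (r i) x)" for x
  have \<Psi>m [measurable]: "\<Psi> \<in> borel_measurable borel" unfolding \<Psi>_def by (rule borel_measurable_lim_metric) simp
  have \<Psi>lim: "AE x in lborel. (\<lambda>i. f (r i) x) \<longlonglongrightarrow> \<Psi> x"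
    using r(2) by eventually_elim (simp add: \<Psi>_def Cauchy_convergent_iff convergent_LIMSEQ_iff)
  \<comment> \<open>On the null set where the subsequence of gradients does not converge, \<open>\<Psi>\<close> is arbitrary; the truncation keeps the limit bounded there.\<close>
  define g where "g x = (if x \<in> O' \<and> norm (\<Psi> x) \<le> R then \<Psi> x - F x else 0)" for x
  have FR: "norm (F x) \<le> R" if "x \<in> O'" for x using UR[OF FU[OF that]] .
  have gR: "norm (g x) \<le> 2 * R" for x
    using FR[of x] R norm_triangle_ineq4[of "\<Psi> x" "F x"] by (auto simp: g_def)
  have gm: "g \<in> borel_measurable borel"
  proof -
    have [measurable]: "(\<lambda>x. indicator O' x *\<^sub>R F x) \<in> borel_measurable borel"
      by (rule borel_measurable_continuous_on_indicator[OF Om F])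
    have "g = (\<lambda>x. if x \<in> O' \<and> norm (\<Psi> x) \<le> R then \<Psi> x - indicator O' x *\<^sub>R F x else 0)"
      by (auto simp: g_def)
    also have "\<dots> \<in> borel_measurable borel" by measurable
    finally show ?thesis .
  qed
  have allD: "AE x in lborel. x \<in> O' \<longrightarrow> (\<forall>n. x \<in> D n)"
  proof (rule AE_lborel_negligible)
    show "negligible (\<Union>n. O' - D n)" using Dn(3) by (intro negligible_countable_Union) auto
  qed auto
  have Glim: "AE x in lborel. (\<lambda>i. G (r i) x) \<longlonglongrightarrow> g x"
    using \<Psi>lim allD
  proof eventually_elim
    case (elim x)
    show ?case
    proof (cases "x \<in> O'")
      case True
      have "norm (\<Psi> x) \<le> R" by (rule LIMSEQ_le_const2[OF tendsto_norm[OF elim(1)]]) (use fb in auto)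
      then have "g x = \<Psi> x - F x" using True by (simp add: g_def)
      moreover have "G (r i) x = f (r i) x - F x" for i
        using elim(2) True by (simp add: f_def \<Phi>_def)
      ultimately show ?thesis using elim(1) by (simp add: tendsto_diff)
    next
      case False
      then have "G (r i) x = 0" for i using Dn(2,4) by blast
      then show ?thesis using False by (simp add: g_def)
    qed
  qed
  define v where "v x = (\<Sum>i. w (Suc i) x - w i x)" for x
  have summ: "(\<lambda>i. \<delta> * (1 / 2) ^ Suc i) sums \<delta>"
    using sums_mult[OF power_half_series, of \<delta>] by simp
  have tele: "(\<Sum>i<n. w (Suc i) x - w i x) = w n x" for n x
    using w0 sum_lessThan_telescope[of "\<lambda>i. w i x" n] by simp
  have ul: "uniform_limit UNIV (\<lambda>n x. \<Sum>i<n. w (Suc i) x - w i x) (\<lambda>x. \<Sum>i. w (Suc i) x - w i x) sequentially"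
    by (rule Weierstrass_m_test[OF _ sums_summable[OF summ]]) (rule wd)
  then have ul': "uniform_limit UNIV w v sequentially" unfolding tele v_def .
  have P': "perturbation O' (w n) (G n)" for n using pw by (simp add: pw_perturbation_def)
  have vc: "continuous_on UNIV v"
    by (rule uniform_limit_theorem[OF _ ul']) (use perturbationD(1)[OF P'] in auto)
  have wlim: "(\<lambda>n. w n x) \<longlonglongrightarrow> v x" for x using tendsto_uniform_limitI[OF ul'] by auto
  have wn: "norm (w n x) \<le> \<delta>" for n x
  proof -
    have "norm (w n x) \<le> (\<Sum>i<n. norm (w (Suc i) x - w i x))"
      using norm_sum[of "\<lambda>i. w (Suc i) x - w i x" "{..<n}"] unfolding tele .
    also have "\<dots> \<le> (\<Sum>i<n. \<delta> * (1 / 2) ^ Suc i)" by (intro sum_mono wd)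
    also have "\<dots> \<le> \<delta>" using sum_le_suminf[OF sums_summable[OF summ], of "{..<n}"] sums_unique[OF summ] \<delta> by simp
    finally show ?thesis .
  qed
  have vn: "norm (v x) \<le> \<delta>" for x
    by (rule LIMSEQ_le_const2[OF tendsto_norm[OF wlim]]) (use wn in auto)
  have GR: "norm (G n x) \<le> 2 * R" for n x
  proof (cases "x \<in> D n")
    case True
    have "norm (F x + G n x) \<le> R" "norm (F x) \<le> R" using UR[OF FGU[OF True]] FR Dn(2) True by auto
    then show ?thesis using norm_triangle_ineq4[of "F x + G n x" "F x"] by simp
  qed (use Dn(4) R in auto)
  have wg: "weak_gradient v g"
    by (rule weak_gradient_limit[OF O(2), of "\<lambda>i. w (r i)" "\<lambda>i. G (r i)" "max \<delta> (2 * R)"])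
      (use P' wn GR Glim gm LIMSEQ_subseq_LIMSEQ[OF wlim r(1)] in \<open>auto simp: o_def le_max_iff_disj\<close>)
  have pert: "perturbation O' v g"
    unfolding perturbation_def
  proof (intro conjI allI impI)
    show "v x = 0" if "x \<notin> O'" for x
      using wlim[of x] perturbationD(2)[OF P' that] by (simp add: LIMSEQ_const_iff)
    show "g x = 0" if "x \<notin> O'" for x using that by (simp add: g_def)
  qed (use vc gm gR wg in auto)
  have lim_avg: "(\<lambda>i. LINT x:O'|lborel. infdist (f (r i) x) E) \<longlonglongrightarrow> (LINT x:O'|lborel. infdist (\<Psi> x) E)"
    unfolding set_lebesgue_integral_def
  proof (rule integral_dominated_convergence)
    show "integrable lborel (\<lambda>x. indicator O' x *\<^sub>R (R + infdist 0 E))"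
      using finO by auto
    show "AE x in lborel. (\<lambda>i. indicator O' x *\<^sub>R infdist (f (r i) x) E) \<longlonglongrightarrow> indicator O' x *\<^sub>R infdist (\<Psi> x) E"
      using \<Psi>lim by eventually_elim (intro tendsto_intros)
    show "AE x in lborel. norm (indicator O' x *\<^sub>R infdist (f (r i) x) E) \<le> indicator O' x *\<^sub>R (R + infdist 0 E)" for i
    proof (rule AE_I2)
      fix x
      show "norm (indicator O' x *\<^sub>R infdist (f (r i) x) E) \<le> indicator O' x *\<^sub>R (R + infdist 0 E)"
        using infdist_le_norm[of "f (r i) x" E] fb[of "r i" x] by (auto simp: infdist_nonneg split: split_indicator)
    qed
  qed measurable
  have "(\<lambda>i. LINT x:O'|lborel. infdist (f i x) E) \<longlonglongrightarrow> 0"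
  proof (rule LIMSEQ_imp_Suc, rule tendsto_sandwich)
    show "\<forall>\<^sub>F n in sequentially. 0 \<le> (LINT x:O'|lborel. infdist (f (Suc n) x) E)"
      unfolding set_lebesgue_integral_def
      by (intro always_eventually allI Bochner_Integration.integral_nonneg) (auto simp: infdist_nonneg)
    show "\<forall>\<^sub>F n in sequentially. (LINT x:O'|lborel. infdist (f (Suc n) x) E) \<le> 2 * (1 / 2) ^ n * m"
      using avg unfolding f_def by (intro always_eventually allI)
    have "(\<lambda>n. 2 * (1 / 2) ^ n * m) \<longlonglongrightarrow> 2 * 0 * m" by (intro tendsto_intros LIMSEQ_power_zero) auto
    then show "(\<lambda>n. 2 * (1 / 2) ^ n * m) \<longlonglongrightarrow> 0" by simp
  qed auto
  from LIMSEQ_unique[OF lim_avg LIMSEQ_subseq_LIMSEQ[OF this r(1), unfolded o_def]]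
  have int0: "(\<integral>x. indicator O' x *\<^sub>R infdist (\<Psi> x) E \<partial>lborel) = 0" by (simp add: set_lebesgue_integral_def)
  have \<Psi>R: "AE x in lborel. norm (\<Psi> x) \<le> R"
    using \<Psi>lim
  proof eventually_elim
    case (elim x)
    show ?case by (rule LIMSEQ_le_const2[OF tendsto_norm[OF elim]]) (use fb in auto)
  qed
  have "integrable lborel (\<lambda>x. indicator O' x *\<^sub>R infdist (\<Psi> x) E)"
  proof (rule Bochner_Integration.integrable_bound)
    show "integrable lborel (\<lambda>x. indicator O' x *\<^sub>R (R + infdist 0 E))" using finO by auto
    show "AE x in lborel. norm (indicator O' x *\<^sub>R infdist (\<Psi> x) E) \<le> norm (indicator O' x *\<^sub>R (R + infdist 0 E))"
      using \<Psi>R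
    proof eventually_elim
      case (elim x)
      then show ?case
        using infdist_le_norm[of "\<Psi> x" E] by (auto simp: infdist_nonneg split: split_indicator)
    qed
  qed measurable
  then have "AE x in lborel. indicator O' x *\<^sub>R infdist (\<Psi> x) E = 0"
    using integral_nonneg_eq_0_iff_AE[of lborel "\<lambda>x. indicator O' x *\<^sub>R infdist (\<Psi> x) E"] int0
    by (auto simp: infdist_nonneg)
  with \<Psi>R have "AE x in lborel. x \<in> O' \<longrightarrow> F x + g x \<in> E"
  proof eventually_elim
    case (elim x)
    then show ?case
      using E in_closed_iff_infdist_zero[of E "\<Psi> x"] by (auto simp: g_def)
  qed
  then show thesis by (rule that[OF pert vn gR])
qed

section \<open>Smooth bump functions and the du Bois-Reymond lemma\<close>

text \<open>Infinitely differentiable functions of one variable: the derivative exists and is of the same kind.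
  Coinduction then proves smoothness of a class of functions by showing that it is closed under
  differentiation.\<close>

coinductive smooth1 :: "(real \<Rightarrow> real) \<Rightarrow> bool" where
  "\<lbrakk>\<And>x. (f has_real_derivative f' x) (at x); smooth1 f'\<rbrakk> \<Longrightarrow> smooth1 f"

text \<open>With polynomials in \<open>1 / x\<close> as factors, the functions built from \<open>exp (- 1 / x)\<close> are closed under
  differentiation.\<close>

definition flat_exp :: "real poly \<Rightarrow> real \<Rightarrow> real" where
  "flat_exp p x = (if 0 < x then poly p (1 / x) * exp (- (1 / x)) else 0)"

lemma poly_mult_exp_tendsto_0: "((\<lambda>y. poly p y * exp (- y)) \<longlongrightarrow> (0::real)) at_top"
proof -
  have "((\<lambda>y. \<Sum>i\<le>degree p. coeff p i * (y ^ i / exp y)) \<longlongrightarrow> (\<Sum>i\<le>degree p. coeff p i * 0)) at_top"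
    by (intro tendsto_intros tendsto_power_div_exp_0)
  moreover have "(\<Sum>i\<le>degree p. coeff p i * (y ^ i / exp y)) = poly p y * exp (- y)" for y
    by (simp add: poly_altdef sum_distrib_right exp_minus divide_inverse mult.assoc)
  ultimately show ?thesis by simp
qed

lemma flat_exp_tendsto_0: "(flat_exp p \<longlongrightarrow> 0) (at 0)"
proof (rule filterlim_split_at)
  show "(flat_exp p \<longlongrightarrow> 0) (at_left 0)"
    by (rule tendsto_eventually) (auto simp: flat_exp_def eventually_at_left_field intro!: exI[of _ "-1"])
  have "((\<lambda>x. poly p (inverse x) * exp (- inverse x)) \<longlongrightarrow> 0) (at_right 0)"
    by (rule filterlim_compose[OF poly_mult_exp_tendsto_0 filterlim_inverse_at_top_right])
  moreover have "\<forall>\<^sub>F x in at_right 0. poly p (inverse x) * exp (- inverse x) = flat_exp p x"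
    by (auto simp: flat_exp_def eventually_at_right_field inverse_eq_divide intro!: exI[of _ 1])
  ultimately show "(flat_exp p \<longlongrightarrow> 0) (at_right 0)"
    by (rule Lim_transform_eventually)
qed

lemma flat_exp_derivative:
  "(flat_exp p has_real_derivative flat_exp ([:0, 0, 1:] * (p - pderiv p)) x) (at x)"
proof (cases x "0 :: real" rule: linorder_cases)
  case less
  have "((\<lambda>_. 0) has_real_derivative flat_exp ([:0, 0, 1:] * (p - pderiv p)) x) (at x)"
    using less by (simp add: flat_exp_def)
  then show ?thesis
    by (rule has_field_derivative_transform_within_open[where S="{..<0}"])
      (use less in \<open>auto simp: flat_exp_def\<close>)
next
  case greater
  have "((\<lambda>x. poly p (1 / x) * exp (- (1 / x))) has_real_derivative
      flat_exp ([:0, 0, 1:] * (p - pderiv p)) x) (at x)"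
    using greater
    by (auto intro!: derivative_eq_intros DERIV_chain'[OF _ poly_DERIV]
        simp: flat_exp_def field_simps power2_eq_square)
  then show ?thesis
    by (rule has_field_derivative_transform_within_open[where S="{0<..}"])
      (use greater in \<open>auto simp: flat_exp_def\<close>)
next
  case equal
  have "(flat_exp ([:0, 1:] * p) \<longlongrightarrow> 0) (at 0)" by (rule flat_exp_tendsto_0)
  moreover have "flat_exp ([:0, 1:] * p) = (\<lambda>h. (flat_exp p h - flat_exp p 0) / (h - 0))"
    by (simp add: flat_exp_def fun_eq_iff)
  ultimately have "((\<lambda>h. (flat_exp p h - flat_exp p 0) / (h - 0)) \<longlongrightarrow> 0) (at 0)" by (simp only:)
  then show ?thesis using equal by (simp add: has_field_derivative_iff flat_exp_def)
qed

lemma smooth1_flat_exp: "smooth1 (flat_exp p)"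
proof -
  have "\<exists>p. f = flat_exp p \<Longrightarrow> smooth1 f" for f
  proof (coinduction arbitrary: f)
    case smooth1
    then show ?case using flat_exp_derivative by blast
  qed
  then show ?thesis by blast
qed

lemma smooth1_affine: "smooth1 f \<Longrightarrow> smooth1 (\<lambda>x. f (a * x + b))"
proof -
  have "\<exists>g c. smooth1 g \<and> f = (\<lambda>x. c * g (a * x + b)) \<Longrightarrow> smooth1 f" for f
  proof (coinduction arbitrary: f)
    case smooth1
    then obtain g c where g: "smooth1 g" "f = (\<lambda>x. c * g (a * x + b))" by blast
    from g(1) obtain g' where g': "\<And>x. (g has_real_derivative g' x) (at x)" "smooth1 g'"
      by cases blast
    define k where "k x = (c * a) * g' (a * x + b)" for x
    have "((\<lambda>x. c * g (a * x + b)) has_real_derivative k x) (at x)" for x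
      unfolding k_def by (auto intro!: derivative_eq_intros DERIV_chain'[OF _ g'(1)])
    then have "\<forall>x. (f has_real_derivative k x) (at x)" unfolding g(2) by blast
    moreover have "\<exists>g2 c2. smooth1 g2 \<and> k = (\<lambda>x. c2 * g2 (a * x + b))"
      unfolding k_def[abs_def] using g'(2) by blast
    ultimately show ?case by - (rule exI[of _ f], rule exI[of _ k], simp)
  qed
  moreover assume "smooth1 f"
  moreover have "(\<lambda>x. f (a * x + b)) = (\<lambda>x. 1 * f (a * x + b))" by simp
  ultimately show ?thesis by blast
qed

text \<open>Sums of products of smooth functions, a class closed under differentiation by the product rule.\<close>

inductive smooth1_products :: "(real \<Rightarrow> real) \<Rightarrow> bool" where
  mult: "\<lbrakk>smooth1 f; smooth1 g\<rbrakk> \<Longrightarrow> smooth1_products (\<lambda>x. f x * g x)"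
| add: "\<lbrakk>smooth1_products f; smooth1_products g\<rbrakk> \<Longrightarrow> smooth1_products (\<lambda>x. f x + g x)"

lemma smooth1_mult:
  assumes "smooth1 f" "smooth1 g" shows "smooth1 (\<lambda>x. f x * g x)"
proof -
  have ex: "\<exists>f'. (\<forall>x. (f has_real_derivative f' x) (at x)) \<and> smooth1_products f'" if "smooth1_products f" for f
    using that
  proof induction
    case (mult f g)
    from mult(1) obtain f' where f': "\<And>x. (f has_real_derivative f' x) (at x)" "smooth1 f'" by cases blast
    from mult(2) obtain g' where g': "\<And>x. (g has_real_derivative g' x) (at x)" "smooth1 g'" by cases blast
    define k where "k x = f' x * g x + g' x * f x" for x
    have "((\<lambda>x. f x * g x) has_real_derivative k x) (at x)" for x
      unfolding k_def by (intro DERIV_mult f' g')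
    moreover have "smooth1_products k"
      unfolding k_def[abs_def] using mult f' g' by (intro smooth1_products.intros)
    ultimately show ?case by blast
  next
    case (add f g)
    then obtain f' g' where "\<forall>x. (f has_real_derivative f' x) (at x)" "smooth1_products f'"
      "\<forall>x. (g has_real_derivative g' x) (at x)" "smooth1_products g'" by blast
    moreover define k where "k x = f' x + g' x" for x
    ultimately have "\<forall>x. ((\<lambda>x. f x + g x) has_real_derivative k x) (at x)" "smooth1_products k"
      unfolding k_def[abs_def] by (auto intro: DERIV_add smooth1_products.intros)
    then show ?case by blast
  qed
  have "smooth1_products f \<Longrightarrow> smooth1 f" for f
  proof (coinduction arbitrary: f)
    case smooth1
    then show ?case using ex by blast
  qed
  then show ?thesis using assms smooth1_products.mult by blast
qed

text \<open>The partial derivatives of a product of functions of separate variables are again such products.\<close>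

lemma Ck_tensor:
  "smooth1 g \<Longrightarrow> smooth1 h \<Longrightarrow> Ck k (\<lambda>x. g (x $ 1) * h (x $ 2))"
proof (induction k arbitrary: g h)
  case (0 g h)
  from 0(1) obtain g' where g': "\<And>x. (g has_real_derivative g' x) (at x)" by cases blast
  from 0(2) obtain h' where h': "\<And>x. (h has_real_derivative h' x) (at x)" by cases blast
  have "continuous_on UNIV g" "continuous_on UNIV h"
    using g' h' by (meson DERIV_isCont continuous_at_imp_continuous_on)+
  then have "continuous_on UNIV (\<lambda>x::real^2. g (x $ 1))" and "continuous_on UNIV (\<lambda>x::real^2. h (x $ 2))"
    by (auto intro!: continuous_on_compose2[of UNIV g] continuous_on_compose2[of UNIV h] continuous_on_component continuous_on_id)
  then have "continuous_on UNIV (\<lambda>x::real^2. g (x $ 1) * h (x $ 2))"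
    by (rule continuous_on_mult)
  then show ?case by simp
next
  case (Suc k g h)
  from Suc(2) obtain g' where g': "\<And>x. (g has_real_derivative g' x) (at x)" "smooth1 g'" by cases blast
  from Suc(3) obtain h' where h': "\<And>x. (h has_real_derivative h' x) (at x)" "smooth1 h'" by cases blast
  have der: "((\<lambda>x::real^2. g (x $ 1) * h (x $ 2)) has_derivative
      (\<lambda>v. g (x $ 1) * (h' (x $ 2) * v $ 2) + g' (x $ 1) * v $ 1 * h (x $ 2))) (at x)" for x
  proof -
    have pr: "((\<lambda>x::real^2. x $ i) has_derivative (\<lambda>v. v $ i)) (at x)" for i
      by (auto intro!: derivative_eq_intros bounded_linear_imp_has_derivative bounded_linear_vec_nth)
    have "((\<lambda>x::real^2. g (x $ 1)) has_derivative (\<lambda>v. g' (x $ 1) * v $ 1)) (at x)"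
      using has_derivative_compose[OF pr, of g] g'(1)[of "x $ 1"] by (simp add: has_field_derivative_def)
    moreover have "((\<lambda>x::real^2. h (x $ 2)) has_derivative (\<lambda>v. h' (x $ 2) * v $ 2)) (at x)"
      using has_derivative_compose[OF pr, of h] h'(1)[of "x $ 2"] by (simp add: has_field_derivative_def)
    ultimately show ?thesis by (rule has_derivative_mult)
  qed
  have pd: "partial j (\<lambda>x::real^2. g (x $ 1) * h (x $ 2)) x
      = g (x $ 1) * (h' (x $ 2) * axis j 1 $ 2) + g' (x $ 1) * axis j 1 $ 1 * h (x $ 2)" for j x
    unfolding partial_def frechet_derivative_at[OF der[of x], symmetric] by simp
  have "partial 1 (\<lambda>x::real^2. g (x $ 1) * h (x $ 2)) = (\<lambda>x. g' (x $ 1) * h (x $ 2))"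
    "partial 2 (\<lambda>x::real^2. g (x $ 1) * h (x $ 2)) = (\<lambda>x. g (x $ 1) * h' (x $ 2))"
    by (auto simp: pd axis_def fun_eq_iff)
  then have "Ck k (partial j (\<lambda>x::real^2. g (x $ 1) * h (x $ 2)))" for j
    using Suc.IH[OF g'(2) Suc(3)] Suc.IH[OF Suc(2) h'(2)] exhaust_2[of j] by auto
  then show ?case using der by (auto simp: differentiable_def)
qed

text \<open>Positive exactly on the open interval from \<open>a\<close> to \<open>b\<close>. The dilation by \<open>n + 1\<close> makes the values tend to 1 there
  as \<open>n\<close> grows.\<close>

definition bump1 :: "real \<Rightarrow> real \<Rightarrow> nat \<Rightarrow> real \<Rightarrow> real" where
  "bump1 a b n s = flat_exp 1 (real (Suc n) * (s - a)) * flat_exp 1 (real (Suc n) * (b - s))"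

lemma smooth1_bump1: "smooth1 (bump1 a b n)"
proof -
  have "smooth1 (\<lambda>s. flat_exp 1 (real (Suc n) * s + (- real (Suc n) * a)) * flat_exp 1 ((- real (Suc n)) * s + real (Suc n) * b))"
    by (intro smooth1_mult smooth1_affine[of "flat_exp 1"] smooth1_flat_exp)
  moreover have "bump1 a b n = (\<lambda>s. flat_exp 1 (real (Suc n) * s + (- real (Suc n) * a)) * flat_exp 1 ((- real (Suc n)) * s + real (Suc n) * b))"
    by (auto simp: bump1_def fun_eq_iff algebra_simps)
  ultimately show ?thesis by simp
qed

lemma flat_exp_1_bounds: "0 \<le> flat_exp 1 s" "flat_exp 1 s \<le> 1"
  by (auto simp: flat_exp_def)

lemma flat_exp_1_dilate_tendsto:
  assumes "s > 0" shows "(\<lambda>n. flat_exp 1 (real (Suc n) * s)) \<longlonglongrightarrow> 1"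
proof -
  have "(\<lambda>n. exp (- (inverse (real (Suc n)) * (1 / s)))) \<longlonglongrightarrow> exp (- (0 * (1 / s)))"
    by (intro tendsto_intros LIMSEQ_inverse_real_of_nat)
  moreover have "exp (- (inverse (real (Suc n)) * (1 / s))) = flat_exp 1 (real (Suc n) * s)" for n
  proof -
    have "0 < real (Suc n) * s" using assms by (intro mult_pos_pos) auto
    then show ?thesis by (simp add: flat_exp_def field_simps del: of_nat_Suc)
  qed
  ultimately show ?thesis by simp
qed

lemma bump1_bounds: "0 \<le> bump1 a b n s" "bump1 a b n s \<le> 1" "s \<notin> {a<..<b} \<Longrightarrow> bump1 a b n s = 0"
proof -
  show "0 \<le> bump1 a b n s" "bump1 a b n s \<le> 1"
    using flat_exp_1_bounds by (auto simp: bump1_def intro: mult_le_one)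
  assume "s \<notin> {a<..<b}"
  then have "real (Suc n) * (s - a) \<le> 0 \<or> real (Suc n) * (b - s) \<le> 0"
    by (auto simp: mult_le_0_iff)
  then show "bump1 a b n s = 0" by (auto simp: bump1_def flat_exp_def)
qed

lemma bump1_tendsto: "(\<lambda>n. bump1 a b n s) \<longlonglongrightarrow> indicator {a<..<b} s"
proof (cases "s \<in> {a<..<b}")
  case True
  have "(\<lambda>n. bump1 a b n s) \<longlonglongrightarrow> 1 * 1"
    unfolding bump1_def using True by (intro tendsto_mult flat_exp_1_dilate_tendsto) auto
  then show ?thesis using True by simp
qed (simp add: bump1_bounds(3))

lemma box_indicator_limit:
  fixes a b :: "real^2"
  obtains \<psi> :: "nat \<Rightarrow> real^2 \<Rightarrow> real" where "\<And>n k. Ck k (\<psi> n)" "\<And>n x. 0 \<le> \<psi> n x" "\<And>n x. \<psi> n x \<le> 1"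
    "\<And>n x. x \<notin> cbox a b \<Longrightarrow> \<psi> n x = 0" "\<And>x. (\<lambda>n. \<psi> n x) \<longlonglongrightarrow> indicator (box a b) x"
proof
  define \<psi> where "\<psi> n x = bump1 (a $ 1) (b $ 1) n (x $ 1) * bump1 (a $ 2) (b $ 2) n (x $ 2)" for n and x :: "real^2"
  show "Ck k (\<psi> n)" for n k unfolding \<psi>_def[abs_def] by (intro Ck_tensor smooth1_bump1)
  show "0 \<le> \<psi> n x" "\<psi> n x \<le> 1" for n x using bump1_bounds by (auto simp: \<psi>_def intro: mult_le_one)
  show "\<psi> n x = 0" if "x \<notin> cbox a b" for n x
    using that bump1_bounds(3)[of "x $ 1" "a $ 1" "b $ 1" n] bump1_bounds(3)[of "x $ 2" "a $ 2" "b $ 2" n]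
    by (auto simp: \<psi>_def mem_box_cart forall_2 not_le)
  show "(\<lambda>n. \<psi> n x) \<longlonglongrightarrow> indicator (box a b) x" for x
  proof -
    have "(\<lambda>n. \<psi> n x) \<longlonglongrightarrow> indicator {a $ 1<..<b $ 1} (x $ 1) * indicator {a $ 2<..<b $ 2} (x $ 2)"
      unfolding \<psi>_def by (intro tendsto_mult bump1_tendsto)
    moreover have "indicator {a $ 1<..<b $ 1} (x $ 1) * indicator {a $ 2<..<b $ 2} (x $ 2) = (indicator (box a b) x :: real)"
      by (auto simp: mem_box_cart forall_2 split: split_indicator)
    ultimately show ?thesis by simp
  qed
qed

text \<open>The positive and the negative part of \<open>h\<close> are densities of two finite measures that agree on open boxes. Boxes
  generate the Borel sets and are closed under intersection, so the measures, and hence the densities, agree.\<close>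

lemma AE_zero_if_box_integrals_zero:
  fixes h :: "'a::euclidean_space \<Rightarrow> real"
  assumes int: "integrable lborel h" and zero: "\<And>a b. (\<integral>x. indicator (box a b) x * h x \<partial>lborel) = 0"
  shows "AE x in lborel. h x = 0"
proof -
  have [measurable]: "h \<in> borel_measurable borel" using int by auto
  let ?p = "density lborel (\<lambda>x. ennreal (h x))" and ?q = "density lborel (\<lambda>x. ennreal (- h x))"
  have fin: "(\<integral>\<^sup>+x. ennreal (h x) \<partial>lborel) \<noteq> \<infinity>" "(\<integral>\<^sup>+x. ennreal (- h x) \<partial>lborel) \<noteq> \<infinity>"
    using int by (auto simp: real_integrable_def)
  have "?p = ?q"
  proof (rule measure_eqI_generator_eq)
    let ?E = "range (\<lambda>(a, b). box a b::'a set)"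
    show "Int_stable ?E" by (auto simp: Int_stable_def box_Int_box)
    show "?E \<subseteq> Pow UNIV" "sets ?p = sigma_sets UNIV ?E" "sets ?q = sigma_sets UNIV ?E"
      by (simp_all add: borel_eq_box)
    let ?A = "\<lambda>n::nat. box (- (real n *\<^sub>R One)) (real n *\<^sub>R One) :: 'a set"
    show "range ?A \<subseteq> ?E" "(\<Union>i. ?A i) = UNIV"
      unfolding UN_box_eq_UNIV by auto
    show "emeasure ?p (?A i) \<noteq> \<infinity>" for i
    proof -
      have "emeasure ?p (?A i) \<le> emeasure ?p (space ?p)" by (rule emeasure_space)
      also have "\<dots> = (\<integral>\<^sup>+x. ennreal (h x) \<partial>lborel)" by (simp add: emeasure_density)
      finally show ?thesis using fin by (auto simp: top_unique)
    qed
    show "emeasure ?p X = emeasure ?q X" if XE: "X \<in> ?E" for X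
    proof -
      obtain p where "X = (\<lambda>(a, b). box a b) p" using XE by blast
      then obtain a b where X: "X = box a b" by (cases p) auto
      let ?f = "\<lambda>x. indicator X x * h x"
      have f: "integrable lborel ?f" using integrable_mult_indicator[OF _ int, of X] X by simp
      then have fin: "(\<integral>\<^sup>+x. ennreal (?f x) \<partial>lborel) \<noteq> \<infinity>" "(\<integral>\<^sup>+x. ennreal (- ?f x) \<partial>lborel) \<noteq> \<infinity>"
        by (auto simp: real_integrable_def)
      have "enn2real (\<integral>\<^sup>+x. ennreal (?f x) \<partial>lborel) = enn2real (\<integral>\<^sup>+x. ennreal (- ?f x) \<partial>lborel)"
        using real_lebesgue_integral_def[OF f] zero[of a b] X by simp
      then have "ennreal (enn2real (\<integral>\<^sup>+x. ennreal (?f x) \<partial>lborel)) = ennreal (enn2real (\<integral>\<^sup>+x. ennreal (- ?f x) \<partial>lborel))"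
        by (rule arg_cong)
      then have eq: "(\<integral>\<^sup>+x. ennreal (?f x) \<partial>lborel) = (\<integral>\<^sup>+x. ennreal (- ?f x) \<partial>lborel)"
        unfolding ennreal_enn2real_if using fin by simp
      have "emeasure ?p X = (\<integral>\<^sup>+x. ennreal (?f x) \<partial>lborel)"
        using X by (subst emeasure_density) (auto intro!: nn_integral_cong split: split_indicator)
      moreover have "emeasure ?q X = (\<integral>\<^sup>+x. ennreal (- ?f x) \<partial>lborel)"
        using X by (subst emeasure_density) (auto intro!: nn_integral_cong split: split_indicator)
      ultimately show ?thesis using eq by simp
    qed
  qed
  then have "AE x in lborel. ennreal (h x) = ennreal (- h x)"
    by (intro sigma_finite_measure.density_unique[OF sigma_finite_lborel]) auto
  then show ?thesis
  proof eventually_elim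
    case (elim x)
    show ?case
    proof (cases "0 \<le> h x")
      case True
      then have "ennreal (- h x) = 0" by (simp add: ennreal_eq_0_iff)
      then have "ennreal (h x) = 0" using elim by simp
      then show ?thesis using True by (simp add: ennreal_eq_0_iff)
    next
      case False
      then have "ennreal (h x) = 0" by (simp add: ennreal_eq_0_iff)
      then show ?thesis using elim False by (simp add: ennreal_eq_0_iff)
    qed
  qed
qed

text \<open>Testing with bumps that converge to the indicator function of a box shows that the integral of \<open>g\<close> over
  every box whose closure lies in \<open>W\<close> vanishes.\<close>

lemma du_Bois_Reymond:
  fixes g :: "real^2 \<Rightarrow> real"
  assumes W: "open W" and g: "locally_integrable W g"
    and zero: "\<And>\<psi>. test_function W \<psi> \<Longrightarrow> (LINT x:W|lebesgue. g x * \<psi> x) = 0"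
  shows "AE x in lebesgue. x \<in> W \<longrightarrow> g x = 0"
proof -
  have box0: "(LINT x:box a b|lebesgue. g x) = 0" if ab: "cbox a b \<subseteq> W" for a b
  proof -
    obtain \<psi> :: "nat \<Rightarrow> real^2 \<Rightarrow> real" where \<psi>: "\<And>n k. Ck k (\<psi> n)" "\<And>n x. 0 \<le> \<psi> n x" "\<And>n x. \<psi> n x \<le> 1"
      "\<And>n x. x \<notin> cbox a b \<Longrightarrow> \<psi> n x = 0" "\<And>x. (\<lambda>n. \<psi> n x) \<longlonglongrightarrow> indicator (box a b) x"
      using box_indicator_limit[of a b] by metis
    have gc: "set_integrable lebesgue (cbox a b) g" using g ab by (auto simp: locally_integrable_def)
    have \<psi>m: "\<psi> n \<in> borel_measurable lebesgue" for n
    proof -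
      have "continuous_on UNIV (\<psi> n)" using \<psi>(1)[of 0 n] by simp
      then show ?thesis by (intro measurable_completion) (simp add: borel_measurable_continuous_onI)
    qed
    have "test_function W (\<psi> n)" for n
      unfolding test_function_def by (intro conjI exI[of _ "cbox a b"]) (use \<psi>(1,4) ab in auto)
    then have z: "(LINT x:W|lebesgue. g x * \<psi> n x) = 0" for n by (rule zero)
    have eq: "indicator W x *\<^sub>R (g x * \<psi> n x) = (indicator (cbox a b) x *\<^sub>R g x) * \<psi> n x" for n x
      using \<psi>(4)[of x n] ab by (auto split: split_indicator)
    have "(\<lambda>n. \<integral>x. (indicator (cbox a b) x *\<^sub>R g x) * \<psi> n x \<partial>lebesgue) \<longlonglongrightarrow>
        (\<integral>x. (indicator (cbox a b) x *\<^sub>R g x) * indicator (box a b) x \<partial>lebesgue)"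
    proof (rule integral_dominated_convergence[where w="\<lambda>x. norm (indicator (cbox a b) x *\<^sub>R g x)"])
      show "(\<lambda>x. (indicator (cbox a b) x *\<^sub>R g x) * indicator (box a b) x) \<in> borel_measurable lebesgue"
        using gc by (intro borel_measurable_times borel_measurable_indicator) (auto simp: set_integrable_def)
      show "(\<lambda>x. (indicator (cbox a b) x *\<^sub>R g x) * \<psi> n x) \<in> borel_measurable lebesgue" for n
        using gc \<psi>m by (intro borel_measurable_times) (auto simp: set_integrable_def)
      show "integrable lebesgue (\<lambda>x. norm (indicator (cbox a b) x *\<^sub>R g x))"
        using gc unfolding set_integrable_def by (rule integrable_norm)
      show "AE x in lebesgue. (\<lambda>n. (indicator (cbox a b) x *\<^sub>R g x) * \<psi> n x) \<longlonglongrightarrow> (indicator (cbox a b) x *\<^sub>R g x) * indicator (box a b) x"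
        by (intro AE_I2 tendsto_mult tendsto_const \<psi>(5))
      show "AE x in lebesgue. norm ((indicator (cbox a b) x *\<^sub>R g x) * \<psi> n x) \<le> norm (indicator (cbox a b) x *\<^sub>R g x)" for n
      proof (rule AE_I2)
        fix x
        have "\<bar>\<psi> n x\<bar> \<le> 1" using \<psi>(2,3)[of n x] by simp
        then show "norm ((indicator (cbox a b) x *\<^sub>R g x) * \<psi> n x) \<le> norm (indicator (cbox a b) x *\<^sub>R g x)"
          unfolding norm_mult real_norm_def[of "\<psi> n x"] by (intro mult_left_le) auto
      qed
    qed
    then have "(\<integral>x. (indicator (cbox a b) x *\<^sub>R g x) * indicator (box a b) x \<partial>lebesgue) = 0"
      using z unfolding set_lebesgue_integral_def eq by (simp add: LIMSEQ_const_iff)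
    also have "(\<lambda>x. (indicator (cbox a b) x *\<^sub>R g x) * indicator (box a b) x) = (\<lambda>x. indicator (box a b) x *\<^sub>R g x)"
      using box_subset_cbox[of a b] by (auto simp: fun_eq_iff indicator_def)
    finally show ?thesis unfolding set_lebesgue_integral_def .
  qed
  have cbox0: "AE x in lebesgue. x \<in> cbox c d \<longrightarrow> g x = 0" if cd: "cbox c d \<subseteq> W" for c d
  proof -
    let ?h = "\<lambda>x. indicator (box c d) x *\<^sub>R g x"
    have "set_integrable lebesgue (cbox c d) g" using g cd by (auto simp: locally_integrable_def)
    then have "set_integrable lebesgue (box c d) g"
      by (rule set_integrable_subset) (auto simp: box_subset_cbox)
    then have hi: "integrable lebesgue ?h" by (simp add: set_integrable_def)
    then obtain h' where h': "h' \<in> borel_measurable lborel" "AE x in lborel. ?h x = h' x"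
      using completion_ex_borel_measurable_real[of ?h lborel] by auto
    have ae: "AE x in lebesgue. ?h x = h' x" using AE_completion[OF h'(2)] .
    have h'l: "h' \<in> borel_measurable lebesgue" using h'(1) by (rule measurable_completion)
    have "integrable lebesgue h'"
      using integrable_cong_AE_imp[OF hi h'l] ae by (auto elim: eventually_mono)
    then have h'i: "integrable lborel h'" using h'(1) by (simp add: integrable_completion)
    have "(\<integral>x. indicator (box a b) x * h' x \<partial>lborel) = 0" for a b
    proof -
      have "(\<integral>x. indicator (box a b) x * h' x \<partial>lborel) = (\<integral>x. indicator (box a b) x * h' x \<partial>lebesgue)"
        using h'(1) by (intro integral_completion[symmetric]) auto
      also have "\<dots> = (\<integral>x. indicator (box a b) x * ?h x \<partial>lebesgue)"
      proof (rule integral_cong_AE)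
        show "(\<lambda>x. indicator (box a b) x * h' x) \<in> borel_measurable lebesgue"
          "(\<lambda>x. indicator (box a b) x * ?h x) \<in> borel_measurable lebesgue"
          by (intro borel_measurable_times[OF _ h'l] borel_measurable_times[OF _ borel_measurable_integrable[OF hi]]
              borel_measurable_indicator; simp)+
      qed (use ae in \<open>auto elim: eventually_mono\<close>)
      also have "\<dots> = (LINT x:box a b \<inter> box c d|lebesgue. g x)"
        unfolding set_lebesgue_integral_def by (intro Bochner_Integration.integral_cong) (auto split: split_indicator)
      also have "\<dots> = 0"
      proof (cases "box a b \<inter> box c d = {}")
        case True then show ?thesis by (simp add: set_lebesgue_integral_def)
      next
        case False
        obtain a' b' where ab': "box a b \<inter> box c d = box a' b'" using box_Int_box[of a b c d] by blast
        then have "box a' b' \<noteq> {}" using False by simp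
        then have "cbox a' b' = closure (box a' b')" by (simp add: closure_box)
        also have "\<dots> \<subseteq> closure (box c d)" using ab' by (intro closure_mono) blast
        also have "\<dots> \<subseteq> cbox c d" by (intro closure_minimal box_subset_cbox closed_cbox)
        finally have "cbox a' b' \<subseteq> W" using cd by blast
        then show ?thesis using box0 ab' by simp
      qed
      finally show ?thesis .
    qed
    then have "AE x in lborel. h' x = 0" by (rule AE_zero_if_box_integrals_zero[OF h'i])
    then have "AE x in lebesgue. h' x = 0" by (rule AE_completion)
    moreover have "AE x in lebesgue. x \<notin> cbox c d - box c d"
    proof -
      have "AE x in lborel. x \<notin> cbox c d - box c d"
        by (rule AE_lborel_negligible[OF negligible_frontier_interval[of c d]])
      then show ?thesis by (rule AE_completion)
    qed
    ultimately show ?thesis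
      using ae by eventually_elim (auto split: split_indicator_asm)
  qed
  obtain \<D> where \<D>: "countable \<D>" "\<And>X. X \<in> \<D> \<Longrightarrow> X \<subseteq> W" "\<And>X. X \<in> \<D> \<Longrightarrow> \<exists>a b. X = cbox a b" "\<Union>\<D> = W"
  proof (rule open_countable_Union_open_cbox[OF W], goal_cases)
    case (1 \<D>)
    show ?case using 1 by (intro that[of \<D>]) auto
  qed
  have "AE x in lebesgue. \<forall>X\<in>\<D>. x \<in> X \<longrightarrow> g x = 0"
    using cbox0 \<D>(2,3) by (subst AE_ball_countable[OF \<D>(1)]) blast
  then show ?thesis by eventually_elim (use \<D>(4) in blast)
qed

section \<open>Weak and classical gradients\<close>

lemma has_derivative_components:
  fixes \<psi> :: "real^2 \<Rightarrow> real"
  assumes "(\<psi> has_derivative D) (at x)"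
  shows "(\<psi> has_derivative (\<lambda>h. (\<chi> j. D (axis j 1)) \<bullet> h)) (at x)"
proof -
  have lin: "linear D" using assms has_derivative_linear by blast
  have "D h = (\<chi> j. D (axis j 1)) \<bullet> h" for h
  proof -
    have h: "h = h $ 1 *\<^sub>R axis 1 1 + h $ 2 *\<^sub>R axis 2 1"
      by (simp add: vec_eq_iff forall_2 axis_def)
    have "D h = D (h $ 1 *\<^sub>R axis 1 1 + h $ 2 *\<^sub>R axis 2 1)" using h by simp
    also have "\<dots> = h $ 1 *\<^sub>R D (axis 1 1) + h $ 2 *\<^sub>R D (axis 2 1)"
      using lin by (simp add: linear_add linear_scale)
    finally show ?thesis by (simp add: inner_vec_def sum_2 mult.commute)
  qed
  then show ?thesis by (intro has_derivative_eq_rhs[OF assms] ext)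
qed

lemma test_function_gradient:
  assumes "test_function \<Omega> \<psi>"
  shows "has_continuous_gradient \<psi> (\<lambda>x. \<chi> j. partial j \<psi> x)"
proof -
  have "Ck (Suc 0) \<psi>" using assms by (simp add: test_function_def)
  then have d: "\<And>x. \<psi> differentiable (at x)" and c: "\<And>j. continuous_on UNIV (partial j \<psi>)" by auto
  have "(\<psi> has_derivative (\<lambda>h. (\<chi> j. partial j \<psi> x) \<bullet> h)) (at x)" for x
    unfolding partial_def using has_derivative_components[OF frechet_derivative_works[THEN iffD1, OF d]] .
  then show ?thesis
    unfolding has_continuous_gradient_def using c by (auto intro!: continuous_on_vec_lambda)
qed

lemma test_function_support:
  assumes "test_function \<Omega> \<psi>"
  obtains C where "compact C" "C \<subseteq> \<Omega>" "\<And>x. x \<notin> C \<Longrightarrow> \<psi> x = 0" "\<And>x j. x \<notin> C \<Longrightarrow> partial j \<psi> x = 0"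
proof -
  obtain C where C: "compact C" "C \<subseteq> \<Omega>" "\<And>x. x \<notin> C \<Longrightarrow> \<psi> x = 0"
    using assms by (auto simp: test_function_def)
  have "partial j \<psi> x = 0" if x: "x \<notin> C" for x j
  proof -
    have "((\<lambda>_. 0) has_derivative (\<lambda>_. 0)) (at x)" by simp
    then have "(\<psi> has_derivative (\<lambda>_. 0)) (at x)"
      by (rule has_derivative_transform_within_open[where s="- C"])
        (use x C in \<open>auto simp: compact_imp_closed\<close>)
    from fun_cong[OF frechet_derivative_at[OF this], of "axis j 1"] show ?thesis by (simp add: partial_def)
  qed
  then show thesis using that C by blast
qed

text \<open>Since \<open>\<psi>\<close> vanishes outside a compact subset of \<open>W\<close>, extending the product by 0 keeps it continuous.\<close>

lemma cutoff_product:
  fixes u \<psi> :: "real^2 \<Rightarrow> real"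
  assumes W: "open W" and u: "continuous_on W u" and \<psi>: "continuous_on UNIV \<psi>"
    and C: "compact C" "C \<subseteq> W" "\<And>x. x \<notin> C \<Longrightarrow> \<psi> x = 0"
  defines "k \<equiv> \<lambda>x. if x \<in> W then u x * \<psi> x else 0"
  shows "continuous_on UNIV k" "integrable lborel k" "(LINT x:W|lebesgue. u x * \<psi> x) = (\<integral>x. k x \<partial>lborel)"
    "integrable lebesgue (\<lambda>x. indicator W x *\<^sub>R (u x * \<psi> x))"
proof -
  have "continuous_on (W \<union> - C) k"
  proof (rule continuous_on_open_Un)
    show "continuous_on W k"
      by (rule continuous_on_eq[OF continuous_on_mult[OF u continuous_on_subset[OF \<psi>]]]) (auto simp: k_def)
    show "continuous_on (- C) k" by (rule continuous_on_eq[of _ "\<lambda>_. 0"]) (auto simp: k_def C)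
  qed (use W C in \<open>auto simp: compact_imp_closed\<close>)
  moreover have "W \<union> - C = UNIV" using C by blast
  ultimately show k: "continuous_on UNIV k" by simp
  have "set_integrable lborel C k"
    unfolding set_integrable_def using C k by (intro borel_integrable_compact) (auto intro: continuous_on_subset)
  moreover have "(\<lambda>x. indicator C x *\<^sub>R k x) = k" using C by (auto simp: k_def fun_eq_iff split: split_indicator)
  ultimately show i: "integrable lborel k" by (simp add: set_integrable_def)
  have eq: "(\<lambda>x. indicator W x *\<^sub>R (u x * \<psi> x)) = k" by (auto simp: k_def fun_eq_iff)
  show "(LINT x:W|lebesgue. u x * \<psi> x) = (\<integral>x. k x \<partial>lborel)"
    unfolding set_lebesgue_integral_def eq using i by (intro integral_completion) auto
  show "integrable lebesgue (\<lambda>x. indicator W x *\<^sub>R (u x * \<psi> x))"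
    unfolding eq using i by (simp add: integrable_completion)
qed

text \<open>Extended by 0, the product of a component of \<open>\<phi>\<close> with \<open>\<psi>\<close> is continuously differentiable with compact support
  on the whole plane, hence Lipschitz, and \<open>integral_gradient_zero\<close> applies.\<close>

lemma classical_gradient_weak:
  fixes \<phi> :: "real^2 \<Rightarrow> real^2" and F :: "real^2 \<Rightarrow> real^2^2"
  assumes W: "open W" and der: "\<And>x. x \<in> W \<Longrightarrow> (\<phi> has_derivative (\<lambda>h. F x *v h)) (at x)"
    and F: "continuous_on W F" and \<psi>: "test_function W \<psi>"
  shows "(LINT x:W|lebesgue. \<phi> x $ i * partial j \<psi> x) = - (LINT x:W|lebesgue. F x $ i $ j * \<psi> x)"
proof -
  obtain C where C: "compact C" "C \<subseteq> W" "\<And>x. x \<notin> C \<Longrightarrow> \<psi> x = 0" "\<And>x j. x \<notin> C \<Longrightarrow> partial j \<psi> x = 0"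
    using test_function_support[OF \<psi>] by blast
  define d where "d x = (\<chi> j. partial j \<psi> x)" for x
  have h: "has_continuous_gradient \<psi> d" unfolding d_def[abs_def] by (rule test_function_gradient[OF \<psi>])
  note c = has_continuous_gradientD[OF h]
  have d0: "d x = 0" if "x \<notin> C" for x using C(4)[OF that] by (simp add: d_def vec_eq_iff)
  have \<phi>c: "continuous_on W \<phi>"
    using der by (intro continuous_at_imp_continuous_on ballI) (meson has_derivative_continuous)
  have \<phi>i: "continuous_on W (\<lambda>x. \<phi> x $ i)" and Fij: "continuous_on W (\<lambda>x. F x $ i $ j)" for i j
    using \<phi>c F by (auto intro!: continuous_intros)
  define f where "f x = (if x \<in> W then \<phi> x $ i * \<psi> x else 0)" for x
  define k1 where "k1 j x = (if x \<in> W then \<phi> x $ i * d x $ j else 0)" for j x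
  define k2 where "k2 j x = (if x \<in> W then F x $ i $ j * \<psi> x else 0)" for j x
  define g where "g x = (\<chi> j. k1 j x + k2 j x)" for x
  have K1: "continuous_on UNIV (k1 j)" "integrable lborel (k1 j)" "(LINT x:W|lebesgue. \<phi> x $ i * d x $ j) = (\<integral>x. k1 j x \<partial>lborel)" for j
    unfolding k1_def[abs_def] using cutoff_product[OF W \<phi>i c(3) C(1,2)] d0 by auto
  have K2: "continuous_on UNIV (k2 j)" "integrable lborel (k2 j)" "(LINT x:W|lebesgue. F x $ i $ j * \<psi> x) = (\<integral>x. k2 j x \<partial>lborel)" for j
    unfolding k2_def[abs_def] using cutoff_product[OF W Fij c(1) C(1,2)] C(3) by auto
  have gc: "continuous_on UNIV g"
    unfolding g_def[abs_def] by (intro continuous_on_vec_lambda continuous_intros K1 K2)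
  have g0: "g x = 0" if "x \<notin> C" for x
    using that C(3)[OF that] d0[OF that] by (simp add: g_def k1_def k2_def vec_eq_iff)
  have fder: "(f has_derivative (\<lambda>h. g x \<bullet> h)) (at x)" for x
  proof (cases "x \<in> W")
    case True
    have "((\<lambda>y. \<phi> y $ i) has_derivative (\<lambda>h. (F x *v h) $ i)) (at x)"
      using bounded_linear.has_derivative[OF bounded_linear_vec_nth der[OF True]] .
    moreover have "(\<psi> has_derivative (\<lambda>h. d x \<bullet> h)) (at x)" using h by (simp add: has_continuous_gradient_def)
    ultimately have "((\<lambda>y. \<phi> y $ i * \<psi> y) has_derivative (\<lambda>h. \<phi> x $ i * (d x \<bullet> h) + (F x *v h) $ i * \<psi> x)) (at x)"
      by (rule has_derivative_mult)
    also have "(\<lambda>h. \<phi> x $ i * (d x \<bullet> h) + (F x *v h) $ i * \<psi> x) = (\<lambda>h. g x \<bullet> h)"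
      using True by (simp add: fun_eq_iff g_def k1_def k2_def inner_vec_def sum_2 matrix_vector_mult_def algebra_simps)
    finally show ?thesis
      by (rule has_derivative_transform_within_open[OF _ W True]) (simp add: f_def)
  next
    case False
    then have xC: "x \<in> - C" using C by blast
    have "((\<lambda>_. 0) has_derivative (\<lambda>h. g x \<bullet> h)) (at x)" using g0 xC by simp
    then show ?thesis
      by (rule has_derivative_transform_within_open[OF _ _ xC]) (use C in \<open>auto simp: f_def compact_imp_closed\<close>)
  qed
  have "compact (g ` C)" using gc C by (intro compact_continuous_image) (auto intro: continuous_on_subset)
  then obtain M where M: "\<And>x. x \<in> C \<Longrightarrow> norm (g x) \<le> M" by (force dest!: compact_imp_bounded simp: bounded_iff)
  have gM: "norm (g x) \<le> \<bar>M\<bar>" for x using M[of x] g0[of x] by (cases "x \<in> C") auto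
  have lip: "\<bar>f x - f y\<bar> \<le> \<bar>M\<bar> * norm (x - y)" for x y
  proof -
    have "norm (f x - f y) \<le> \<bar>M\<bar> * norm (x - y)"
    proof (rule differentiable_bound[of UNIV f "\<lambda>x h. g x \<bullet> h"])
      fix x show "onorm (\<lambda>h. g x \<bullet> h) \<le> \<bar>M\<bar>"
      proof (rule onorm_le)
        fix v show "norm (g x \<bullet> v) \<le> \<bar>M\<bar> * norm v"
          using Cauchy_Schwarz_ineq2[of "g x" v] mult_right_mono[OF gM[of x], of "norm v"] by auto
      qed
    qed (use fder in auto)
    then show ?thesis by simp
  qed
  obtain \<rho> where \<rho>: "C \<subseteq> ball 0 \<rho>" using bounded_subset_ballD[OF compact_imp_bounded[OF C(1)]] by blast
  have "f x = 0" if "x \<notin> ball 0 \<rho>" for x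
  proof -
    have "x \<notin> C" using that \<rho> by blast
    then show ?thesis using C(3) by (simp add: f_def)
  qed
  from integral_gradient_zero[where e = "axis j 1", OF lip this AE_I2[OF fder] borel_measurable_continuous_onI[OF gc]]
  have "(\<integral>x. k1 j x + k2 j x \<partial>lborel) = 0" by (simp add: g_def inner_axis)
  then have "(\<integral>x. k1 j x \<partial>lborel) = - (\<integral>x. k2 j x \<partial>lborel)" using K1 K2 by simp
  then show ?thesis using K1(3)[of j] K2(3)[of j] by (simp add: d_def)
qed

lemma locally_integrable_component:
  assumes "locally_integrable \<Omega> G"
  shows "locally_integrable \<Omega> (\<lambda>x. G x $ i)"
  unfolding locally_integrable_def set_integrable_def
proof (intro allI impI)
  fix C assume "compact C \<and> C \<subseteq> \<Omega>"
  then have "integrable lebesgue (\<lambda>x. indicator C x *\<^sub>R G x)"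
    using assms by (auto simp: locally_integrable_def set_integrable_def)
  then have "integrable lebesgue (\<lambda>x. (indicator C x *\<^sub>R G x) $ i)"
    by (rule integrable_bounded_linear[OF bounded_linear_vec_nth])
  then show "integrable lebesgue (\<lambda>x. indicator C x *\<^sub>R G x $ i)" by simp
qed

lemma locally_integrable_times_compact:
  fixes u \<psi> :: "real^2 \<Rightarrow> real"
  assumes u: "locally_integrable \<Omega> u" and \<psi>: "continuous_on UNIV \<psi>"
    and C: "compact C" "C \<subseteq> \<Omega>" "\<And>x. x \<notin> C \<Longrightarrow> \<psi> x = 0"
  shows "set_integrable lebesgue \<Omega> (\<lambda>x. u x * \<psi> x)"
proof -
  have iu: "integrable lebesgue (\<lambda>x. indicator C x *\<^sub>R u x)"
    using u C by (auto simp: locally_integrable_def set_integrable_def)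
  have "compact (\<psi> ` C)" using \<psi> C by (intro compact_continuous_image) (auto intro: continuous_on_subset)
  then obtain B where B: "\<And>x. x \<in> C \<Longrightarrow> \<bar>\<psi> x\<bar> \<le> B" by (force dest!: compact_imp_bounded simp: bounded_iff)
  have \<psi>m: "\<psi> \<in> borel_measurable lebesgue"
    using \<psi> by (intro measurable_completion) (simp add: borel_measurable_continuous_onI)
  have "integrable lebesgue (\<lambda>x. (indicator C x *\<^sub>R u x) * \<psi> x)"
  proof (rule Bochner_Integration.integrable_bound)
    show "integrable lebesgue (\<lambda>x. \<bar>B\<bar> * (indicator C x *\<^sub>R u x))" using iu by (rule integrable_mult_right)
    show "(\<lambda>x. (indicator C x *\<^sub>R u x) * \<psi> x) \<in> borel_measurable lebesgue"
      using iu \<psi>m by (intro borel_measurable_times) auto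
    show "AE x in lebesgue. norm ((indicator C x *\<^sub>R u x) * \<psi> x) \<le> norm (\<bar>B\<bar> * (indicator C x *\<^sub>R u x))"
    proof (rule AE_I2)
      fix x
      show "norm ((indicator C x *\<^sub>R u x) * \<psi> x) \<le> norm (\<bar>B\<bar> * (indicator C x *\<^sub>R u x))"
      proof (cases "x \<in> C")
        case True
        have "\<bar>u x\<bar> * \<bar>\<psi> x\<bar> \<le> \<bar>u x\<bar> * \<bar>B\<bar>" using B[OF True] by (intro mult_left_mono) auto
        then show ?thesis using True by (simp add: abs_mult mult.commute)
      qed simp
    qed
  qed
  moreover have "(\<lambda>x. (indicator C x *\<^sub>R u x) * \<psi> x) = (\<lambda>x. indicator \<Omega> x *\<^sub>R (u x * \<psi> x))"
    using C by (intro ext) (auto split: split_indicator)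
  ultimately show ?thesis unfolding set_integrable_def by (simp only:)
qed

text \<open>Connects the hypothesis of the theorem, which concerns the weak gradient, with the construction, which needs a
  gradient that is continuous on an open set.\<close>

lemma weak_gradient_eq_classical_AE:
  fixes \<phi> :: "real^2 \<Rightarrow> real^2" and F :: "real^2 \<Rightarrow> real^2^2"
  assumes W: "open W" "W \<subseteq> \<Omega>" and der: "\<And>x. x \<in> W \<Longrightarrow> (\<phi> has_derivative (\<lambda>h. F x *v h)) (at x)"
    and F: "continuous_on W F" and D: "has_weak_gradient \<Omega> \<phi> D\<phi>"
  shows "AE x in lebesgue. x \<in> W \<longrightarrow> D\<phi> x = F x"
proof -
  have comp: "AE x in lebesgue. x \<in> W \<longrightarrow> D\<phi> x $ i $ j - F x $ i $ j = 0" for i j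
  proof (rule du_Bois_Reymond[OF W(1)])
    have DW: "locally_integrable W (\<lambda>x. D\<phi> x $ i $ j)"
    proof -
      have "locally_integrable W D\<phi>" using D W(2) by (auto simp: has_weak_gradient_def locally_integrable_def)
      then show ?thesis by (intro locally_integrable_component)
    qed
    have FW: "locally_integrable W (\<lambda>x. F x $ i $ j)"
      unfolding locally_integrable_def
    proof (intro allI impI)
      fix C assume C: "compact C \<and> C \<subseteq> W"
      have "integrable lborel (\<lambda>x. indicator C x *\<^sub>R F x $ i $ j)"
        using C F by (intro borel_integrable_compact) (auto intro!: continuous_intros intro: continuous_on_subset)
      then show "set_integrable lebesgue C (\<lambda>x. F x $ i $ j)"
        unfolding set_integrable_def by (subst integrable_completion) auto
    qed
    show "locally_integrable W (\<lambda>x. D\<phi> x $ i $ j - F x $ i $ j)"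
      using DW FW unfolding locally_integrable_def by (auto intro: set_integral_diff)
    fix \<psi> assume \<psi>: "test_function W \<psi>"
    obtain C where C: "compact C" "C \<subseteq> W" "\<And>x. x \<notin> C \<Longrightarrow> \<psi> x = 0" "\<And>x j. x \<notin> C \<Longrightarrow> partial j \<psi> x = 0"
      using test_function_support[OF \<psi>] by blast
    have \<psi>\<Omega>: "test_function \<Omega> \<psi>" using \<psi> W(2) by (auto simp: test_function_def)
    have \<psi>c: "continuous_on UNIV \<psi>" using has_continuous_gradientD(1)[OF test_function_gradient[OF \<psi>]] .
    have i1: "set_integrable lebesgue W (\<lambda>x. D\<phi> x $ i $ j * \<psi> x)"
      by (rule locally_integrable_times_compact[OF DW \<psi>c C(1-3)])
    have i2: "set_integrable lebesgue W (\<lambda>x. F x $ i $ j * \<psi> x)"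
      by (rule locally_integrable_times_compact[OF FW \<psi>c C(1-3)])
    have restr: "(LINT x:\<Omega>|lebesgue. q x * p x) = (LINT x:W|lebesgue. q x * p x)" if "\<And>x. x \<notin> C \<Longrightarrow> p x = 0"
      for q p :: "real^2 \<Rightarrow> real"
      unfolding set_lebesgue_integral_def
    proof (rule Bochner_Integration.integral_cong[OF refl])
      fix x show "indicator \<Omega> x *\<^sub>R (q x * p x) = indicator W x *\<^sub>R (q x * p x)"
        using that[of x] C(2) W(2) by (cases "x \<in> C") (auto split: split_indicator)
    qed
    have "(LINT x:W|lebesgue. D\<phi> x $ i $ j * \<psi> x) = (LINT x:\<Omega>|lebesgue. D\<phi> x $ i $ j * \<psi> x)"
      by (rule restr[symmetric]) (rule C(3))
    also have "\<dots> = - (LINT x:\<Omega>|lebesgue. \<phi> x $ i * partial j \<psi> x)"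
      using D \<psi>\<Omega> by (simp add: has_weak_gradient_def)
    also have "(LINT x:\<Omega>|lebesgue. \<phi> x $ i * partial j \<psi> x) = (LINT x:W|lebesgue. \<phi> x $ i * partial j \<psi> x)"
      by (rule restr) (rule C(4))
    also have "\<dots> = - (LINT x:W|lebesgue. F x $ i $ j * \<psi> x)"
      by (rule classical_gradient_weak[OF W(1) der F \<psi>])
    finally have "(LINT x:W|lebesgue. D\<phi> x $ i $ j * \<psi> x) = (LINT x:W|lebesgue. F x $ i $ j * \<psi> x)" by simp
    then show "(LINT x:W|lebesgue. (D\<phi> x $ i $ j - F x $ i $ j) * \<psi> x) = 0"
      using set_integral_diff(2)[OF i1 i2] by (simp add: left_diff_distrib)
  qed
  have "AE x in lebesgue. \<forall>i j. x \<in> W \<longrightarrow> D\<phi> x $ i $ j - F x $ i $ j = 0"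
    unfolding AE_all_countable using comp by blast
  then show ?thesis by eventually_elim (simp add: vec_eq_iff)
qed

lemma bounded_borel_locally_integrable:
  fixes G :: "real^2 \<Rightarrow> 'b::euclidean_space"
  assumes "G \<in> borel_measurable borel" "\<And>x. norm (G x) \<le> M"
  shows "locally_integrable \<Omega> G"
  unfolding locally_integrable_def
proof (intro allI impI)
  fix C assume C: "compact C \<and> C \<subseteq> \<Omega>"
  have "0 \<le> M" using assms(2)[of 0] norm_ge_zero order_trans by blast
  then have "integrable lborel (\<lambda>x. indicator C x *\<^sub>R G x)"
    using assms C
    by (intro integrable_bounded_support[where D=C and M=M] borel_measurable_scaleR borel_measurable_indicator)
      (auto simp: compact_imp_bounded compact_imp_closed split: split_indicator)
  then show "set_integrable lebesgue C G"
    unfolding set_integrable_def by (subst integrable_completion) auto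
qed

lemma has_weak_gradient_add:
  assumes "has_weak_gradient \<Omega> u G" "has_weak_gradient \<Omega> v H"
  shows "has_weak_gradient \<Omega> (\<lambda>x. u x + v x) (\<lambda>x. G x + H x)"
proof -
  have li: "locally_integrable \<Omega> u" "locally_integrable \<Omega> v" "locally_integrable \<Omega> G" "locally_integrable \<Omega> H"
    using assms by (auto simp: has_weak_gradient_def)
  have "(LINT x:\<Omega>|lebesgue. (u x + v x) $ i * partial j \<psi> x) = - (LINT x:\<Omega>|lebesgue. (G x + H x) $ i $ j * \<psi> x)"
    if \<psi>: "test_function \<Omega> \<psi>" for \<psi> i j
  proof -
    obtain C where C: "compact C" "C \<subseteq> \<Omega>" "\<And>x. x \<notin> C \<Longrightarrow> \<psi> x = 0" "\<And>x j. x \<notin> C \<Longrightarrow> partial j \<psi> x = 0"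
      using test_function_support[OF \<psi>] by blast
    have c: "continuous_on UNIV \<psi>" "continuous_on UNIV (partial j \<psi>)"
      using has_continuous_gradientD[OF test_function_gradient[OF \<psi>]] by auto
    have i: "set_integrable lebesgue \<Omega> (\<lambda>x. u x $ i * partial j \<psi> x)" "set_integrable lebesgue \<Omega> (\<lambda>x. v x $ i * partial j \<psi> x)"
      "set_integrable lebesgue \<Omega> (\<lambda>x. G x $ i $ j * \<psi> x)" "set_integrable lebesgue \<Omega> (\<lambda>x. H x $ i $ j * \<psi> x)"
      using li c C by (auto intro!: locally_integrable_times_compact[where C=C] locally_integrable_component)
    show ?thesis
      using assms \<psi> set_integral_add(2)[OF i(1,2)] set_integral_add(2)[OF i(3,4)]
      by (simp add: has_weak_gradient_def distrib_right)
  qed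
  moreover have "locally_integrable \<Omega> (\<lambda>x. u x + v x)" "locally_integrable \<Omega> (\<lambda>x. G x + H x)"
    using li by (auto simp: locally_integrable_def intro: set_integral_add)
  ultimately show ?thesis by (simp add: has_weak_gradient_def)
qed

text \<open>The sets \<open>D n\<close> may have unbounded union, so the test functions now need compact support to make the integrals
  exist.\<close>

lemma glue_has_weak_gradient:
  assumes disj: "disjoint_family D" and D: "\<And>n. D n \<in> sets borel" "\<And>n. D n \<subseteq> \<Omega>"
    and P: "\<And>n. perturbation (D n) (w n) (G n)"
    and c: "\<And>n x. norm (w n x) \<le> c n" "c \<longlonglongrightarrow> 0" and C: "\<And>n. c n \<le> C" and M: "\<And>n x. norm (G n x) \<le> M"
  shows "has_weak_gradient \<Omega> (glue D w) (glue D G)" "continuous_on UNIV (glue D w)"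
    "glue D G \<in> borel_measurable borel" "norm (glue D w x) \<le> C" "norm (glue D G x) \<le> M"
proof -
  show cont: "continuous_on UNIV (glue D w)"
    by (rule continuous_on_glue[OF disj _ _ c]) (use perturbationD[OF P] in auto)
  show Gm: "glue D G \<in> borel_measurable borel"
    by (rule borel_measurable_glue[OF disj]) (use perturbationD[OF P] in auto)
  show wC: "norm (glue D w x) \<le> C" for x
    by (rule glue_norm_le[OF disj]) (use c(1) C in \<open>meson order_trans\<close>)
  show GM: "norm (glue D G x) \<le> M" for x by (rule glue_norm_le[OF disj M])
  have wm: "glue D w \<in> borel_measurable borel" using cont by (rule borel_measurable_continuous_onI)
  note [measurable] = Gm wm
  have "(LINT x:\<Omega>|lebesgue. glue D w x $ i * partial j \<psi> x) = - (LINT x:\<Omega>|lebesgue. glue D G x $ i $ j * \<psi> x)"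
    if \<psi>: "test_function \<Omega> \<psi>" for \<psi> i j
  proof -
    obtain X where X: "compact X" "X \<subseteq> \<Omega>" "\<And>x. x \<notin> X \<Longrightarrow> \<psi> x = 0" "\<And>x j. x \<notin> X \<Longrightarrow> partial j \<psi> x = 0"
      using test_function_support[OF \<psi>] by blast
    have h: "has_continuous_gradient \<psi> (\<lambda>x. \<chi> j. partial j \<psi> x)" by (rule test_function_gradient[OF \<psi>])
    have c: "continuous_on UNIV \<psi>" "continuous_on UNIV (partial j \<psi>)"
      using has_continuous_gradientD[OF h] by auto
    then have [measurable]: "\<psi> \<in> borel_measurable borel" "partial j \<psi> \<in> borel_measurable borel"
      by (auto intro: borel_measurable_continuous_onI)
    have "compact (\<psi> ` X)" "compact (partial j \<psi> ` X)"
      using c X by (auto intro!: compact_continuous_image intro: continuous_on_subset)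
    then obtain B1 B2 where "\<forall>y\<in>\<psi> ` X. norm y \<le> B1" "\<forall>y\<in>partial j \<psi> ` X. norm y \<le> B2"
      by (meson bounded_iff compact_imp_bounded)
    then have B: "\<bar>\<psi> x\<bar> \<le> \<bar>B1\<bar>" "\<bar>partial j \<psi> x\<bar> \<le> \<bar>B2\<bar>" for x
      using X(3)[of x] X(4)[of x j] by (cases "x \<in> X"; force)+
    have CM: "0 \<le> C" "0 \<le> M" using wC[of 0] GM[of 0] norm_ge_zero order_trans by blast+
    have I1: "integrable lborel (\<lambda>x. glue D w x $ i * partial j \<psi> x)"
    proof (rule integrable_bounded_support[where D=X and M="C * \<bar>B2\<bar>"])
      fix x
      have "\<bar>glue D w x $ i\<bar> \<le> C" using wC[of x] component_le_norm_cart[of "glue D w x" i] by linarith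
      then show "norm (glue D w x $ i * partial j \<psi> x) \<le> C * \<bar>B2\<bar>"
        using B(2)[of x] CM by (simp add: abs_mult mult_mono)
    qed (use X in \<open>auto simp: compact_imp_bounded\<close>)
    have I2: "integrable lborel (\<lambda>x. glue D G x $ i $ j * \<psi> x)"
    proof (rule integrable_bounded_support[where D=X and M="M * \<bar>B1\<bar>"])
      fix x
      have "\<bar>glue D G x $ i $ j\<bar> \<le> M"
        using GM[of x] Finite_Cartesian_Product.norm_nth_le[of "glue D G x" i]
          Finite_Cartesian_Product.norm_nth_le[of "glue D G x $ i" j] by simp
      then show "norm (glue D G x $ i $ j * \<psi> x) \<le> M * \<bar>B1\<bar>"
        using B(1)[of x] CM by (simp add: abs_mult mult_mono)
    qed (use X in \<open>auto simp: compact_imp_bounded\<close>)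
    have restr: "(LINT x:\<Omega>|lebesgue. q x * p x) = (\<integral>x. q x * p x \<partial>lborel)"
      if "\<And>x. x \<notin> X \<Longrightarrow> p x = 0" "integrable lborel (\<lambda>x. q x * p x)" for q p :: "real^2 \<Rightarrow> real"
    proof -
      have "(\<lambda>x. indicator \<Omega> x *\<^sub>R (q x * p x)) = (\<lambda>x. q x * p x)"
      proof
        fix x show "indicator \<Omega> x *\<^sub>R (q x * p x) = q x * p x"
          using that(1)[of x] X(2) by (cases "x \<in> X") (auto split: split_indicator)
      qed
      then have "(LINT x:\<Omega>|lebesgue. q x * p x) = (\<integral>x. q x * p x \<partial>lebesgue)"
        unfolding set_lebesgue_integral_def by (simp only:)
      also have "\<dots> = (\<integral>x. q x * p x \<partial>lborel)" using that(2) by (intro integral_completion) auto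
      finally show ?thesis .
    qed
    have "(\<integral>x. glue D w x $ i * partial j \<psi> x \<partial>lborel) = - (\<integral>x. glue D G x $ i $ j * \<psi> x \<partial>lborel)"
      using glue_weak_identity[OF disj D(1) P h, of i j] I1 I2 by simp
    then show ?thesis
      using restr[of "partial j \<psi>", OF X(4) I1] restr[of \<psi>, OF X(3) I2] by simp
  qed
  then show "has_weak_gradient \<Omega> (glue D w) (glue D G)"
    unfolding has_weak_gradient_def
    using bounded_borel_locally_integrable[OF wm wC] bounded_borel_locally_integrable[OF Gm GM] by blast
qed

section \<open>The differential inclusion\<close>

theorem theorem1p1:
  fixes K :: "(real \<times> real) set" and E :: "(real^2^2) set"
    and \<Omega> :: "(real^2) set" and \<phi> :: "real^2 \<Rightarrow> real^2" and D\<phi> :: "real^2 \<Rightarrow> real^2^2"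
  assumes "K \<subseteq> {(x, y). 0 \<le> x \<and> x \<le> y}" and "compact K"
    and "K \<noteq> {}" and "0 < (INF p\<in>K. fst p)"
    and "E = {\<xi>. (sv1 \<xi>, sv2 \<xi>) \<in> K}"
    and "open \<Omega>"
    and "C1_piec \<Omega> \<phi>"
    and "has_weak_gradient \<Omega> \<phi> D\<phi>"
    and "AE x in lebesgue_on \<Omega>. D\<phi> x \<in> E \<union> interior (Rco E)"
  shows "\<exists>u Du. (\<lambda>x. u x - \<phi> x) \<in> W1inf_zero \<Omega> \<and>
           has_weak_gradient \<Omega> u Du \<and>
           (AE x in lebesgue_on \<Omega>. Du x \<in> E)"
proof -
  have E: "E = singular_value_set K" using assms(5) by (simp add: singular_value_set_def)
  have K: "0 < x \<and> x \<le> y" if "(x, y) \<in> K" for x y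
  proof -
    have "(INF p\<in>K. fst p) \<le> fst (x, y)"
      using assms(1) that by (intro cINF_lower) (auto intro!: bdd_belowI[of _ 0])
    then show ?thesis using assms(1,4) that by auto
  qed
  have bK: "bounded K" and cK: "closed K" using assms(2) by (auto simp: compact_imp_bounded compact_imp_closed)
  obtain x0 y0 where "(x0, y0) \<in> K" using assms(3) by auto
  then have Ene: "E \<noteq> {}" unfolding E using K[of x0 y0] by (intro singular_value_set_nonempty) auto
  have Ecl: "closed E" unfolding E by (rule closed_singular_value_set[OF cK])
  define U where "U = interior (lamination_hull E)"
  have RU: "interior (Rco E) \<subseteq> U"
    unfolding U_def by (rule interior_mono[OF Rco_subset_lamination_hull])
  have good: "approximable U E \<epsilon> X" if "X \<in> U" "\<epsilon> > 0" for X \<epsilon>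
    using interior_hull_approximable[OF K bK] that unfolding U_def E by blast
  obtain R where R: "R > 0" "\<And>X. X \<in> E \<Longrightarrow> norm X \<le> R"
    using bounded_singular_value_set[OF bK] bounded_pos unfolding E by blast
  have "lamination_hull E \<subseteq> cball 0 R" by (rule lamination_hull_subset_convex) (use R in auto)
  then have UR: "norm X \<le> R" if "X \<in> U" for X
    using that interior_subset[of "lamination_hull E"] unfolding U_def by auto
  obtain \<F> where "(\<forall>V\<in>\<F>. open V \<and> V \<subseteq> \<Omega> \<and> C1_closure V \<phi>) \<and> negligible (\<Omega> - \<Union>\<F>)"
    using assms(7) unfolding C1_piec_def by (elim conjE exE) (rule that, intro conjI)
  then have FF: "\<And>V. V \<in> \<F> \<Longrightarrow> open V \<and> V \<subseteq> \<Omega> \<and> C1_closure V \<phi>" "negligible (\<Omega> - \<Union>\<F>)" by auto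
  define W where "W = \<Union>\<F>"
  define F where "F x = matrix (frechet_derivative \<phi> (at x))" for x
  have W: "open W" "W \<subseteq> \<Omega>" "negligible (\<Omega> - W)" using FF by (auto simp: W_def)
  have piece: "(\<forall>x\<in>V. (\<phi> has_derivative (\<lambda>h. F x *v h)) (at x)) \<and> continuous_on V F" if VF: "V \<in> \<F>" for V
  proof -
    obtain G :: "real^2 \<Rightarrow> real^2^2" where G: "continuous_on (closure V) G" "\<forall>x\<in>V. (\<phi> has_derivative (\<lambda>h. G x *v h)) (at x)"
      using FF(1)[OF VF] unfolding C1_closure_def by blast
    have eq: "F x = G x" if "x \<in> V" for x
    proof -
      have "frechet_derivative \<phi> (at x) = (\<lambda>h. G x *v h)"
        using frechet_derivative_at[of \<phi> _ x] G(2) that by metis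
      then show ?thesis by (simp add: F_def matrix_of_matrix_vector_mul)
    qed
    have "continuous_on V G" using G(1) closure_subset continuous_on_subset by blast
    then have "continuous_on V F" by (rule continuous_on_eq) (simp add: eq)
    then show ?thesis using G(2) eq by simp
  qed
  have der: "(\<phi> has_derivative (\<lambda>h. F x *v h)) (at x)" if "x \<in> W" for x using piece that by (auto simp: W_def)
  have Fc: "continuous_on W F" unfolding W_def using piece FF(1) by (intro continuous_on_open_Union) auto
  have FD: "AE x in lebesgue. x \<in> W \<longrightarrow> D\<phi> x = F x"
    by (rule weak_gradient_eq_classical_AE[OF W(1,2) der Fc assms(8)])
  define Q where "Q = F -` interior (Rco E) \<inter> W"
  have Qo: "open Q"
    unfolding Q_def using Fc W(1) continuous_on_open_vimage[OF W(1)] by blast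
  \<comment> \<open>Open annuli make the pieces bounded and disjoint; only the circles of integer radius, a null set, are lost.\<close>
  define D where "D n = Q \<inter> {x. real n < norm x \<and> norm x < real n + 1}" for n :: nat
  have Do: "open (D n)" for n
    unfolding D_def using Qo by (intro open_Int open_Collect_conj open_Collect_less continuous_intros)
  have Db: "bounded (D n)" for n
    by (rule bounded_subset[OF bounded_ball[of 0 "real n + 1"]]) (auto simp: D_def)
  have Dd: "disjoint_family D"
  proof -
    have "m = n" if "x \<in> D m" "x \<in> D n" for m n x
    proof -
      have "real m < real n + 1" "real n < real m + 1" using that by (auto simp: D_def)
      then show ?thesis by linarith
    qed
    then show ?thesis by (auto simp: disjoint_family_on_def)
  qed
  have DW: "D n \<subseteq> W" "\<And>x. x \<in> D n \<Longrightarrow> F x \<in> U" for n using RU by (auto simp: D_def Q_def)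
  define sol where "sol n w G \<longleftrightarrow> perturbation (D n) w G \<and> (\<forall>x. norm (w x) \<le> (1 / 2) ^ n) \<and>
      (\<forall>x. norm (G x) \<le> 2 * R) \<and> (AE x in lborel. x \<in> D n \<longrightarrow> F x + G x \<in> E)" for n w G
  have "\<exists>w G. sol n w G" for n
  proof (rule exact_solution_bounded[where O'="D n" and F=F and U=U and E=E and R=R and \<delta>="(1 / 2) ^ n"], goal_cases)
    case (11 w G)
    then show ?case unfolding sol_def by blast
  qed (use Do Db continuous_on_subset[OF Fc DW(1)] DW(2) good UR Ecl Ene R in auto)
  then obtain w G where "\<And>n. sol n (w n) (G n)" by metis
  then have wG: "\<And>n. perturbation (D n) (w n) (G n)" "\<And>n x. norm (w n x) \<le> (1 / 2) ^ n"
    "\<And>n x. norm (G n x) \<le> 2 * R" "\<And>n. AE x in lborel. x \<in> D n \<longrightarrow> F x + G n x \<in> E"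
    unfolding sol_def by blast+
  define v H where "v = glue D w" and "H = glue D G"
  have D\<Omega>: "D n \<subseteq> \<Omega>" and Dm: "D n \<in> sets borel" for n using DW(1) W(2) Do by auto
  have lim0: "(\<lambda>n. (1 / 2) ^ n :: real) \<longlonglongrightarrow> 0" by (rule LIMSEQ_power_zero) auto
  have le1: "(1 / 2) ^ n \<le> (1::real)" for n by (simp add: power_le_one)
  note gl = glue_has_weak_gradient[OF Dd Dm D\<Omega> wG(1,2) lim0 le1 wG(3), folded v_def H_def]
  have leb: "f \<in> borel_measurable borel \<Longrightarrow> f \<in> borel_measurable (lebesgue_on \<Omega>)" for f :: "real^2 \<Rightarrow> 'z::euclidean_space"
    by (simp add: measurable_completion measurable_restrict_space1)
  have "Linf \<Omega> v" "Linf \<Omega> H"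
    unfolding Linf_def using gl leb borel_measurable_continuous_onI[OF gl(2)] by (auto intro!: exI)
  then have W1: "v \<in> W1inf \<Omega>" using gl(1) by (auto simp: W1inf_def)
  have "(v \<longlongrightarrow> 0) (at z within \<Omega>)" if "z \<in> frontier \<Omega>" for z
  proof -
    have "z \<notin> \<Omega>" using that assms(6) by (simp add: frontier_def interior_open)
    then have "v z = 0" unfolding v_def using D\<Omega> by (intro glue_outside) auto
    moreover have "(v \<longlongrightarrow> v z) (at z within \<Omega>)"
      using gl(2) by (meson UNIV_I continuous_on_def tendsto_within_subset top_greatest)
    ultimately show ?thesis by simp
  qed
  then have zero: "v \<in> W1inf_zero \<Omega>"
    using W1 continuous_on_subset[OF gl(2)] by (auto simp: W1inf_zero_def intro!: exI[of _ v])
  have wg: "has_weak_gradient \<Omega> (\<lambda>x. \<phi> x + v x) (\<lambda>x. D\<phi> x + H x)"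
    by (rule has_weak_gradient_add[OF assms(8) gl(1)])
  have \<Omega>m: "\<Omega> \<in> sets lebesgue" using assms(6) by auto
  have a1: "AE x in lebesgue. x \<in> \<Omega> \<longrightarrow> D\<phi> x \<in> E \<union> interior (Rco E)"
    using assms(9) \<Omega>m by (simp add: AE_restrict_space_iff)
  have a2: "AE x in lebesgue. \<forall>n. x \<in> D n \<longrightarrow> F x + G n x \<in> E"
    using AE_completion[OF wG(4)] by (simp add: AE_all_countable)
  have a3: "AE x in lebesgue. x \<notin> (\<Omega> - W) \<union> (\<Union>n::nat. sphere 0 (real n))"
  proof -
    have "negligible ((\<Omega> - W) \<union> (\<Union>n::nat. sphere 0 (real n)))"
      using W(3) by (intro negligible_Un negligible_countable_Union) (auto simp: negligible_sphere)
    from AE_lborel_negligible[OF this, of "\<lambda>x. x \<notin> (\<Omega> - W) \<union> (\<Union>n::nat. sphere 0 (real n))"]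
    show ?thesis by (intro AE_completion) blast
  qed
  have "AE x in lebesgue. x \<in> \<Omega> \<longrightarrow> D\<phi> x + H x \<in> E"
    using FD a1 a2 a3
  proof eventually_elim
    case (elim x)
    show ?case
    proof
      assume x: "x \<in> \<Omega>"
      then have xW: "x \<in> W" and ns: "\<And>n::nat. norm x \<noteq> real n" using elim(4) by auto
      show "D\<phi> x + H x \<in> E"
      proof (cases "F x \<in> interior (Rco E)")
        case True
        define n where "n = nat \<lfloor>norm x\<rfloor>"
        have "real n = of_int \<lfloor>norm x\<rfloor>" by (simp add: n_def)
        then have "real n \<le> norm x" "norm x < real n + 1" by linarith+
        then have "x \<in> D n" using ns[of n] True xW by (auto simp: D_def Q_def)
        then have "F x + G n x \<in> E" "H x = G n x" using elim(3) glue_inside[OF Dd] by (auto simp: H_def)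
        then show ?thesis using elim(1) xW by simp
      next
        case False
        then have "H x = 0" unfolding H_def by (intro glue_outside) (auto simp: D_def Q_def)
        then show ?thesis using False elim(1,2) x xW by auto
      qed
    qed
  qed
  then have "AE x in lebesgue_on \<Omega>. D\<phi> x + H x \<in> E"
    using \<Omega>m by (simp add: AE_restrict_space_iff)
  then show ?thesis
    using zero wg by (intro exI[of _ "\<lambda>x. \<phi> x + v x"] exI[of _ "\<lambda>x. D\<phi> x + H x"]) simp
qed

thm_deps theorem1p1

end
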